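(* Consider a planar $4$-web given, in local coordinates $(x,y)$, by web functions $f_1=x$, $f_2=y$, $f_3(x,y)$, $f_4(x,y)$. Put $$\operatorname{Flex} f=f_y^2f_{xx}-2f_xf_yf_{xy}+f_x^2f_{yy},\qquad \Delta=f_{3,x}f_{4,y}-f_{3,y}f_{4,x},$$ $$\alpha =\frac{f_{4,y}\operatorname{Flex} f_3}{f_{3,x}f_{3,y}\Delta}-\frac{f_{3,y}\operatorname{Flex} f_4}{f_{4,x}f_{4,y}\Delta},\qquad \beta=-\frac{f_{4,x}\operatorname{Flex} f_3}{f_{3,x}f_{3,y}\Delta}+\frac{f_{3,x}\operatorname{Flex} f_4}{f_{4,x}f_{4,y}\Delta},$$ and consider the conditions $$(\ast)\qquad \alpha_{xx}+2\beta_{xy}=\beta\alpha_x+2\beta\beta_y,\qquad 2\alpha_{xy}+\beta_{yy}=2\alpha\alpha_x+\alpha\beta_y .$$ Then: (i) The projective structure defined by the $4$-web is (locally) symmetric if and only if conditions $(\ast)$ hold. (ii) The $4$-web given by the functions $\{x,y,f_3(x,y),f_4(x,y)\}$ is locally equivalent to a geodesic $4$-web on an affine symmetric surface if and only if conditions $(\ast)$ hold.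
   Context: All objects are smooth and all considerations are local (in a neighbourhood of each point of the domain). Subscripts $x,y$ (after the comma for indexed functions, e.g. $f_{3,x}=\partial f_3/\partial x$) denote partial derivatives. A planar $4$-web is given by four foliations, pairwise transversal at every point, which are the level sets of web functions $f_1,\dots,f_4$ with $df_i\wedge df_j\ne0$ for $i\neq j$; every planar $4$-web can be locally written with $f_1=x$, $f_2=y$, and then $f_{3,x},f_{3,y},f_{4,x},f_{4,y},\Delta$ are nowhere zero. Affine connections are torsion-free. Two affine connections $\nabla,\widetilde\nabla$ are projectively equivalent if $\nabla_X(Y)-\widetilde\nabla_X(Y)=\rho(X)Y+\rho(Y)X$ for some $1$-form $\rho$ and all vector fields $X,Y$. A projective structure is a class of projectively equivalent affine connections. Every planar $4$-web defines a unique projective structure such that all leaves of the web are (unparametrized) geodesics of the connections in the class; this is the projective structure defined by the web. An affine connection is called symmetric if it is torsion-free and its curvature tensor $R$ satisfies $\nabla R=0$; an affine symmetric surface is a surface with such a connection. A projective structure is called symmetric if its class contains an affine symmetric connection. A web is geodesic on a surface with connection $\nabla$ if all its leaves are geodesics of $\nabla$. Two webs are locally equivalent if there is a local diffeomorphism mapping the leaves of one to the leaves of the other. *)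

theory Defs
  imports "HOL-Analysis.Analysis"
begin

section \<open>Smooth maps\<close>

type_synonym plane = "real \<times> real"

text \<open>These notions of smoothness are meant for open sets only: derivatives are taken in the
  whole space.\<close>

primrec Ck_on :: "nat \<Rightarrow> 'a::euclidean_space set \<Rightarrow> ('a \<Rightarrow> 'b::real_normed_vector) \<Rightarrow> bool" where
  "Ck_on 0 S f \<longleftrightarrow> continuous_on S f"
| "Ck_on (Suc k) S f \<longleftrightarrow>
     (\<forall>x\<in>S. f differentiable (at x)) \<and> (\<forall>v. Ck_on k S (\<lambda>x. frechet_derivative f (at x) v))"

definition smooth_on :: "'a::euclidean_space set \<Rightarrow> ('a \<Rightarrow> 'b::real_normed_vector) \<Rightarrow> bool" where
  "smooth_on S f \<longleftrightarrow> (\<forall>k. Ck_on k S f)"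

definition smooth_near :: "'a::euclidean_space \<Rightarrow> ('a \<Rightarrow> 'b::real_normed_vector) \<Rightarrow> bool" where
  "smooth_near p f \<longleftrightarrow> (\<exists>W. open W \<and> p \<in> W \<and> smooth_on W f)"

definition diffeomorphism :: "plane set \<Rightarrow> plane set \<Rightarrow> (plane \<Rightarrow> plane) \<Rightarrow> bool" where
  "diffeomorphism W V \<phi> \<longleftrightarrow>
     open W \<and> open V \<and> bij_betw \<phi> W V \<and> smooth_on W \<phi> \<and> smooth_on V (inv_into W \<phi>)"

definition dx :: "(plane \<Rightarrow> real) \<Rightarrow> plane \<Rightarrow> real" where
  "dx f p = frechet_derivative f (at p) (1, 0)"

definition dy :: "(plane \<Rightarrow> real) \<Rightarrow> plane \<Rightarrow> real" where
  "dy f p = frechet_derivative f (at p) (0, 1)"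


section \<open>Affine connections on open subsets of the plane\<close>

type_synonym vfield = "plane \<Rightarrow> plane"

type_synonym connection = "vfield \<Rightarrow> vfield \<Rightarrow> vfield"

definition lie_bracket :: "vfield \<Rightarrow> vfield \<Rightarrow> vfield" where
  "lie_bracket X Y = (\<lambda>p. frechet_derivative Y (at p) (X p) - frechet_derivative X (at p) (Y p))"

text \<open>A connection on \<open>U\<close> is the operator \<open>D X Y = \<nabla>\<^sub>X Y\<close>. Its axioms are imposed for vector
  fields defined and smooth near a point of \<open>U\<close>, so that the restriction of a connection to
  a smaller open set is given by the same operator. Only the values of \<open>D X Y\<close> at points of
  \<open>U\<close> near which \<open>X\<close> and \<open>Y\<close> are smooth are meaningful.\<close>

definition is_connection :: "plane set \<Rightarrow> connection \<Rightarrow> bool" where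
  "is_connection U D \<longleftrightarrow>
     (\<forall>p\<in>U. \<forall>X X' Y Y' :: vfield. \<forall>g :: plane \<Rightarrow> real.
        smooth_near p X \<longrightarrow> smooth_near p X' \<longrightarrow> smooth_near p Y \<longrightarrow> smooth_near p Y' \<longrightarrow>
        smooth_near p g \<longrightarrow>
          smooth_near p (D X Y)
        \<and> D (\<lambda>q. X q + X' q) Y p = D X Y p + D X' Y p
        \<and> D (\<lambda>q. g q *\<^sub>R X q) Y p = g p *\<^sub>R D X Y p
        \<and> D X (\<lambda>q. Y q + Y' q) p = D X Y p + D X Y' p
        \<and> D X (\<lambda>q. g q *\<^sub>R Y q) p =
            frechet_derivative g (at p) (X p) *\<^sub>R Y p + g p *\<^sub>R D X Y p)"

definition torsion_free :: "plane set \<Rightarrow> connection \<Rightarrow> bool" where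
  "torsion_free U D \<longleftrightarrow>
     (\<forall>p\<in>U. \<forall>X Y. smooth_near p X \<longrightarrow> smooth_near p Y \<longrightarrow>
        D X Y p - D Y X p = lie_bracket X Y p)"

definition affine_connection :: "plane set \<Rightarrow> connection \<Rightarrow> bool" where
  "affine_connection U D \<longleftrightarrow> open U \<and> is_connection U D \<and> torsion_free U D"

definition curvature :: "connection \<Rightarrow> vfield \<Rightarrow> vfield \<Rightarrow> vfield \<Rightarrow> vfield" where
  "curvature D X Y Z =
     (\<lambda>p. D X (D Y Z) p - D Y (D X Z) p - D (lie_bracket X Y) Z p)"

definition nabla_curvature :: "connection \<Rightarrow> vfield \<Rightarrow> vfield \<Rightarrow> vfield \<Rightarrow> vfield \<Rightarrow> vfield" where
  "nabla_curvature D W X Y Z =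
     (\<lambda>p. D W (curvature D X Y Z) p - curvature D (D W X) Y Z p
        - curvature D X (D W Y) Z p - curvature D X Y (D W Z) p)"

definition affine_symmetric :: "plane set \<Rightarrow> connection \<Rightarrow> bool" where
  "affine_symmetric U D \<longleftrightarrow> affine_connection U D \<and>
     (\<forall>p\<in>U. \<forall>W X Y Z. smooth_near p W \<longrightarrow> smooth_near p X \<longrightarrow> smooth_near p Y \<longrightarrow>
        smooth_near p Z \<longrightarrow> nabla_curvature D W X Y Z p = 0)"


section \<open>Projective structures\<close>

definition one_form :: "plane set \<Rightarrow> (plane \<Rightarrow> plane \<Rightarrow> real) \<Rightarrow> bool" where
  "one_form U \<rho> \<longleftrightarrow> (\<forall>p\<in>U. linear (\<rho> p)) \<and> (\<forall>v. smooth_on U (\<lambda>p. \<rho> p v))"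

definition projectively_equivalent :: "plane set \<Rightarrow> connection \<Rightarrow> connection \<Rightarrow> bool" where
  "projectively_equivalent U D D' \<longleftrightarrow>
     (\<exists>\<rho>. one_form U \<rho> \<and>
        (\<forall>p\<in>U. \<forall>X Y. smooth_near p X \<longrightarrow> smooth_near p Y \<longrightarrow>
           D X Y p - D' X Y p = \<rho> p (X p) *\<^sub>R Y p + \<rho> p (Y p) *\<^sub>R X p))"

definition projective_structure :: "plane set \<Rightarrow> connection set \<Rightarrow> bool" where
  "projective_structure U P \<longleftrightarrow>
     (\<exists>D. affine_connection U D \<and>
        P = {D'. affine_connection U D' \<and> projectively_equivalent U D D'})"

definition restrict_projective :: "plane set \<Rightarrow> connection set \<Rightarrow> connection set" where
  "restrict_projective W P =
     {D'. affine_connection W D' \<and> (\<exists>D\<in>P. projectively_equivalent W D D')}"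

definition symmetric_projective :: "plane set \<Rightarrow> connection set \<Rightarrow> bool" where
  "symmetric_projective W P \<longleftrightarrow> (\<exists>D\<in>P. affine_symmetric W D)"

definition locally_symmetric_projective :: "plane set \<Rightarrow> connection set \<Rightarrow> bool" where
  "locally_symmetric_projective U P \<longleftrightarrow>
     (\<forall>p\<in>U. \<exists>W. open W \<and> p \<in> W \<and> W \<subseteq> U \<and> symmetric_projective W (restrict_projective W P))"


section \<open>Geodesics and webs\<close>

definition velocity :: "(real \<Rightarrow> plane) \<Rightarrow> real \<Rightarrow> plane" where
  "velocity \<gamma> t = vector_derivative \<gamma> (at t)"

text \<open>The coordinate formula \<open>\<gamma>'' + \<Gamma>(\<gamma>', \<gamma>')\<close> for the covariant derivative of the velocity along
  the curve; the Christoffel symbols \<open>\<Gamma>(u, v)\<close> are obtained by applying the connection to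
  constant vector fields.\<close>

definition covariant_acceleration :: "connection \<Rightarrow> (real \<Rightarrow> plane) \<Rightarrow> real \<Rightarrow> plane" where
  "covariant_acceleration D \<gamma> t =
     vector_derivative (velocity \<gamma>) (at t) + D (\<lambda>_. velocity \<gamma> t) (\<lambda>_. velocity \<gamma> t) (\<gamma> t)"

definition unparametrized_geodesic :: "connection \<Rightarrow> real set \<Rightarrow> (real \<Rightarrow> plane) \<Rightarrow> bool" where
  "unparametrized_geodesic D I \<gamma> \<longleftrightarrow>
     (\<forall>t\<in>I. \<exists>c. covariant_acceleration D \<gamma> t = c *\<^sub>R velocity \<gamma> t)"

definition geodesic_leaf :: "connection \<Rightarrow> plane set \<Rightarrow> bool" where
  "geodesic_leaf D L \<longleftrightarrow>
     (\<forall>\<gamma> a b. a < b \<longrightarrow> smooth_on {a<..<b} \<gamma> \<longrightarrow>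
        (\<forall>t\<in>{a<..<b}. \<gamma> t \<in> L \<and> velocity \<gamma> t \<noteq> 0) \<longrightarrow>
        unparametrized_geodesic D {a<..<b} \<gamma>)"

definition four_web :: "plane set \<Rightarrow> (plane \<Rightarrow> real) list \<Rightarrow> bool" where
  "four_web U fs \<longleftrightarrow>
     open U \<and> length fs = 4 \<and> (\<forall>f\<in>set fs. smooth_on U f) \<and>
     (\<forall>i<4. \<forall>j<4. i \<noteq> j \<longrightarrow>
        (\<forall>p\<in>U. dx (fs ! i) p * dy (fs ! j) p - dy (fs ! i) p * dx (fs ! j) p \<noteq> 0))"

definition web_leaves :: "plane set \<Rightarrow> (plane \<Rightarrow> real) list \<Rightarrow> plane set set" where
  "web_leaves U fs = (\<Union>f\<in>set fs. \<Union>c. components {p\<in>U. f p = c})"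

definition geodesic_web :: "plane set \<Rightarrow> connection \<Rightarrow> (plane \<Rightarrow> real) list \<Rightarrow> bool" where
  "geodesic_web U D fs \<longleftrightarrow> four_web U fs \<and> (\<forall>L\<in>web_leaves U fs. geodesic_leaf D L)"

definition web_projective_structure :: "plane set \<Rightarrow> (plane \<Rightarrow> real) list \<Rightarrow> connection set" where
  "web_projective_structure U fs =
     (THE P. projective_structure U P \<and> (\<forall>D\<in>P. geodesic_web U D fs))"

definition webs_equivalent_near ::
    "plane \<Rightarrow> plane set \<Rightarrow> (plane \<Rightarrow> real) list \<Rightarrow> plane set \<Rightarrow> (plane \<Rightarrow> real) list \<Rightarrow> bool" where
  "webs_equivalent_near p U fs V gs \<longleftrightarrow>
     (\<exists>U' V' \<phi>. p \<in> U' \<and> U' \<subseteq> U \<and> V' \<subseteq> V \<and> diffeomorphism U' V' \<phi> \<and>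
        (\<lambda>L. \<phi> ` L) ` web_leaves U' fs = web_leaves V' gs)"

text \<open>Since the notion is local, it suffices to consider surfaces that are coordinate domains,
  i.e. open subsets of the plane.\<close>

definition locally_equivalent_to_geodesic_web_on_symmetric_surface ::
    "plane set \<Rightarrow> (plane \<Rightarrow> real) list \<Rightarrow> bool" where
  "locally_equivalent_to_geodesic_web_on_symmetric_surface U fs \<longleftrightarrow>
     (\<forall>p\<in>U. \<exists>V D gs. affine_symmetric V D \<and> geodesic_web V D gs \<and>
        webs_equivalent_near p U fs V gs)"


section \<open>The invariants of the web \<open>x, y, f\<^sub>3, f\<^sub>4\<close>\<close>

definition Flex :: "(plane \<Rightarrow> real) \<Rightarrow> plane \<Rightarrow> real" where
  "Flex f p = (dy f p)\<^sup>2 * dx (dx f) p - 2 * dx f p * dy f p * dy (dx f) p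
            + (dx f p)\<^sup>2 * dy (dy f) p"

definition Delta :: "(plane \<Rightarrow> real) \<Rightarrow> (plane \<Rightarrow> real) \<Rightarrow> plane \<Rightarrow> real" where
  "Delta f3 f4 p = dx f3 p * dy f4 p - dy f3 p * dx f4 p"

definition alpha :: "(plane \<Rightarrow> real) \<Rightarrow> (plane \<Rightarrow> real) \<Rightarrow> plane \<Rightarrow> real" where
  "alpha f3 f4 p =
     dy f4 p * Flex f3 p / (dx f3 p * dy f3 p * Delta f3 f4 p)
     - dy f3 p * Flex f4 p / (dx f4 p * dy f4 p * Delta f3 f4 p)"

definition beta :: "(plane \<Rightarrow> real) \<Rightarrow> (plane \<Rightarrow> real) \<Rightarrow> plane \<Rightarrow> real" where
  "beta f3 f4 p =
     - (dx f4 p * Flex f3 p / (dx f3 p * dy f3 p * Delta f3 f4 p))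
     + dx f3 p * Flex f4 p / (dx f4 p * dy f4 p * Delta f3 f4 p)"

definition star_conditions :: "plane set \<Rightarrow> (plane \<Rightarrow> real) \<Rightarrow> (plane \<Rightarrow> real) \<Rightarrow> bool" where
  "star_conditions U f3 f4 \<longleftrightarrow>
     (let a = alpha f3 f4; b = beta f3 f4 in
      \<forall>p\<in>U. dx (dx a) p + 2 * dy (dx b) p = b p * dx a p + 2 * b p * dy b p
          \<and> 2 * dy (dx a) p + dy (dy b) p = 2 * a p * dx a p + a p * dy b p)"

end

(* A connection whose geodesics include the leaves of the web is, in the coordinates x, y,
   determined by alpha, beta and two free functions r1, r2 (the freedom of a one-form). If such a
   connection is symmetric, its curvature is trace-free, and together with the parallelism of the
   curvature this gives the Liouville equations m_x = beta m and n_y = alpha n for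
   m = alpha_x + 2 beta_y and n = 2 alpha_x + beta_y, which are the star conditions. Conversely, they
   are the integrability conditions of the system that expresses flatness,
     r1_x = r1^2 + beta r1,   r1_y = r1 r2 - m/3,   r2_x = r1 r2 - n/3,   r2_y = r2^2 + alpha r2.
   The two Riccati equations are solved by quadratures with initial values on the axes through the
   given point chosen such that the two mixed equations hold there; these then hold near
   the point, since their defects solve a homogeneous linear Goursat problem. *)
theory Submission
  imports Defs
begin

section \<open>Calculus of smooth maps\<close>

text \<open>A symmetric connection need not be flat, and the two directions concern different
  connections: a symmetric one yields the star conditions, and these yield a flat one. So a
  symmetric class contains a flat connection near every point. Flatness is four equations for two
  unknowns. Two facts make it tractable. Each Riccati equation differentiates in one variable only
  and has the solution 0, so the reciprocal of a solution satisfies a linear equation, solved by an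
  exponential and two antiderivatives with the other variable as a parameter. And the initial data
  decouple: \<open>r2\<close> vanishes on the vertical line through the point and \<open>r1\<close>
  on the horizontal one, so the product \<open>r1 r2\<close> drops out of each mixed equation on the
  line where it is imposed. In (ii) the other surface carries arbitrary coordinates and web
  functions; only the sets of leaves correspond. Instead of comparing functions, its connection is
  pulled back to \<open>U\<close>, where the given web is again geodesic and the argument of (i)
  applies. As a connection is an operator on fields, this requires its locality and the behaviour of
  second derivatives under a change of coordinates.\<close>

lemma frechet_derivativeI: "(f has_derivative f') (at x) \<Longrightarrow> frechet_derivative f (at x) = f'"
  using frechet_derivative_at by metis

lemma Ck_on_cong:
  assumes "open S" "\<And>x. x \<in> S \<Longrightarrow> f x = g x"
  shows "Ck_on k S f \<longleftrightarrow> Ck_on k S g"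
proof -
  have imp: "Ck_on k S f \<Longrightarrow> Ck_on k S g" if "\<And>x. x \<in> S \<Longrightarrow> f x = g x" for f g :: "'a \<Rightarrow> 'b"
    using that
  proof (induction k arbitrary: f g)
    case 0
    then show ?case by (auto cong: continuous_on_cong)
  next
    case (Suc k)
    have g: "(g has_derivative frechet_derivative f (at x)) (at x)" if "x \<in> S" for x
      using Suc.prems that assms(1)
      by (metis Ck_on.simps(2) frechet_derivative_works has_derivative_transform_within_open)
    then have "frechet_derivative g (at x) = frechet_derivative f (at x)" if "x \<in> S" for x
      using frechet_derivativeI that by blast
    moreover have "Ck_on k S (\<lambda>x. frechet_derivative f (at x) v)" for v
      using Suc.prems by simp
    ultimately have "Ck_on k S (\<lambda>x. frechet_derivative g (at x) v)" for v
      using Suc.IH[of "\<lambda>x. frechet_derivative f (at x) v"] by simp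
    then show ?case
      using g by (auto simp: differentiable_def)
  qed
  show ?thesis
    using imp[of f g] imp[of g f] assms by auto
qed

text \<open>Replaces the chosen \<open>frechet_derivative\<close> by one computed with derivative
  rules. The closure properties below are inductions on \<open>k\<close> through this rule.\<close>

lemma Ck_on_SucI:
  assumes "open S" "\<And>x. x \<in> S \<Longrightarrow> (f has_derivative f' x) (at x)" "\<And>v. Ck_on k S (\<lambda>x. f' x v)"
  shows "Ck_on (Suc k) S f"
proof -
  have "Ck_on k S (\<lambda>x. frechet_derivative f (at x) v)" for v
    using assms frechet_derivativeI[OF assms(2)]
    by (subst Ck_on_cong[where g="\<lambda>x. f' x v"]) auto
  then show ?thesis
    using assms by (auto simp: differentiable_def)
qed

lemma Ck_on_SucD:
  assumes "Ck_on (Suc k) S f" "x \<in> S"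
  shows "(f has_derivative frechet_derivative f (at x)) (at x)"
  using assms frechet_derivative_works by auto

lemma Ck_on_subset: "Ck_on k S f \<Longrightarrow> T \<subseteq> S \<Longrightarrow> Ck_on k T f"
  by (induction k arbitrary: f) (auto intro: continuous_on_subset)

lemma Ck_on_Suc_imp: "Ck_on (Suc k) S f \<Longrightarrow> Ck_on k S f"
proof (induction k arbitrary: f)
  case 0
  then show ?case
    by (auto intro!: continuous_at_imp_continuous_on differentiable_imp_continuous_within)
next
  case (Suc k)
  then show ?case by simp
qed

lemma Ck_on_const: "Ck_on k S (\<lambda>x. c)"
  by (induction k arbitrary: c) auto

lemma Ck_on_bounded_linear:
  assumes "open S" "bounded_linear h" "Ck_on k S f"
  shows "Ck_on k S (\<lambda>x. h (f x))"
  using assms(3)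
proof (induction k arbitrary: f)
  case 0
  then show ?case
    using assms(2) by (auto intro: bounded_linear.continuous_on)
next
  case (Suc k)
  show ?case
    by (rule Ck_on_SucI[OF assms(1) bounded_linear.has_derivative[OF assms(2) Ck_on_SucD[OF Suc.prems]]])
      (use Suc in auto)
qed

lemma Ck_on_add:
  assumes "open S" "Ck_on k S f" "Ck_on k S g"
  shows "Ck_on k S (\<lambda>x. f x + g x)"
  using assms(2,3)
proof (induction k arbitrary: f g)
  case 0
  then show ?case by (auto intro: continuous_on_add)
next
  case (Suc k)
  show ?case
    by (rule Ck_on_SucI[OF assms(1) has_derivative_add[OF Ck_on_SucD[OF Suc.prems(1)] Ck_on_SucD[OF Suc.prems(2)]]])
      (use Suc in auto)
qed

lemma Ck_on_bounded_bilinear: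
  assumes "open S" "bounded_bilinear h" "Ck_on k S f" "Ck_on k S g"
  shows "Ck_on k S (\<lambda>x. h (f x) (g x))"
  using assms(3,4)
proof (induction k arbitrary: f g)
  case 0
  then show ?case
    using assms(2) by (auto intro: bounded_bilinear.continuous_on)
next
  case (Suc k)
  show ?case
    by (rule Ck_on_SucI[OF assms(1) bounded_bilinear.FDERIV[OF assms(2) Ck_on_SucD[OF Suc.prems(1)] Ck_on_SucD[OF Suc.prems(2)]]])
      (use Suc Suc.prems[THEN Ck_on_Suc_imp] in \<open>auto intro!: Ck_on_add assms(1)\<close>)
qed

lemma Ck_on_sum:
  assumes "open S" "finite I" "\<And>i. i \<in> I \<Longrightarrow> Ck_on k S (f i)"
  shows "Ck_on k S (\<lambda>x. \<Sum>i\<in>I. f i x)"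
  using assms(2,3) by (induction rule: finite_induct) (auto intro: Ck_on_const Ck_on_add assms(1))

lemma linear_euclidean_expand:
  fixes h :: "'a::euclidean_space \<Rightarrow> 'b::real_vector"
  assumes "linear h"
  shows "h v = (\<Sum>b\<in>Basis. (v \<bullet> b) *\<^sub>R h b)"
proof -
  have "h (\<Sum>b\<in>Basis. (v \<bullet> b) *\<^sub>R b) = (\<Sum>b\<in>Basis. (v \<bullet> b) *\<^sub>R h b)"
    using assms by (simp add: linear_sum linear_cmul)
  then show ?thesis
    by (simp add: euclidean_representation)
qed

text \<open>The chain rule differentiates \<open>g\<close> in a direction that varies with the
  point, whereas \<open>Ck_on\<close> speaks of fixed directions only. Expanding the direction in
  the basis leaves finitely many fixed directions with coefficients of class \<open>k\<close>, and
  the induction hypothesis applies to the derivatives of \<open>g\<close>.\<close>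

lemma Ck_on_compose:
  fixes f :: "'a::euclidean_space \<Rightarrow> 'b::euclidean_space" and g :: "'b \<Rightarrow> 'c::real_normed_vector"
  assumes "open S" "open T" "Ck_on k S f" "Ck_on k T g" "\<And>x. x \<in> S \<Longrightarrow> f x \<in> T"
  shows "Ck_on k S (\<lambda>x. g (f x))"
  using assms(3,4)
proof (induction k arbitrary: g)
  case 0
  then show ?case
    using assms(5) by (auto intro: continuous_on_compose2)
next
  case (Suc k)
  have der: "((\<lambda>x. g (f x)) has_derivative
      (\<lambda>v. frechet_derivative g (at (f x)) (frechet_derivative f (at x) v))) (at x)" if "x \<in> S" for x
    by (rule has_derivative_compose[OF Ck_on_SucD[OF Suc.prems(1) that] Ck_on_SucD[OF Suc.prems(2) assms(5)[OF that]]])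
  have lin: "linear (frechet_derivative g (at (f x)))" if "x \<in> S" for x
    using Suc.prems(2) assms(5)[OF that] by (auto intro: linear_frechet_derivative)
  have "Ck_on k S (\<lambda>x. frechet_derivative g (at (f x)) (frechet_derivative f (at x) v))" for v
  proof (subst Ck_on_cong[OF assms(1)])
    show "frechet_derivative g (at (f x)) (frechet_derivative f (at x) v) =
        (\<Sum>b\<in>Basis. (frechet_derivative f (at x) v \<bullet> b) *\<^sub>R frechet_derivative g (at (f x)) b)"
      if "x \<in> S" for x
      using linear_euclidean_expand[OF lin[OF that]] .
    show "Ck_on k S (\<lambda>x. \<Sum>b\<in>Basis. (frechet_derivative f (at x) v \<bullet> b) *\<^sub>R frechet_derivative g (at (f x)) b)"
    proof (intro Ck_on_sum assms(1) finite_Basis)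
      fix b :: 'b
      have "Ck_on k S (\<lambda>x. frechet_derivative f (at x) v \<bullet> b)"
        using Suc.prems(1) by (intro Ck_on_bounded_linear[OF assms(1) bounded_linear_inner_left]) auto
      moreover have "Ck_on k S (\<lambda>x. frechet_derivative g (at (f x)) b)"
        using Suc.IH[of "\<lambda>y. frechet_derivative g (at y) b"] Suc.prems Ck_on_Suc_imp by auto
      ultimately show "Ck_on k S (\<lambda>x. (frechet_derivative f (at x) v \<bullet> b) *\<^sub>R frechet_derivative g (at (f x)) b)"
        by (intro Ck_on_bounded_bilinear[OF assms(1) bounded_bilinear_scaleR])
    qed
  qed
  then show ?case
    using der by (intro Ck_on_SucI[OF assms(1)])
qed

text \<open>The derivative of \<open>1/f\<close> is a product of \<open>1/f\<close>, the derivative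
  of \<open>f\<close> and \<open>1/f\<close>, so one order of smoothness of \<open>1/f\<close> gives
  the next.\<close>

lemma Ck_on_inverse:
  fixes f :: "'a::euclidean_space \<Rightarrow> real"
  assumes "open S" "Ck_on k S f" "\<And>x. x \<in> S \<Longrightarrow> f x \<noteq> 0"
  shows "Ck_on k S (\<lambda>x. inverse (f x))"
  using assms(2)
proof (induction k)
  case 0
  then show ?case using assms(3) by (auto intro: continuous_on_inverse)
next
  case (Suc k)
  have "Ck_on k S (\<lambda>x. inverse (f x))"
    using Suc Ck_on_Suc_imp by blast
  then have "Ck_on k S (\<lambda>x. - (inverse (f x) * frechet_derivative f (at x) v * inverse (f x)))" for v
    using Suc.prems
    by (intro Ck_on_bounded_linear[OF assms(1) bounded_linear_minus[OF bounded_linear_ident]]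
        Ck_on_bounded_bilinear[OF assms(1) bounded_bilinear_mult]) auto
  then show ?case
    using Deriv.has_derivative_inverse[OF assms(3) Ck_on_SucD[OF Suc.prems]]
    by (intro Ck_on_SucI[OF assms(1)])
qed

lemma Ck_on_exp:
  fixes f :: "'a::euclidean_space \<Rightarrow> real"
  assumes "open S" "Ck_on k S f"
  shows "Ck_on k S (\<lambda>x. exp (f x))"
  using assms(2)
proof (induction k)
  case 0
  then show ?case by (auto intro: continuous_on_exp)
next
  case (Suc k)
  have "Ck_on k S (\<lambda>x. exp (f x))"
    using Suc Ck_on_Suc_imp by blast
  then have "Ck_on k S (\<lambda>x. exp (f x) * frechet_derivative f (at x) v)" for v
    using Suc.prems by (intro Ck_on_bounded_bilinear[OF assms(1) bounded_bilinear_mult]) auto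
  moreover have "((\<lambda>x. exp (f x)) has_derivative (\<lambda>v. exp (f x) * frechet_derivative f (at x) v)) (at x)"
    if "x \<in> S" for x
    using Ck_on_SucD[OF Suc.prems that] by (auto intro!: derivative_eq_intros)
  ultimately show ?case
    by (intro Ck_on_SucI[OF assms(1)])
qed

lemma smooth_on_cong: "open S \<Longrightarrow> (\<And>x. x \<in> S \<Longrightarrow> f x = g x) \<Longrightarrow> smooth_on S f \<longleftrightarrow> smooth_on S g"
  unfolding smooth_on_def using Ck_on_cong by blast

lemma smooth_on_subset: "smooth_on S f \<Longrightarrow> T \<subseteq> S \<Longrightarrow> smooth_on T f"
  unfolding smooth_on_def using Ck_on_subset by blast

lemma smooth_on_const: "smooth_on S (\<lambda>x. c)"
  unfolding smooth_on_def by (simp add: Ck_on_const)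

lemma smooth_on_ident: "smooth_on S (\<lambda>x. x)"
  unfolding smooth_on_def
proof
  show "Ck_on k S (\<lambda>x. x)" for k
    by (cases k) (auto simp: Ck_on_const)
qed

lemma smooth_on_bounded_linear: "open S \<Longrightarrow> bounded_linear h \<Longrightarrow> smooth_on S f \<Longrightarrow> smooth_on S (\<lambda>x. h (f x))"
  unfolding smooth_on_def using Ck_on_bounded_linear by blast

lemma smooth_on_fst: "open S \<Longrightarrow> smooth_on S f \<Longrightarrow> smooth_on S (\<lambda>x. fst (f x))"
  by (rule smooth_on_bounded_linear[OF _ bounded_linear_fst])

lemma smooth_on_snd: "open S \<Longrightarrow> smooth_on S f \<Longrightarrow> smooth_on S (\<lambda>x. snd (f x))"
  by (rule smooth_on_bounded_linear[OF _ bounded_linear_snd])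

lemma smooth_on_minus: "open S \<Longrightarrow> smooth_on S f \<Longrightarrow> smooth_on S (\<lambda>x. - f x)"
  by (rule smooth_on_bounded_linear[OF _ bounded_linear_minus[OF bounded_linear_ident]])

lemma smooth_on_add: "open S \<Longrightarrow> smooth_on S f \<Longrightarrow> smooth_on S g \<Longrightarrow> smooth_on S (\<lambda>x. f x + g x)"
  unfolding smooth_on_def using Ck_on_add by blast

lemma smooth_on_diff: "open S \<Longrightarrow> smooth_on S f \<Longrightarrow> smooth_on S g \<Longrightarrow> smooth_on S (\<lambda>x. f x - g x)"
  using smooth_on_add[OF _ _ smooth_on_minus, of S f g] by simp

lemma smooth_on_bounded_bilinear:
  "open S \<Longrightarrow> bounded_bilinear h \<Longrightarrow> smooth_on S f \<Longrightarrow> smooth_on S g \<Longrightarrow> smooth_on S (\<lambda>x. h (f x) (g x))"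
  unfolding smooth_on_def using Ck_on_bounded_bilinear by blast

lemma smooth_on_scaleR: "open S \<Longrightarrow> smooth_on S f \<Longrightarrow> smooth_on S g \<Longrightarrow> smooth_on S (\<lambda>x. f x *\<^sub>R g x)"
  by (rule smooth_on_bounded_bilinear[OF _ bounded_bilinear_scaleR])

lemma smooth_on_mult:
  fixes f g :: "'a::euclidean_space \<Rightarrow> real"
  shows "open S \<Longrightarrow> smooth_on S f \<Longrightarrow> smooth_on S g \<Longrightarrow> smooth_on S (\<lambda>x. f x * g x)"
  by (rule smooth_on_bounded_bilinear[OF _ bounded_bilinear_mult])

lemma smooth_on_power2:
  fixes f :: "'a::euclidean_space \<Rightarrow> real"
  shows "open S \<Longrightarrow> smooth_on S f \<Longrightarrow> smooth_on S (\<lambda>x. (f x)\<^sup>2)"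
  unfolding power2_eq_square by (rule smooth_on_mult)

lemma smooth_on_divide:
  fixes f g :: "'a::euclidean_space \<Rightarrow> real"
  assumes "open S" "smooth_on S f" "smooth_on S g" "\<And>x. x \<in> S \<Longrightarrow> g x \<noteq> 0"
  shows "smooth_on S (\<lambda>x. f x / g x)"
proof -
  have "smooth_on S (\<lambda>x. inverse (g x))"
    using assms Ck_on_inverse unfolding smooth_on_def by blast
  then show ?thesis
    using smooth_on_mult[OF assms(1,2)] by (simp add: divide_inverse)
qed

lemma smooth_on_exp:
  fixes f :: "'a::euclidean_space \<Rightarrow> real"
  shows "open S \<Longrightarrow> smooth_on S f \<Longrightarrow> smooth_on S (\<lambda>x. exp (f x))"
  unfolding smooth_on_def using Ck_on_exp by blast

lemma smooth_on_sum:
  "open S \<Longrightarrow> finite I \<Longrightarrow> (\<And>i. i \<in> I \<Longrightarrow> smooth_on S (f i)) \<Longrightarrow> smooth_on S (\<lambda>x. \<Sum>i\<in>I. f i x)"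
  unfolding smooth_on_def using Ck_on_sum by blast

lemma smooth_on_compose:
  fixes f :: "'a::euclidean_space \<Rightarrow> 'b::euclidean_space" and g :: "'b \<Rightarrow> 'c::real_normed_vector"
  assumes "open S" "open T" "smooth_on S f" "smooth_on T g" "\<And>x. x \<in> S \<Longrightarrow> f x \<in> T"
  shows "smooth_on S (\<lambda>x. g (f x))"
  using assms Ck_on_compose unfolding smooth_on_def by blast

lemma smooth_on_Pair:
  fixes f g :: "'a::euclidean_space \<Rightarrow> real"
  assumes "open S" "smooth_on S f" "smooth_on S g"
  shows "smooth_on S (\<lambda>x. (f x, g x))"
proof -
  have "bounded_linear (\<lambda>x::real. (x, 0::real))" "bounded_linear (\<lambda>x::real. (0::real, x))"
    by (auto intro!: bounded_linear_Pair bounded_linear_ident bounded_linear_zero)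
  from this[THEN smooth_on_bounded_linear[OF assms(1)]] assms(2,3)
  have "smooth_on S (\<lambda>x. (f x, 0) + (0, g x))"
    by (intro smooth_on_add[OF assms(1)]) auto
  then show ?thesis by simp
qed

lemma smooth_on_imp_differentiable: "smooth_on S f \<Longrightarrow> x \<in> S \<Longrightarrow> f differentiable (at x)"
  unfolding smooth_on_def by (drule spec[of _ "Suc 0"]) simp

lemma smooth_on_has_derivative:
  "smooth_on S f \<Longrightarrow> x \<in> S \<Longrightarrow> (f has_derivative frechet_derivative f (at x)) (at x)"
  using smooth_on_imp_differentiable frechet_derivative_works by metis

lemma smooth_on_imp_continuous_on: "smooth_on S f \<Longrightarrow> continuous_on S f"
  unfolding smooth_on_def by (drule spec[of _ 0]) simp

lemma smooth_on_frechet_derivative: "smooth_on S f \<Longrightarrow> smooth_on S (\<lambda>x. frechet_derivative f (at x) v)"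
  unfolding smooth_on_def
proof
  show "Ck_on k S (\<lambda>x. frechet_derivative f (at x) v)" if "\<forall>k. Ck_on k S f" for k
    using that[rule_format, of "Suc k"] by simp
qed

lemma smooth_on_frechet_derivative_field:
  fixes f :: "'a::euclidean_space \<Rightarrow> 'b::real_normed_vector"
  assumes "open S" "smooth_on S f" "smooth_on S X"
  shows "smooth_on S (\<lambda>x. frechet_derivative f (at x) (X x))"
proof -
  have "smooth_on S (\<lambda>x. \<Sum>b\<in>Basis. (X x \<bullet> b) *\<^sub>R frechet_derivative f (at x) b)"
    using assms
    by (intro smooth_on_sum smooth_on_scaleR smooth_on_frechet_derivative
        smooth_on_bounded_linear[OF _ bounded_linear_inner_left]) auto
  moreover have "frechet_derivative f (at x) (X x) = (\<Sum>b\<in>Basis. (X x \<bullet> b) *\<^sub>R frechet_derivative f (at x) b)"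
    if "x \<in> S" for x
    using linear_euclidean_expand[OF linear_frechet_derivative[OF smooth_on_imp_differentiable[OF assms(2) that]]] .
  ultimately show ?thesis
    using smooth_on_cong[OF assms(1), of "\<lambda>x. frechet_derivative f (at x) (X x)"] by simp
qed

lemma smooth_on_dx: "smooth_on S f \<Longrightarrow> smooth_on S (dx f)"
  unfolding dx_def[abs_def] by (rule smooth_on_frechet_derivative)

lemma smooth_on_dy: "smooth_on S f \<Longrightarrow> smooth_on S (dy f)"
  unfolding dy_def[abs_def] by (rule smooth_on_frechet_derivative)

lemmas smooth_intros =
  smooth_on_const smooth_on_ident smooth_on_fst smooth_on_snd smooth_on_minus smooth_on_add
  smooth_on_diff smooth_on_scaleR smooth_on_mult smooth_on_power2 smooth_on_divide smooth_on_exp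
  smooth_on_Pair smooth_on_dx smooth_on_dy

lemma frechet_derivative_plane:
  fixes f :: "plane \<Rightarrow> real"
  assumes "f differentiable (at p)"
  shows "frechet_derivative f (at p) v = fst v * dx f p + snd v * dy f p"
proof -
  have lin: "linear (frechet_derivative f (at p))"
    by (rule linear_frechet_derivative[OF assms])
  have "v = fst v *\<^sub>R (1, 0) + snd v *\<^sub>R (0, 1)"
    by (simp add: prod_eq_iff)
  then have "frechet_derivative f (at p) v = frechet_derivative f (at p) (fst v *\<^sub>R (1, 0) + snd v *\<^sub>R (0, 1))"
    by simp
  also have "\<dots> = fst v * dx f p + snd v * dy f p"
    unfolding linear_add[OF lin] linear_cmul[OF lin] dx_def dy_def by simp
  finally show ?thesis .
qed

lemma has_derivative_plane:
  fixes f :: "plane \<Rightarrow> real"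
  assumes "f differentiable (at p)"
  shows "(f has_derivative (\<lambda>v. fst v * dx f p + snd v * dy f p)) (at p)"
proof -
  have "frechet_derivative f (at p) = (\<lambda>v. fst v * dx f p + snd v * dy f p)"
    using frechet_derivative_plane[OF assms] by blast
  then show ?thesis
    using assms frechet_derivative_works by metis
qed

lemma dx_dyI:
  assumes "(f has_derivative f') (at p)"
  shows "dx f p = f' (1, 0)" "dy f p = f' (0, 1)"
  using frechet_derivativeI[OF assms] by (auto simp: dx_def dy_def)

lemma dx_cong:
  assumes "open S" "p \<in> S" "\<And>x. x \<in> S \<Longrightarrow> f x = g x"
  shows "dx f p = dx g p" "dy f p = dy g p" "f differentiable (at p) \<longleftrightarrow> g differentiable (at p)"
proof -
  have *: "(f has_derivative D) (at p) \<longleftrightarrow> (g has_derivative D) (at p)" for D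
    using assms has_derivative_transform_within_open[of f D p UNIV S g]
      has_derivative_transform_within_open[of g D p UNIV S f] by auto
  show "dx f p = dx g p" "dy f p = dy g p" "f differentiable (at p) \<longleftrightarrow> g differentiable (at p)"
    using * by (auto simp: dx_def dy_def frechet_derivative_def differentiable_def)
qed

section \<open>Squares, mixed derivatives and level curves\<close>

definition square :: "plane \<Rightarrow> real \<Rightarrow> plane set" where
  "square p r = {fst p - r<..<fst p + r} \<times> {snd p - r<..<snd p + r}"

lemma open_square: "open (square p r)"
  unfolding square_def by (intro open_Times open_greaterThanLessThan)

lemma convex_square: "convex (square p r)"
  unfolding square_def by (intro convex_Times convex_real_interval)

lemma mem_square: "q \<in> square p r \<longleftrightarrow> \<bar>fst q - fst p\<bar> < r \<and> \<bar>snd q - snd p\<bar> < r"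
  unfolding square_def by (cases q) auto

lemma square_mono: "r \<le> s \<Longrightarrow> square p r \<subseteq> square p s"
  by (auto simp: mem_square)

lemma center_in_square: "0 < r \<Longrightarrow> p \<in> square p r"
  by (simp add: mem_square)

lemma open_contains_square:
  assumes "open S" "p \<in> S"
  obtains r where "0 < r" "square p r \<subseteq> S"
proof -
  obtain e where e: "0 < e" "ball p e \<subseteq> S"
    using assms openE by blast
  have "square p (e / 2) \<subseteq> ball p e"
  proof
    fix q assume "q \<in> square p (e / 2)"
    then have "\<bar>fst p - fst q\<bar> + \<bar>snd p - snd q\<bar> < e"
      by (auto simp: mem_square abs_minus_commute)
    then have "norm (p - q) < e"
      using norm_Pair_le[of "fst p - fst q" "snd p - snd q"] by (cases p; cases q) auto
    then show "q \<in> ball p e"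
      by (simp add: dist_norm)
  qed
  then show ?thesis
    using e by (intro that[of "e / 2"]) auto
qed

section \<open>Derivatives along coordinate lines and the symmetry of mixed derivatives\<close>

lemma DERIV_dx:
  assumes "f differentiable (at (x, y))"
  shows "((\<lambda>t. f (t, y)) has_real_derivative dx f (x, y)) (at x)"
proof -
  have "((\<lambda>t. (t, y)) has_derivative (\<lambda>h. (h, 0))) (at x)"
    by (auto intro!: derivative_eq_intros)
  from has_derivative_compose[OF this has_derivative_plane[OF assms]] show ?thesis
    by (simp add: has_field_derivative_def mult_commute_abs)
qed

lemma DERIV_dy:
  assumes "f differentiable (at (x, y))"
  shows "((\<lambda>t. f (x, t)) has_real_derivative dy f (x, y)) (at y)"
proof -
  have "((\<lambda>t. (x, t)) has_derivative (\<lambda>h. (0, h))) (at y)"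
    by (auto intro!: derivative_eq_intros)
  from has_derivative_compose[OF this has_derivative_plane[OF assms]] show ?thesis
    by (simp add: has_field_derivative_def mult_commute_abs)
qed

text \<open>The same second difference over a square is evaluated by the mean value theorem in the
  two orders of the variables. Only the intermediate points differ.\<close>

lemma mixed_difference:
  assumes "0 < h" "{a..a + h} \<times> {b..b + h} \<subseteq> S" "smooth_on S f"
  shows "\<exists>x y. a < x \<and> x < a + h \<and> b < y \<and> y < b + h \<and>
      f (a + h, b + h) - f (a + h, b) - f (a, b + h) + f (a, b) = h * h * dy (dx f) (x, y)"
    and "\<exists>x y. a < x \<and> x < a + h \<and> b < y \<and> y < b + h \<and>
      f (a + h, b + h) - f (a + h, b) - f (a, b + h) + f (a, b) = h * h * dx (dy f) (x, y)"
proof -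
  have S: "(x, y) \<in> S" if "a \<le> x" "x \<le> a + h" "b \<le> y" "y \<le> b + h" for x y
    using assms(2) that by auto
  note diff = smooth_on_imp_differentiable[OF _ S]
  have "\<exists>x. a < x \<and> x < a + h \<and> (f (a + h, b + h) - f (a + h, b)) - (f (a, b + h) - f (a, b)) =
      (a + h - a) * (dx f (x, b + h) - dx f (x, b))"
    using assms(1) diff[OF assms(3)]
    by (intro MVT2) (auto intro!: DERIV_diff DERIV_dx)
  then obtain x where x: "a < x" "x < a + h" "(f (a + h, b + h) - f (a + h, b)) - (f (a, b + h) - f (a, b)) =
      h * (dx f (x, b + h) - dx f (x, b))"
    by auto
  have "\<exists>y. b < y \<and> y < b + h \<and> dx f (x, b + h) - dx f (x, b) = (b + h - b) * dy (dx f) (x, y)"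
    using assms(1) diff[OF smooth_on_dx[OF assms(3)]] x
    by (intro MVT2) (auto intro!: DERIV_dy)
  then obtain y where "b < y" "y < b + h" "dx f (x, b + h) - dx f (x, b) = h * dy (dx f) (x, y)"
    by auto
  then show "\<exists>x y. a < x \<and> x < a + h \<and> b < y \<and> y < b + h \<and>
      f (a + h, b + h) - f (a + h, b) - f (a, b + h) + f (a, b) = h * h * dy (dx f) (x, y)"
    using x by (intro exI[of _ x] exI[of _ y]) auto
  have "\<exists>y. b < y \<and> y < b + h \<and> (f (a + h, b + h) - f (a, b + h)) - (f (a + h, b) - f (a, b)) =
      (b + h - b) * (dy f (a + h, y) - dy f (a, y))"
    using assms(1) diff[OF assms(3)]
    by (intro MVT2) (auto intro!: DERIV_diff DERIV_dy)
  then obtain y where y: "b < y" "y < b + h" "(f (a + h, b + h) - f (a, b + h)) - (f (a + h, b) - f (a, b)) =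
      h * (dy f (a + h, y) - dy f (a, y))"
    by auto
  have "\<exists>x. a < x \<and> x < a + h \<and> dy f (a + h, y) - dy f (a, y) = (a + h - a) * dx (dy f) (x, y)"
    using assms(1) diff[OF smooth_on_dy[OF assms(3)]] y
    by (intro MVT2) (auto intro!: DERIV_dx)
  then obtain x where "a < x" "x < a + h" "dy f (a + h, y) - dy f (a, y) = h * dx (dy f) (x, y)"
    by auto
  then show "\<exists>x y. a < x \<and> x < a + h \<and> b < y \<and> y < b + h \<and>
      f (a + h, b + h) - f (a + h, b) - f (a, b + h) + f (a, b) = h * h * dx (dy f) (x, y)"
    using y by (intro exI[of _ x] exI[of _ y]) auto
qed

lemma dx_dy_commute:
  assumes "open S" "smooth_on S f" "p \<in> S"
  shows "dx (dy f) p = dy (dx f) p"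
proof (rule ccontr)
  assume ne: "dx (dy f) p \<noteq> dy (dx f) p"
  \<comment> \<open>Half the gap: the balls of radius \<open>e\<close> about the two values are
    disjoint, while \<open>mixed_difference\<close> yields equal values of the two mixed derivatives
    at points close to \<open>p\<close>.\<close>
  define e where "e = \<bar>dx (dy f) p - dy (dx f) p\<bar> / 2"
  have e: "0 < e"
    using ne by (simp add: e_def)
  have "continuous_on S (dx (dy f))" "continuous_on S (dy (dx f))"
    using assms(2) by (auto intro!: smooth_on_imp_continuous_on smooth_on_dx smooth_on_dy)
  then have "open ((dx (dy f) -` ball (dx (dy f) p) e \<inter> S) \<inter> (dy (dx f) -` ball (dy (dx f) p) e \<inter> S))"
    by (intro open_Int continuous_on_open_vimage[OF assms(1), THEN iffD1, rule_format]) auto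
  moreover have "p \<in> (dx (dy f) -` ball (dx (dy f) p) e \<inter> S) \<inter> (dy (dx f) -` ball (dy (dx f) p) e \<inter> S)"
    using e assms(3) by auto
  ultimately obtain r where r: "0 < r"
    "square p r \<subseteq> (dx (dy f) -` ball (dx (dy f) p) e \<inter> S) \<inter> (dy (dx f) -` ball (dy (dx f) p) e \<inter> S)"
    by (rule open_contains_square)
  define h where "h = r / 2"
  have h: "0 < h" "h < r"
    using r(1) by (auto simp: h_def)
  have "{fst p..fst p + h} \<times> {snd p..snd p + h} \<subseteq> square p r"
    using h by (auto simp: mem_square)
  then have sub: "{fst p..fst p + h} \<times> {snd p..snd p + h} \<subseteq> S"
    using r(2) by blast
  obtain x y x' y' where xy: "fst p < x" "x < fst p + h" "snd p < y" "y < snd p + h"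
      "fst p < x'" "x' < fst p + h" "snd p < y'" "y' < snd p + h"
      and eq: "h * h * dy (dx f) (x, y) = h * h * dx (dy f) (x', y')"
    using mixed_difference[OF h(1) sub assms(2)] by (elim exE conjE) simp
  have "(x, y) \<in> square p r" "(x', y') \<in> square p r"
    using xy h by (auto simp: mem_square)
  then have "\<bar>dy (dx f) (x, y) - dy (dx f) p\<bar> < e" "\<bar>dx (dy f) (x', y') - dx (dy f) p\<bar> < e"
    using r(2) by (auto simp: dist_real_def abs_minus_commute)
  then show False
    using eq h(1) unfolding e_def by simp argo
qed

text \<open>Bootstrapping: since the derivative of the curve is \<open>F\<close> along the curve,
  class \<open>k\<close> of the curve gives class \<open>k\<close> of its derivative.\<close>

lemma smooth_on_integral_curve:
  fixes \<gamma> :: "real \<Rightarrow> 'a::euclidean_space"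
  assumes "open I" "open T" "smooth_on T F" "\<And>t. t \<in> I \<Longrightarrow> \<gamma> t \<in> T"
    and der: "\<And>t. t \<in> I \<Longrightarrow> (\<gamma> has_vector_derivative F (\<gamma> t)) (at t)"
  shows "smooth_on I \<gamma>"
  unfolding smooth_on_def
proof
  show "Ck_on k I \<gamma>" for k
  proof (induction k)
    case 0
    then show ?case
      using has_vector_derivative_continuous[OF der] by (simp add: continuous_at_imp_continuous_on)
  next
    case (Suc k)
    have "Ck_on k I (\<lambda>t. F (\<gamma> t))"
      using assms(3) by (intro Ck_on_compose[OF assms(1,2) Suc _ assms(4)]) (simp add: smooth_on_def)
    then have "Ck_on k I (\<lambda>t. v *\<^sub>R F (\<gamma> t))" for v
      by (intro Ck_on_bounded_linear[OF assms(1) bounded_linear_scaleR_right])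
    then show ?case
      using der unfolding has_vector_derivative_def by (intro Ck_on_SucI[OF assms(1)])
  qed
qed

text \<open>Implicit function theorem: the map \<open>(x, y)\<close> to \<open>(x, f)\<close>
  straightens the level sets, and the curve is the image of a horizontal segment under its inverse.
  Smoothness is not taken from the inverse map: the curve is an integral curve of the smooth field
  \<open>(1, - f_x / f_y)\<close>.\<close>

lemma level_curve:
  fixes f :: "plane \<Rightarrow> real"
  assumes "open S" "smooth_on S f" "p \<in> S" "dy f p \<noteq> 0"
  obtains \<gamma> e where "0 < e" "smooth_on {-e<..<e} \<gamma>" "\<gamma> 0 = p"
    "\<And>t. t \<in> {-e<..<e} \<Longrightarrow> \<gamma> t \<in> S \<and> f (\<gamma> t) = f p \<and> velocity \<gamma> t \<noteq> 0"
proof -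
  \<comment> \<open>A positive product says that \<open>dy f\<close> has the same sign as at
    \<open>p\<close>; on a square with this property \<open>f\<close> is strictly monotone along
    vertical segments.\<close>
  have "open ((\<lambda>q. dy f q * dy f p) -` {0<..} \<inter> S)"
    using assms(1,2) smooth_on_imp_continuous_on[OF smooth_on_dy[OF assms(2)]]
    by (intro iffD1[OF continuous_on_open_vimage, rule_format]) (auto intro!: continuous_intros)
  moreover have "p \<in> (\<lambda>q. dy f q * dy f p) -` {0<..} \<inter> S"
    using assms(3,4) by (auto simp: zero_less_mult_iff)
  ultimately obtain r where r: "0 < r" "square p r \<subseteq> (\<lambda>q. dy f q * dy f p) -` {0<..} \<inter> S"
    by (rule open_contains_square)
  define T where "T = square p r"
  have T: "open T" "p \<in> T" "T \<subseteq> S"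
    using r by (auto simp: T_def open_square center_in_square)
  have pos: "dy f q * dy f p > 0" if "q \<in> T" for q
    using r(2) that by (auto simp: T_def)
  define \<Phi> where "\<Phi> = (\<lambda>q. (fst q, f q))"
  have smT: "smooth_on T f"
    using assms(2) T(3) smooth_on_subset by blast
  have diff: "f differentiable (at q)" if "q \<in> T" for q
    using smT that by (rule smooth_on_imp_differentiable)
  have no: "f (x, y1) \<noteq> f (x, y2)" if "(x, y1) \<in> T" "(x, y2) \<in> T" "y1 < y2" for x y1 y2
  proof
    assume eq: "f (x, y1) = f (x, y2)"
    have mem: "(x, y) \<in> T" if "y1 \<le> y" "y \<le> y2" for y
      using that \<open>(x, y1) \<in> T\<close> \<open>(x, y2) \<in> T\<close> by (auto simp: T_def mem_square)
    have "\<exists>z. y1 < z \<and> z < y2 \<and> f (x, y2) - f (x, y1) = (y2 - y1) * dy f (x, z)"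
      using that mem by (intro MVT2) (auto intro!: DERIV_dy diff)
    then obtain z where "y1 < z" "z < y2" "dy f (x, z) = 0"
      using eq that by auto
    then show False
      using pos[OF mem[of z]] by auto
  qed
  have inj: "inj_on \<Phi> T"
  proof (rule inj_onI)
    fix q q' assume *: "q \<in> T" "q' \<in> T" "\<Phi> q = \<Phi> q'"
    then show "q = q'"
      using no[of "fst q" "snd q" "snd q'"] no[of "fst q" "snd q'" "snd q"]
      by (cases q; cases q'; cases "snd q" "snd q'" rule: linorder_cases) (auto simp: \<Phi>_def)
  qed
  have cont: "continuous_on T \<Phi>"
    unfolding \<Phi>_def using smooth_on_imp_continuous_on[OF smT] by (intro continuous_intros)
  \<comment> \<open>Openness of the image makes the horizontal line through the image of
    \<open>p\<close> stay in the domain of the inverse for small times.\<close>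
  have op: "open (\<Phi> ` T)"
    by (rule invariance_of_domain[OF cont T(1) inj])
  define g where "g = inv_into T \<Phi>"
  have gder: "(g has_derivative (\<lambda>w. (fst w, (snd w - fst w * dx f q) / dy f q))) (at (\<Phi> q))" if "q \<in> T" for q
  proof (rule has_derivative_inverse_strong[OF T(1) that cont])
    show "g (\<Phi> x) = x" if "x \<in> T" for x
      using inj that by (simp add: g_def)
    show "(\<Phi> has_derivative (\<lambda>v. (fst v, fst v * dx f q + snd v * dy f q))) (at q)"
      unfolding \<Phi>_def using diff[OF that]
      by (intro has_derivative_Pair has_derivative_plane) (auto intro!: derivative_eq_intros)
    show "(\<lambda>v. (fst v, fst v * dx f q + snd v * dy f q)) \<circ> (\<lambda>w. (fst w, (snd w - fst w * dx f q) / dy f q)) = id"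
      using pos[OF that] by (auto simp: fun_eq_iff)
  qed
  have "open ((\<lambda>t. (fst p + t, f p)) -` (\<Phi> ` T))"
    using op by (intro open_vimage continuous_intros)
  moreover have "0 \<in> (\<lambda>t. (fst p + t, f p)) -` (\<Phi> ` T)"
    using T(2) by (auto simp: \<Phi>_def)
  ultimately obtain e where e: "0 < e" "ball 0 e \<subseteq> (\<lambda>t. (fst p + t, f p)) -` (\<Phi> ` T)"
    using openE by blast
  have eT: "(fst p + t, f p) \<in> \<Phi> ` T" if "t \<in> {-e<..<e}" for t
  proof -
    have "t \<in> ball 0 e"
      using that by (auto simp: dist_real_def)
    then show ?thesis using e(2) by blast
  qed
  define \<gamma> where "\<gamma> = (\<lambda>t. g (fst p + t, f p))"
  have g1: "\<gamma> t \<in> T \<and> \<Phi> (\<gamma> t) = (fst p + t, f p)" if "t \<in> {-e<..<e}" for t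
    using eT[OF that] by (simp add: \<gamma>_def g_def inv_into_into f_inv_into_f)
  have der: "(\<gamma> has_vector_derivative (1, - (dx f (\<gamma> t) / dy f (\<gamma> t)))) (at t)" if "t \<in> {-e<..<e}" for t
  proof -
    have "(g has_derivative (\<lambda>w. (fst w, (snd w - fst w * dx f (\<gamma> t)) / dy f (\<gamma> t)))) (at (fst p + t, f p))"
      using gder[of "\<gamma> t"] g1[OF that] by simp
    moreover have "((\<lambda>t. (fst p + t, f p)) has_derivative (\<lambda>h. (h, 0))) (at t)"
      by (auto intro!: derivative_eq_intros)
    ultimately have "((\<lambda>t. g (fst p + t, f p)) has_derivative
        (\<lambda>h. (h, (0 - h * dx f (\<gamma> t)) / dy f (\<gamma> t)))) (at t)"
      by (auto dest: has_derivative_compose)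
    then show ?thesis
      by (simp add: has_vector_derivative_def \<gamma>_def)
  qed
  show ?thesis
  proof (rule that[OF e(1)])
    have "smooth_on T (\<lambda>q. (1::real, - (dx f q / dy f q)))"
      using T(1) smT pos by (intro smooth_intros) (auto dest!: pos)
    then show "smooth_on {-e<..<e} \<gamma>"
      using g1 der by (intro smooth_on_integral_curve[OF _ T(1)]) auto
    have "\<Phi> (\<gamma> 0) = \<Phi> p"
      using g1[of 0] e(1) by (simp add: \<Phi>_def)
    then show "\<gamma> 0 = p"
      using inj_onD[OF inj] g1[of 0] e(1) T(2) by auto
    show "\<gamma> t \<in> S \<and> f (\<gamma> t) = f p \<and> velocity \<gamma> t \<noteq> 0" if "t \<in> {-e<..<e}" for t
      using g1[OF that] T(3) vector_derivative_at[OF der[OF that]]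
      by (auto simp: \<Phi>_def velocity_def zero_prod_def)
  qed
qed

section \<open>Antiderivatives\<close>

text \<open>The weights \<open>t ^ j\<close> make the class of these integrals closed under differentiation.\<close>

definition ray_integral :: "real \<Rightarrow> nat \<Rightarrow> (plane \<Rightarrow> real) \<Rightarrow> plane \<Rightarrow> real" where
  "ray_integral c j f q = integral {0..1} (\<lambda>t. t ^ j * f (c + t * (fst q - c), snd q))"

lemma ray_in_square:
  assumes "q \<in> square p r" "t \<in> {0..1}"
  shows "(fst p + t * (fst q - fst p), snd q) \<in> square p r"
proof -
  have "\<bar>t * (fst q - fst p)\<bar> \<le> \<bar>fst q - fst p\<bar>"
    using assms(2) by (auto simp: abs_mult intro!: mult_left_le_one_le)
  then show ?thesis
    using assms(1) by (auto simp: mem_square)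
qed

lemma ray_continuous_on:
  assumes "smooth_on (square p r) f"
  shows "continuous_on (square p r \<times> {0..1}) (\<lambda>(q, t). t ^ j * f (fst p + t * (fst q - fst p), snd q))"
proof -
  have "continuous_on (square p r \<times> {0..1}) (\<lambda>x. f (fst p + snd x * (fst (fst x) - fst p), snd (fst x)))"
    by (rule continuous_on_compose2[OF smooth_on_imp_continuous_on[OF assms]])
      (auto intro!: continuous_intros ray_in_square)
  then show ?thesis
    by (auto simp: case_prod_unfold intro!: continuous_intros)
qed

lemma ray_continuous_on_unit:
  assumes "smooth_on (square p r) f" "q \<in> square p r"
  shows "continuous_on {0..1} (\<lambda>t. t ^ j * f (fst p + t * (fst q - fst p), snd q))"
  using continuous_on_compose2[OF ray_continuous_on[OF assms(1), of j], of "{0..1}" "\<lambda>t. (q, t)"] assms(2)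
  by (auto simp: image_subset_iff continuous_on_Pair)

lemma ray_integrable:
  assumes "smooth_on (square p r) f" "q \<in> square p r"
  shows "(\<lambda>t. t ^ j * f (fst p + t * (fst q - fst p), snd q)) integrable_on {0..1}"
  using ray_continuous_on_unit[OF assms] by (rule integrable_continuous_real)

text \<open>Differentiation under the integral sign. Moving \<open>q\<close> horizontally moves the
  integration point \<open>t\<close> times as fast, hence one more power of \<open>t\<close> with
  \<open>dx f\<close> and none with \<open>dy f\<close>.\<close>

lemma has_derivative_ray_integral:
  assumes sm: "smooth_on (square p r) f" and q: "q \<in> square p r"
  shows "(ray_integral (fst p) j f has_derivative
    (\<lambda>v. fst v * ray_integral (fst p) (Suc j) (dx f) q + snd v * ray_integral (fst p) j (dy f) q)) (at q)"
proof -
  let ?K = "\<lambda>j f q t. t ^ j * f (fst p + t * (fst q - fst p), snd q)"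
  \<comment> \<open>The derivative of the integrand in \<open>q\<close>, packaged as a bounded
    linear map as the Leibniz rule expects.\<close>
  define D :: "plane \<Rightarrow> real \<Rightarrow> plane \<Rightarrow>\<^sub>L real" where "D = (\<lambda>q t. ?K (Suc j) (dx f) q t *\<^sub>R fst_blinfun + ?K j (dy f) q t *\<^sub>R snd_blinfun)"
  note cont = ray_continuous_on[OF smooth_on_dx[OF sm], of "Suc j"] ray_continuous_on[OF smooth_on_dy[OF sm], of j]
  have "((\<lambda>q. integral (cbox 0 1) (?K j f q)) has_derivative integral (cbox 0 1) (D q)) (at q within square p r)"
  proof (rule leibniz_rule[OF _ _ _ q convex_square])
    fix x :: plane and t :: real
    assume *: "x \<in> square p r" "t \<in> cbox 0 1"
    have "f differentiable (at (fst p + t * (fst x - fst p), snd x))"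
      using * by (intro smooth_on_imp_differentiable[OF sm] ray_in_square) auto
    moreover have "((\<lambda>q. (fst p + t * (fst q - fst p), snd q)) has_derivative (\<lambda>v. (t * fst v, snd v)))
        (at x within square p r)"
      by (auto intro!: derivative_eq_intros)
    ultimately have "((\<lambda>q. f (fst p + t * (fst q - fst p), snd q)) has_derivative
      (\<lambda>v. t * fst v * dx f (fst p + t * (fst x - fst p), snd x) + snd v * dy f (fst p + t * (fst x - fst p), snd x)))
      (at x within square p r)"
      by (auto dest!: has_derivative_plane dest: has_derivative_compose)
    then have "((\<lambda>q. ?K j f q t) has_derivative
      (\<lambda>v. t ^ j * (t * fst v * dx f (fst p + t * (fst x - fst p), snd x) + snd v * dy f (fst p + t * (fst x - fst p), snd x))))
      (at x within square p r)"
      by (rule has_derivative_mult_right)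
    moreover have "blinfun_apply (D x t) = (\<lambda>v. t ^ j * (t * fst v * dx f (fst p + t * (fst x - fst p), snd x)
        + snd v * dy f (fst p + t * (fst x - fst p), snd x)))"
      by (auto simp: D_def blinfun.add_left blinfun.scaleR_left algebra_simps)
    ultimately show "((\<lambda>q. ?K j f q t) has_derivative blinfun_apply (D x t)) (at x within square p r)"
      by simp
  next
    show "?K j f x integrable_on cbox 0 1" if "x \<in> square p r" for x
      using ray_integrable[OF sm that] by simp
    show "continuous_on (square p r \<times> cbox 0 1) (\<lambda>(x, t). D x t)"
      using cont by (auto simp: D_def case_prod_unfold intro!: continuous_intros)
  qed
  moreover have "blinfun_apply (integral (cbox 0 1) (D q)) v =
      fst v * ray_integral (fst p) (Suc j) (dx f) q + snd v * ray_integral (fst p) j (dy f) q" for v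
  proof -
    have int: "?K (Suc j) (dx f) q integrable_on {0..1}" "?K j (dy f) q integrable_on {0..1}"
      using ray_integrable[OF smooth_on_dx[OF sm] q] ray_integrable[OF smooth_on_dy[OF sm] q] by blast+
    have "continuous_on {0..1} (D q)"
      unfolding D_def
      by (intro continuous_on_add continuous_on_scaleR continuous_on_const ray_continuous_on_unit[of p r]
          smooth_on_dx smooth_on_dy sm q)
    then have "D q integrable_on {0..1}"
      by (rule integrable_continuous_real)
    then have "blinfun_apply (integral {0..1} (D q)) v = integral {0..1} (\<lambda>t. blinfun_apply (D q t) v)"
      by (rule blinfun_apply_integral)
    also have "\<dots> = integral {0..1} (\<lambda>t. fst v * ?K (Suc j) (dx f) q t + snd v * ?K j (dy f) q t)"
      by (simp add: D_def blinfun.add_left blinfun.scaleR_left mult.commute)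
    also have "\<dots> = integral {0..1} (\<lambda>t. fst v * ?K (Suc j) (dx f) q t) + integral {0..1} (\<lambda>t. snd v * ?K j (dy f) q t)"
      by (intro integral_add integrable_on_mult_right int)
    also have "\<dots> = fst v * ray_integral (fst p) (Suc j) (dx f) q + snd v * ray_integral (fst p) j (dy f) q"
      unfolding ray_integral_def by (simp only: integral_mult_right)
    finally show ?thesis by simp
  qed
  ultimately have "(ray_integral (fst p) j f has_derivative
    (\<lambda>v. fst v * ray_integral (fst p) (Suc j) (dx f) q + snd v * ray_integral (fst p) j (dy f) q)) (at q within square p r)"
    unfolding ray_integral_def[abs_def] by (simp add: has_derivative_eq_rhs ext)
  then show ?thesis
    using at_within_open[OF q open_square] by simp
qed

lemma smooth_on_ray_integral:
  assumes "smooth_on (square p r) f"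
  shows "smooth_on (square p r) (ray_integral (fst p) j f)"
  unfolding smooth_on_def
proof
  show "Ck_on k (square p r) (ray_integral (fst p) j f)" for k
    using assms
  proof (induction k arbitrary: j f)
    case 0
    then show ?case
      by (auto intro!: continuous_at_imp_continuous_on has_derivative_continuous has_derivative_ray_integral)
  next
    case (Suc k)
    show ?case
      by (rule Ck_on_SucI[OF open_square has_derivative_ray_integral[OF Suc.prems]])
        (auto intro!: Ck_on_add open_square Suc.IH smooth_on_dx smooth_on_dy Suc.prems
          Ck_on_bounded_linear[OF open_square bounded_linear_mult_right])
  qed
qed

lemma antiderivative_dx:
  assumes sm: "smooth_on (square p r) f"
  obtains F where "smooth_on (square p r) F" "\<And>q. q \<in> square p r \<Longrightarrow> dx F q = f q" "\<And>y. F (fst p, y) = 0"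
proof
  \<comment> \<open>This is the integral of \<open>f\<close> along the horizontal segment from
    \<open>x = fst p\<close> to \<open>q\<close>, rescaled to the fixed interval from 0 to 1. Fixed
    limits make smoothness in both variables available at once.\<close>
  define F where "F = (\<lambda>q. (fst q - fst p) * ray_integral (fst p) 0 f q)"
  show "smooth_on (square p r) F"
    unfolding F_def by (intro smooth_intros open_square smooth_on_ray_integral sm)
  show "F (fst p, y) = 0" for y
    by (simp add: F_def)
  show "dx F q = f q" if q: "q \<in> square p r" for q
  proof -
    let ?c = "\<lambda>t. (fst p + t * (fst q - fst p), snd q)"
    have "(F has_derivative (\<lambda>v. (fst q - fst p) * (fst v * ray_integral (fst p) (Suc 0) (dx f) q
        + snd v * ray_integral (fst p) 0 (dy f) q) + fst v * ray_integral (fst p) 0 f q)) (at q)"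
      unfolding F_def
      by (rule derivative_eq_intros has_derivative_ray_integral[OF sm q] refl)+ auto
    then have "dx F q = (fst q - fst p) * ray_integral (fst p) (Suc 0) (dx f) q + ray_integral (fst p) 0 f q"
      using dx_dyI(1) by fastforce
    \<comment> \<open>The integrand that arises from differentiating \<open>F\<close> is the
      \<open>t\<close>-derivative of \<open>t * f (?c t)\<close>, whose boundary values are
      \<open>f q\<close> and 0.\<close>
    moreover have "((\<lambda>t. (fst q - fst p) * (t ^ Suc 0 * dx f (?c t)) + t ^ 0 * f (?c t)) has_integral
        1 * f (?c 1) - 0 * f (?c 0)) {0..1}"
    proof (rule fundamental_theorem_of_calculus)
      fix t :: real assume t: "t \<in> {0..1}"
      have "f differentiable (at (?c t))"
        using t by (intro smooth_on_imp_differentiable[OF sm] ray_in_square q)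
      moreover have "((\<lambda>t. fst p + t * (fst q - fst p)) has_real_derivative fst q - fst p) (at t)"
        by (auto intro!: derivative_eq_intros)
      ultimately have "((\<lambda>t. f (?c t)) has_real_derivative dx f (?c t) * (fst q - fst p)) (at t)"
        using DERIV_chain2 DERIV_dx by fastforce
      then have "((\<lambda>t. t * f (?c t)) has_real_derivative
          (fst q - fst p) * (t ^ Suc 0 * dx f (?c t)) + t ^ 0 * f (?c t)) (at t)"
        by (auto intro!: derivative_eq_intros)
      then show "((\<lambda>t. t * f (?c t)) has_vector_derivative
          (fst q - fst p) * (t ^ Suc 0 * dx f (?c t)) + t ^ 0 * f (?c t)) (at t within {0..1})"
        by (metis (no_types, lifting) has_field_derivative_at_within has_real_derivative_iff_has_vector_derivative)
    qed simp
    then have "integral {0..1} (\<lambda>t. (fst q - fst p) * (t ^ Suc 0 * dx f (?c t)) + t ^ 0 * f (?c t)) = f q"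
      by (auto dest: integral_unique)
    moreover have "integral {0..1} (\<lambda>t. (fst q - fst p) * (t ^ Suc 0 * dx f (?c t)) + t ^ 0 * f (?c t)) =
        (fst q - fst p) * ray_integral (fst p) (Suc 0) (dx f) q + ray_integral (fst p) 0 f q"
    proof -
      have "integral {0..1} (\<lambda>t. (fst q - fst p) * (t ^ Suc 0 * dx f (?c t)) + t ^ 0 * f (?c t)) =
        integral {0..1} (\<lambda>t. (fst q - fst p) * (t ^ Suc 0 * dx f (?c t))) + integral {0..1} (\<lambda>t. t ^ 0 * f (?c t))"
        using ray_integrable[OF smooth_on_dx[OF sm] q, of "Suc 0"] ray_integrable[OF sm q, of 0]
        by (intro integral_add integrable_on_mult_right) auto
      then show ?thesis
        unfolding ray_integral_def by (simp only: integral_mult_right)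
    qed
    ultimately show ?thesis by simp
  qed
qed

text \<open>Reflection in the diagonal turns statements about \<open>x\<close> into statements about
  \<open>y\<close>; it serves for antiderivatives, level curves and the second Riccati
  equation.\<close>

lemma dx_dy_swap:
  assumes "f differentiable (at (prod.swap q))"
  shows "dx (\<lambda>q. f (prod.swap q)) q = dy f (prod.swap q)"
    and "dy (\<lambda>q. f (prod.swap q)) q = dx f (prod.swap q)"
proof -
  have "(prod.swap has_derivative (\<lambda>v. prod.swap v)) (at q)"
    unfolding prod.swap_def by (auto intro!: derivative_eq_intros)
  from has_derivative_compose[OF this has_derivative_plane[OF assms]]
  show "dx (\<lambda>q. f (prod.swap q)) q = dy f (prod.swap q)"
    "dy (\<lambda>q. f (prod.swap q)) q = dx f (prod.swap q)"
    by (auto dest: dx_dyI)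
qed

lemma smooth_on_swap:
  fixes f :: "plane \<Rightarrow> real"
  assumes "open S" "open T" "smooth_on T f" "\<And>q. q \<in> S \<Longrightarrow> prod.swap q \<in> T"
  shows "smooth_on S (\<lambda>q. f (prod.swap q))"
proof (rule smooth_on_compose[OF assms(1,2) _ assms(3,4)])
  show "smooth_on S prod.swap"
    unfolding prod.swap_def using assms(1) by (intro smooth_intros)
qed

lemma antiderivative_dy:
  assumes sm: "smooth_on (square p r) f"
  obtains F where "smooth_on (square p r) F" "\<And>q. q \<in> square p r \<Longrightarrow> dy F q = f q" "\<And>x. F (x, snd p) = 0"
proof -
  have "smooth_on (square (prod.swap p) r) (\<lambda>q. f (prod.swap q))"
    using sm by (intro smooth_on_swap[OF open_square open_square]) (auto simp: mem_square)
  then obtain F where F: "smooth_on (square (prod.swap p) r) F"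
      "\<And>q. q \<in> square (prod.swap p) r \<Longrightarrow> dx F q = f (prod.swap q)" "\<And>y. F (fst (prod.swap p), y) = 0"
    by (rule antiderivative_dx) blast
  show ?thesis
  proof (rule that)
    show "smooth_on (square p r) (\<lambda>q. F (prod.swap q))"
      using F(1) by (intro smooth_on_swap[OF open_square open_square]) (auto simp: mem_square)
    show "dy (\<lambda>q. F (prod.swap q)) q = f q" if "q \<in> square p r" for q
    proof -
      have "prod.swap q \<in> square (prod.swap p) r"
        using that by (auto simp: mem_square)
      then show ?thesis
        using F(2)[of "prod.swap q"] dx_dy_swap(2)[OF smooth_on_imp_differentiable[OF F(1)]] by simp
    qed
    show "F (prod.swap (x, snd p)) = 0" for x
      using F(3) by simp
  qed
qed

section \<open>Germs of smooth maps\<close>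

lemma smooth_nearI: "open W \<Longrightarrow> p \<in> W \<Longrightarrow> smooth_on W f \<Longrightarrow> smooth_near p f"
  unfolding smooth_near_def by blast

lemma smooth_near_common:
  assumes "smooth_near p f" "smooth_near p g"
  obtains W where "open W" "p \<in> W" "smooth_on W f" "smooth_on W g"
proof -
  obtain V W where "open V" "p \<in> V" "smooth_on V f" "open W" "p \<in> W" "smooth_on W g"
    using assms unfolding smooth_near_def by blast
  then show ?thesis
    by (intro that[of "V \<inter> W"]) (auto intro: smooth_on_subset)
qed

lemma smooth_near_const: "smooth_near p (\<lambda>_. c)"
  by (rule smooth_nearI[of UNIV]) (auto intro: smooth_on_const)

lemma smooth_near_fst: "smooth_near p f \<Longrightarrow> smooth_near p (\<lambda>q. fst (f q))"
  unfolding smooth_near_def using smooth_on_fst by blast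

lemma smooth_near_snd: "smooth_near p f \<Longrightarrow> smooth_near p (\<lambda>q. snd (f q))"
  unfolding smooth_near_def using smooth_on_snd by blast

lemma smooth_near_add: "smooth_near p f \<Longrightarrow> smooth_near p g \<Longrightarrow> smooth_near p (\<lambda>q. f q + g q)"
  by (erule smooth_near_common, assumption) (blast intro: smooth_nearI smooth_on_add)

lemma smooth_near_diff: "smooth_near p f \<Longrightarrow> smooth_near p g \<Longrightarrow> smooth_near p (\<lambda>q. f q - g q)"
  by (erule smooth_near_common, assumption) (blast intro: smooth_nearI smooth_on_diff)

lemma smooth_near_scaleR: "smooth_near p f \<Longrightarrow> smooth_near p g \<Longrightarrow> smooth_near p (\<lambda>q. f q *\<^sub>R g q)"
  by (erule smooth_near_common, assumption) (blast intro: smooth_nearI smooth_on_scaleR)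

lemma smooth_near_mult:
  fixes f g :: "'a::euclidean_space \<Rightarrow> real"
  shows "smooth_near p f \<Longrightarrow> smooth_near p g \<Longrightarrow> smooth_near p (\<lambda>q. f q * g q)"
  by (erule smooth_near_common, assumption) (blast intro: smooth_nearI smooth_on_mult)

lemma smooth_near_Pair:
  fixes f g :: "'a::euclidean_space \<Rightarrow> real"
  shows "smooth_near p f \<Longrightarrow> smooth_near p g \<Longrightarrow> smooth_near p (\<lambda>q. (f q, g q))"
  by (erule smooth_near_common, assumption) (blast intro: smooth_nearI smooth_on_Pair)

lemma smooth_near_frechet_derivative_field:
  "smooth_near p f \<Longrightarrow> smooth_near p X \<Longrightarrow> smooth_near p (\<lambda>q. frechet_derivative f (at q) (X q))"
  by (erule smooth_near_common, assumption) (blast intro: smooth_nearI smooth_on_frechet_derivative_field)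

lemmas smooth_near_intros =
  smooth_near_const smooth_near_fst smooth_near_snd smooth_near_add smooth_near_diff smooth_near_scaleR
  smooth_near_mult smooth_near_Pair smooth_near_frechet_derivative_field

lemma smooth_near_cong:
  assumes "smooth_near p f" "open W" "p \<in> W" "\<And>q. q \<in> W \<Longrightarrow> f q = g q"
  shows "smooth_near p g"
proof -
  obtain V where V: "open V" "p \<in> V" "smooth_on V f"
    using assms(1) unfolding smooth_near_def by blast
  have "smooth_on (V \<inter> W) g"
    using smooth_on_cong[of "V \<inter> W" f g] smooth_on_subset[OF V(3), of "V \<inter> W"] V(1) assms by auto
  then show ?thesis
    using V assms by (intro smooth_nearI[of "V \<inter> W"]) auto
qed

lemma smooth_near_imp_differentiable: "smooth_near p f \<Longrightarrow> f differentiable (at p)"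
  unfolding smooth_near_def using smooth_on_imp_differentiable by blast

lemma Ck_on_local:
  assumes "open W" "\<And>p. p \<in> W \<Longrightarrow> \<exists>V. open V \<and> p \<in> V \<and> Ck_on k V f"
  shows "Ck_on k W f"
  using assms(2)
proof (induction k arbitrary: f)
  case 0
  then show ?case
    by (metis Ck_on.simps(1) continuous_at_imp_continuous_on continuous_on_eq_continuous_at)
next
  case (Suc k)
  have "f differentiable (at p)" if "p \<in> W" for p
    using Suc.prems[OF that] by auto
  moreover have "Ck_on k W (\<lambda>x. frechet_derivative f (at x) v)" for v
    using Suc.prems by (intro Suc.IH) fastforce
  ultimately show ?case by simp
qed

text \<open>The connection axioms give smoothness only near each point separately. This assembles
  such local information, notably for the Christoffel symbols.\<close>

lemma smooth_on_local:
  assumes "open W" "\<And>p. p \<in> W \<Longrightarrow> smooth_near p f"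
  shows "smooth_on W f"
  unfolding smooth_on_def
proof
  show "Ck_on k W f" for k
    using assms unfolding smooth_near_def smooth_on_def by (intro Ck_on_local) blast+
qed

section \<open>Connections in coordinates\<close>

lemma affine_connectionD:
  assumes "affine_connection U D" "p \<in> U" "smooth_near p X" "smooth_near p Y"
  shows "smooth_near p (D X Y)"
    and "smooth_near p X' \<Longrightarrow> D (\<lambda>q. X q + X' q) Y p = D X Y p + D X' Y p"
    and "smooth_near p g \<Longrightarrow> D (\<lambda>q. g q *\<^sub>R X q) Y p = g p *\<^sub>R D X Y p"
    and "smooth_near p Y' \<Longrightarrow> D X (\<lambda>q. Y q + Y' q) p = D X Y p + D X Y' p"
    and "smooth_near p g \<Longrightarrow> D X (\<lambda>q. g q *\<^sub>R Y q) p =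
            frechet_derivative g (at p) (X p) *\<^sub>R Y p + g p *\<^sub>R D X Y p"
    and "D X Y p - D Y X p = lie_bracket X Y p"
proof -
  have c: "is_connection U D" "torsion_free U D"
    using assms(1) unfolding affine_connection_def by auto
  note * = c(1)[unfolded is_connection_def, rule_format, OF assms(2)]
  \<comment> \<open>Constant zero fields and functions serve as the remaining arguments when one
    axiom is extracted from the bundle.\<close>
  have k: "smooth_near p (\<lambda>_. 0 :: plane)" "smooth_near p (\<lambda>_. 0 :: real)"
    by (rule smooth_near_const)+
  show "smooth_near p (D X Y)"
    using *[OF assms(3) k(1) assms(4) k(1) k(2)] by blast
  show "smooth_near p X' \<Longrightarrow> D (\<lambda>q. X q + X' q) Y p = D X Y p + D X' Y p"
    using *[OF assms(3) _ assms(4) k(1) k(2)] by blast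
  show "smooth_near p g \<Longrightarrow> D (\<lambda>q. g q *\<^sub>R X q) Y p = g p *\<^sub>R D X Y p"
    using *[OF assms(3) k(1) assms(4) k(1)] by blast
  show "smooth_near p Y' \<Longrightarrow> D X (\<lambda>q. Y q + Y' q) p = D X Y p + D X Y' p"
    using *[OF assms(3) k(1) assms(4) _ k(2)] by blast
  show "smooth_near p g \<Longrightarrow> D X (\<lambda>q. g q *\<^sub>R Y q) p =
            frechet_derivative g (at p) (X p) *\<^sub>R Y p + g p *\<^sub>R D X Y p"
    using *[OF assms(3) k(1) assms(4) k(1)] by blast
  show "D X Y p - D Y X p = lie_bracket X Y p"
    using c(2) assms unfolding torsion_free_def by blast
qed

text \<open>Constant fields have zero derivative, so this is the bilinear coordinate part of the
  connection, the same term that enters \<open>covariant_acceleration\<close>.\<close>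

definition christoffel :: "connection \<Rightarrow> plane \<Rightarrow> plane \<Rightarrow> plane \<Rightarrow> plane" where
  "christoffel D u v p = D (\<lambda>_. u) (\<lambda>_. v) p"

lemma christoffel_commute:
  assumes "affine_connection U D" "p \<in> U"
  shows "christoffel D u v p = christoffel D v u p"
  using affine_connectionD(6)[OF assms smooth_near_const smooth_near_const, of u v]
  by (simp add: christoffel_def lie_bracket_def)

lemma christoffel_expand:
  assumes "affine_connection U D" "p \<in> U"
  shows "christoffel D u v p = (fst u * fst v) *\<^sub>R christoffel D (1, 0) (1, 0) p
    + (fst u * snd v + snd u * fst v) *\<^sub>R christoffel D (1, 0) (0, 1) p
    + (snd u * snd v) *\<^sub>R christoffel D (0, 1) (0, 1) p"
proof -
  note D = affine_connectionD[OF assms smooth_near_const smooth_near_const]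
  have left: "christoffel D u v p = fst u *\<^sub>R christoffel D (1, 0) v p + snd u *\<^sub>R christoffel D (0, 1) v p" for u v
  proof -
    have "u = fst u *\<^sub>R (1, 0) + snd u *\<^sub>R (0, 1)"
      by (simp add: prod_eq_iff)
    then have "christoffel D u v p = D (\<lambda>_. fst u *\<^sub>R (1, 0) + snd u *\<^sub>R (0, 1)) (\<lambda>_. v) p"
      by (simp add: christoffel_def)
    also have "\<dots> = D (\<lambda>_. fst u *\<^sub>R (1, 0)) (\<lambda>_. v) p + D (\<lambda>_. snd u *\<^sub>R (0, 1)) (\<lambda>_. v) p"
      by (intro D smooth_near_const)
    also have "\<dots> = fst u *\<^sub>R christoffel D (1, 0) v p + snd u *\<^sub>R christoffel D (0, 1) v p"
      unfolding christoffel_def by (intro arg_cong2[of _ _ _ _ "(+)"] D(3) smooth_near_const)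
    finally show ?thesis .
  qed
  have right: "christoffel D u v p = fst v *\<^sub>R christoffel D u (1, 0) p + snd v *\<^sub>R christoffel D u (0, 1) p" for u v
    using left[of v u] christoffel_commute[OF assms] by simp
  show ?thesis
    unfolding left[of u v] right[of "(1, 0)" v] right[of "(0, 1)" v]
    using christoffel_commute[OF assms, of "(0, 1)" "(1, 0)"]
    by (simp add: algebra_simps)
qed

text \<open>Both fields are expanded in the coordinate frame with their components as coefficients;
  function-linearity in \<open>X\<close> and the Leibniz rule in \<open>Y\<close> do the rest.
  Locality is no axiom of \<open>is_connection\<close>; it is obtained from this formula, which sees
  only \<open>X p\<close> and the first jet of \<open>Y\<close> at \<open>p\<close>.\<close>

lemma connection_coordinates:
  assumes "affine_connection U D" "p \<in> U" "smooth_near p X" "smooth_near p Y"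
  shows "D X Y p = frechet_derivative Y (at p) (X p) + christoffel D (X p) (Y p) p"
proof -
  have c: "smooth_near p (\<lambda>_. v)" for v :: plane
    by (rule smooth_near_const)
  note D = affine_connectionD[OF assms(1,2)]
  let ?c = "christoffel D"
  have s: "smooth_near p (\<lambda>q. fst (X q))" "smooth_near p (\<lambda>q. snd (X q))"
      "smooth_near p (\<lambda>q. fst (Y q))" "smooth_near p (\<lambda>q. snd (Y q))"
    using assms(3,4) by (auto intro: smooth_near_fst smooth_near_snd)
  have "Y = (\<lambda>q. fst (Y q) *\<^sub>R (1, 0) + snd (Y q) *\<^sub>R (0, 1))"
    by (auto simp: prod_eq_iff)
  then have "D X Y p = D X (\<lambda>q. fst (Y q) *\<^sub>R (1, 0) + snd (Y q) *\<^sub>R (0, 1)) p"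
    by simp
  also have "\<dots> = D X (\<lambda>q. fst (Y q) *\<^sub>R (1, 0)) p + D X (\<lambda>q. snd (Y q) *\<^sub>R (0, 1)) p"
    by (intro D(4) assms(3) smooth_near_scaleR s smooth_near_const)
  also have "D X (\<lambda>q. fst (Y q) *\<^sub>R (1, 0)) p =
      frechet_derivative (\<lambda>q. fst (Y q)) (at p) (X p) *\<^sub>R (1, 0) + fst (Y p) *\<^sub>R D X (\<lambda>_. (1, 0)) p"
    by (rule D(5)[OF assms(3) smooth_near_const s(3)])
  also have "D X (\<lambda>q. snd (Y q) *\<^sub>R (0, 1)) p =
      frechet_derivative (\<lambda>q. snd (Y q)) (at p) (X p) *\<^sub>R (0, 1) + snd (Y p) *\<^sub>R D X (\<lambda>_. (0, 1)) p"
    by (rule D(5)[OF assms(3) smooth_near_const s(4)])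
  finally have 1: "D X Y p = (frechet_derivative (\<lambda>q. fst (Y q)) (at p) (X p) *\<^sub>R (1, 0) + fst (Y p) *\<^sub>R D X (\<lambda>_. (1, 0)) p)
     + (frechet_derivative (\<lambda>q. snd (Y q)) (at p) (X p) *\<^sub>R (0, 1) + snd (Y p) *\<^sub>R D X (\<lambda>_. (0, 1)) p)" .
  have 2: "D X (\<lambda>_. v) p = ?c (X p) v p" for v
  proof -
    have "X = (\<lambda>q. fst (X q) *\<^sub>R (1, 0) + snd (X q) *\<^sub>R (0, 1))"
      by (auto simp: prod_eq_iff)
    then have "D X (\<lambda>_. v) p = D (\<lambda>q. fst (X q) *\<^sub>R (1, 0) + snd (X q) *\<^sub>R (0, 1)) (\<lambda>_. v) p"
      by simp
    also have "\<dots> = D (\<lambda>q. fst (X q) *\<^sub>R (1, 0)) (\<lambda>_. v) p + D (\<lambda>q. snd (X q) *\<^sub>R (0, 1)) (\<lambda>_. v) p"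
      by (intro D(2) smooth_near_scaleR s smooth_near_const)
    also have "D (\<lambda>q. fst (X q) *\<^sub>R (1, 0)) (\<lambda>_. v) p = fst (X p) *\<^sub>R ?c (1, 0) v p"
      unfolding christoffel_def by (intro D(3) c s)
    also have "D (\<lambda>q. snd (X q) *\<^sub>R (0, 1)) (\<lambda>_. v) p = snd (X p) *\<^sub>R ?c (0, 1) v p"
      unfolding christoffel_def by (intro D(3) c s)
    finally show ?thesis
      unfolding christoffel_expand[OF assms(1,2), of "X p" v] christoffel_expand[OF assms(1,2), of "(1, 0)" v]
        christoffel_expand[OF assms(1,2), of "(0, 1)" v]
      by (simp add: algebra_simps)
  qed
  have "(Y has_derivative (\<lambda>v. (frechet_derivative (\<lambda>q. fst (Y q)) (at p) v, frechet_derivative (\<lambda>q. snd (Y q)) (at p) v))) (at p)"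
    using has_derivative_Pair[OF smooth_near_imp_differentiable[OF s(3), THEN frechet_derivative_works[THEN iffD1]]
        smooth_near_imp_differentiable[OF s(4), THEN frechet_derivative_works[THEN iffD1]]]
    by simp
  then have 3: "frechet_derivative Y (at p) (X p) =
      (frechet_derivative (\<lambda>q. fst (Y q)) (at p) (X p), frechet_derivative (\<lambda>q. snd (Y q)) (at p) (X p))"
    by (simp add: frechet_derivativeI)
  show ?thesis
    unfolding 1 2 3 christoffel_expand[OF assms(1,2), of "X p" "Y p"] christoffel_expand[OF assms(1,2), of "X p" "(1, 0)"]
      christoffel_expand[OF assms(1,2), of "X p" "(0, 1)"]
    by (simp add: algebra_simps prod_eq_iff)
qed

text \<open>\<open>(r\<^sub>1, r\<^sub>2)\<close> is the one-form by which this connection differs from the one with \<open>r\<^sub>1 = r\<^sub>2 = 0\<close>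
  in the same projective class.\<close>

definition web_connection ::
    "(plane \<Rightarrow> real) \<Rightarrow> (plane \<Rightarrow> real) \<Rightarrow> (plane \<Rightarrow> real) \<Rightarrow> (plane \<Rightarrow> real) \<Rightarrow> connection" where
  "web_connection a b r1 r2 X Y p = frechet_derivative Y (at p) (X p) +
     (fst (X p) * fst (Y p) * (b p + 2 * r1 p) + (fst (X p) * snd (Y p) + snd (X p) * fst (Y p)) * r2 p,
      snd (X p) * snd (Y p) * (a p + 2 * r2 p) + (fst (X p) * snd (Y p) + snd (X p) * fst (Y p)) * r1 p)"

lemma affine_connection_web_connection:
  assumes "open U" "smooth_on U a" "smooth_on U b" "smooth_on U r1" "smooth_on U r2"
  shows "affine_connection U (web_connection a b r1 r2)"
  unfolding affine_connection_def
proof (intro conjI assms(1))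
  show "is_connection U (web_connection a b r1 r2)"
    unfolding is_connection_def
  proof (intro ballI allI impI)
    fix p and X X' Y Y' :: vfield and g :: "plane \<Rightarrow> real"
    assume p: "p \<in> U" and sm: "smooth_near p X" "smooth_near p X'" "smooth_near p Y" "smooth_near p Y'" "smooth_near p g"
    have near: "smooth_near p a" "smooth_near p b" "smooth_near p r1" "smooth_near p r2"
      using assms p by (auto intro: smooth_nearI)
    have "smooth_near p (web_connection a b r1 r2 X Y)"
      unfolding web_connection_def[abs_def]
      by (intro smooth_near_intros sm near)
    moreover have lin: "frechet_derivative Y (at p) (u + v) = frechet_derivative Y (at p) u + frechet_derivative Y (at p) v"
        "frechet_derivative Y (at p) (c *\<^sub>R u) = c *\<^sub>R frechet_derivative Y (at p) u" for u v c
      using linear_frechet_derivative[OF smooth_near_imp_differentiable[OF sm(3)]]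
      by (auto simp: linear_add linear_cmul)
    note der = sm[THEN smooth_near_imp_differentiable, THEN frechet_derivative_works[THEN iffD1]]
    have add: "frechet_derivative (\<lambda>q. Y q + Y' q) (at p) v = frechet_derivative Y (at p) v + frechet_derivative Y' (at p) v" for v
      using frechet_derivativeI[OF has_derivative_add[OF der(3,4)]] by simp
    have scale: "frechet_derivative (\<lambda>q. g q *\<^sub>R Y q) (at p) v =
        g p *\<^sub>R frechet_derivative Y (at p) v + frechet_derivative g (at p) v *\<^sub>R Y p" for v
      using frechet_derivativeI[OF has_derivative_scaleR[OF der(5,3)]] by simp
    ultimately show "smooth_near p (web_connection a b r1 r2 X Y)
        \<and> web_connection a b r1 r2 (\<lambda>q. X q + X' q) Y p = web_connection a b r1 r2 X Y p + web_connection a b r1 r2 X' Y p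
        \<and> web_connection a b r1 r2 (\<lambda>q. g q *\<^sub>R X q) Y p = g p *\<^sub>R web_connection a b r1 r2 X Y p
        \<and> web_connection a b r1 r2 X (\<lambda>q. Y q + Y' q) p = web_connection a b r1 r2 X Y p + web_connection a b r1 r2 X Y' p
        \<and> web_connection a b r1 r2 X (\<lambda>q. g q *\<^sub>R Y q) p =
            frechet_derivative g (at p) (X p) *\<^sub>R Y p + g p *\<^sub>R web_connection a b r1 r2 X Y p"
      unfolding web_connection_def lin add scale by (simp add: prod_eq_iff algebra_simps)
  qed
  show "torsion_free U (web_connection a b r1 r2)"
    by (auto simp: torsion_free_def web_connection_def lie_bracket_def prod_eq_iff algebra_simps)
qed

text \<open>Equality of operators would be too strong: outside smooth germs their values are
  arbitrary. This is equality of the connections they represent.\<close>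

definition agrees_on :: "plane set \<Rightarrow> connection \<Rightarrow> connection \<Rightarrow> bool" where
  "agrees_on W D D' \<longleftrightarrow>
     (\<forall>p\<in>W. \<forall>X Y. smooth_near p X \<longrightarrow> smooth_near p Y \<longrightarrow> D X Y p = D' X Y p)"

section \<open>Geodesic webs\<close>

lemma level_curve_regular:
  fixes f :: "plane \<Rightarrow> real"
  assumes "open S" "smooth_on S f" "p \<in> S" "dx f p \<noteq> 0 \<or> dy f p \<noteq> 0"
  obtains \<gamma> e where "0 < e" "smooth_on {-e<..<e} \<gamma>" "\<gamma> 0 = p"
    "\<And>t. t \<in> {-e<..<e} \<Longrightarrow> \<gamma> t \<in> S \<and> f (\<gamma> t) = f p \<and> velocity \<gamma> t \<noteq> 0"
proof (cases "dy f p = 0")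
  case False
  then show ?thesis
    using level_curve[OF assms(1-3)] that by blast
next
  case True
  define S' where "S' = prod.swap -` S"
  have S': "open S'" "prod.swap p \<in> S'"
    using assms(1,3) by (auto simp: S'_def intro!: open_vimage continuous_on_swap)
  have "smooth_on S' (\<lambda>q. f (prod.swap q))"
    using assms(1,2) S'(1) by (intro smooth_on_swap) (auto simp: S'_def)
  moreover have "dy (\<lambda>q. f (prod.swap q)) (prod.swap p) \<noteq> 0"
    using True assms(4) dx_dy_swap(2)[of f "prod.swap p"] smooth_on_imp_differentiable[OF assms(2,3)]
    by simp
  ultimately obtain \<gamma> e where \<gamma>: "0 < e" "smooth_on {-e<..<e} \<gamma>" "\<gamma> 0 = prod.swap p"
    "\<And>t. t \<in> {-e<..<e} \<Longrightarrow> \<gamma> t \<in> S' \<and> f (prod.swap (\<gamma> t)) = f (prod.swap (prod.swap p)) \<and> velocity \<gamma> t \<noteq> 0"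
    using level_curve[OF S'(1) _ S'(2)] by blast
  show ?thesis
  proof (rule that[OF \<gamma>(1)])
    show "smooth_on {-e<..<e} (\<lambda>t. prod.swap (\<gamma> t))"
      unfolding prod.swap_def by (intro smooth_on_Pair smooth_on_fst smooth_on_snd \<gamma>(2) open_greaterThanLessThan)
    show "prod.swap (\<gamma> 0) = p"
      using \<gamma>(3) by simp
    fix t assume t: "t \<in> {-e<..<e}"
    have "(\<gamma> has_vector_derivative velocity \<gamma> t) (at t)"
      using smooth_on_imp_differentiable[OF \<gamma>(2) t] by (simp add: velocity_def vector_derivative_works)
    then have "((\<lambda>t. prod.swap (\<gamma> t)) has_vector_derivative prod.swap (velocity \<gamma> t)) (at t)"
      unfolding has_vector_derivative_def prod.swap_def by (auto intro!: derivative_eq_intros)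
    then show "prod.swap (\<gamma> t) \<in> S \<and> f (prod.swap (\<gamma> t)) = f p \<and> velocity (\<lambda>t. prod.swap (\<gamma> t)) t \<noteq> 0"
      using \<gamma>(4)[OF t] by (auto simp: S'_def velocity_def vector_derivative_at prod_eq_iff)
  qed
qed

text \<open>The first and second \<open>t\<close>-derivatives of the constant function
  \<open>f (\<gamma> t)\<close>.\<close>

lemma velocity_level_curve:
  assumes S: "open S" "smooth_on S f" and I: "open I" "smooth_on I \<gamma>"
    and lev: "\<And>t. t \<in> I \<Longrightarrow> \<gamma> t \<in> S \<and> f (\<gamma> t) = k" and t: "t \<in> I"
  shows "fst (velocity \<gamma> t) * dx f (\<gamma> t) + snd (velocity \<gamma> t) * dy f (\<gamma> t) = 0"
    and "fst (vector_derivative (velocity \<gamma>) (at t)) * dx f (\<gamma> t)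
       + snd (vector_derivative (velocity \<gamma>) (at t)) * dy f (\<gamma> t)
       + (fst (velocity \<gamma> t))\<^sup>2 * dx (dx f) (\<gamma> t)
       + 2 * fst (velocity \<gamma> t) * snd (velocity \<gamma> t) * dy (dx f) (\<gamma> t)
       + (snd (velocity \<gamma> t))\<^sup>2 * dy (dy f) (\<gamma> t) = 0"
proof -
  have v: "(\<gamma> has_vector_derivative velocity \<gamma> t) (at t)" if "t \<in> I" for t
    using smooth_on_imp_differentiable[OF I(2) that] by (simp add: velocity_def vector_derivative_works)
  have comp: "((\<lambda>t. g (\<gamma> t)) has_real_derivative
      fst (velocity \<gamma> t) * dx g (\<gamma> t) + snd (velocity \<gamma> t) * dy g (\<gamma> t)) (at t)"
    if "smooth_on S g" "t \<in> I" for g t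
  proof -
    have "g differentiable (at (\<gamma> t))"
      using lev that smooth_on_imp_differentiable by blast
    from has_derivative_compose[OF v[OF that(2), unfolded has_vector_derivative_def] has_derivative_plane[OF this]]
    show ?thesis
      unfolding has_field_derivative_def
      by (rule has_derivative_eq_rhs) (auto simp: fun_eq_iff algebra_simps)
  qed
  have zero: "fst (velocity \<gamma> t) * dx f (\<gamma> t) + snd (velocity \<gamma> t) * dy f (\<gamma> t) = 0" if "t \<in> I" for t
  proof -
    have "((\<lambda>t. f (\<gamma> t)) has_real_derivative 0) (at t)"
      by (rule has_field_derivative_transform_within_open[of "\<lambda>_. k" _ _ I]) (use lev that I(1) in auto)
    then show ?thesis
      using comp[OF S(2) that] DERIV_unique by blast
  qed
  then show "fst (velocity \<gamma> t) * dx f (\<gamma> t) + snd (velocity \<gamma> t) * dy f (\<gamma> t) = 0"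
    using t .
  have "smooth_on I (velocity \<gamma>)"
  proof -
    have "smooth_on I (\<lambda>t. frechet_derivative \<gamma> (at t) 1)"
      by (rule smooth_on_frechet_derivative[OF I(2)])
    moreover have "frechet_derivative \<gamma> (at t) 1 = velocity \<gamma> t" if "t \<in> I" for t
      using frechet_derivativeI[OF v[OF that, unfolded has_vector_derivative_def]] by simp
    ultimately show ?thesis
      using smooth_on_cong[OF I(1), of "\<lambda>t. frechet_derivative \<gamma> (at t) 1" "velocity \<gamma>"] by simp
  qed
  then have w: "(velocity \<gamma> has_vector_derivative vector_derivative (velocity \<gamma>) (at t)) (at t)"
    using t by (simp add: smooth_on_imp_differentiable flip: vector_derivative_works)
  let ?w = "vector_derivative (velocity \<gamma>) (at t)"
  have w12: "((\<lambda>t. fst (velocity \<gamma> t)) has_real_derivative fst ?w) (at t)"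
    "((\<lambda>t. snd (velocity \<gamma> t)) has_real_derivative snd ?w) (at t)"
    using w unfolding has_vector_derivative_def has_field_derivative_def
    by (auto intro!: derivative_eq_intros simp: fun_eq_iff)
  have "((\<lambda>t. fst (velocity \<gamma> t) * dx f (\<gamma> t) + snd (velocity \<gamma> t) * dy f (\<gamma> t)) has_real_derivative 0) (at t)"
    by (rule has_field_derivative_transform_within_open[of "\<lambda>_. 0" _ _ I]) (use zero t I(1) in auto)
  moreover have "((\<lambda>t. fst (velocity \<gamma> t) * dx f (\<gamma> t) + snd (velocity \<gamma> t) * dy f (\<gamma> t)) has_real_derivative
     fst ?w * dx f (\<gamma> t) + (fst (velocity \<gamma> t) * dx (dx f) (\<gamma> t) + snd (velocity \<gamma> t) * dy (dx f) (\<gamma> t)) * fst (velocity \<gamma> t)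
     + (snd ?w * dy f (\<gamma> t) + (fst (velocity \<gamma> t) * dx (dy f) (\<gamma> t) + snd (velocity \<gamma> t) * dy (dy f) (\<gamma> t)) * snd (velocity \<gamma> t))) (at t)"
    by (intro DERIV_add DERIV_mult w12 comp smooth_on_dx smooth_on_dy S(2) t)
  ultimately have "fst ?w * dx f (\<gamma> t) + (fst (velocity \<gamma> t) * dx (dx f) (\<gamma> t) + snd (velocity \<gamma> t) * dy (dx f) (\<gamma> t)) * fst (velocity \<gamma> t)
     + (snd ?w * dy f (\<gamma> t) + (fst (velocity \<gamma> t) * dx (dy f) (\<gamma> t) + snd (velocity \<gamma> t) * dy (dy f) (\<gamma> t)) * snd (velocity \<gamma> t)) = 0"
    by (rule DERIV_unique[symmetric])
  moreover have "dx (dy f) (\<gamma> t) = dy (dx f) (\<gamma> t)"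
    using dx_dy_commute[OF S] lev[OF t] by blast
  ultimately show "fst ?w * dx f (\<gamma> t) + snd ?w * dy f (\<gamma> t)
       + (fst (velocity \<gamma> t))\<^sup>2 * dx (dx f) (\<gamma> t)
       + 2 * fst (velocity \<gamma> t) * snd (velocity \<gamma> t) * dy (dx f) (\<gamma> t)
       + (snd (velocity \<gamma> t))\<^sup>2 * dy (dy f) (\<gamma> t) = 0"
    by (simp add: power2_eq_square algebra_simps)
qed

lemma christoffel_scaleR:
  assumes "affine_connection U D" "p \<in> U"
  shows "christoffel D (c *\<^sub>R u) (c *\<^sub>R v) p = c\<^sup>2 *\<^sub>R christoffel D u v p"
  unfolding christoffel_expand[OF assms, of "c *\<^sub>R u"] christoffel_expand[OF assms, of u]
  by (simp add: algebra_simps power2_eq_square)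

text \<open>The leaves of \<open>f\<close> have tangent direction \<open>(- f\<^sub>y, f\<^sub>x)\<close>.\<close>

definition geodesic_condition :: "connection \<Rightarrow> (plane \<Rightarrow> real) \<Rightarrow> plane \<Rightarrow> bool" where
  "geodesic_condition D f p \<longleftrightarrow>
     (let c = christoffel D (- dy f p, dx f p) (- dy f p, dx f p) p in
       dx f p * fst c + dy f p * snd c = Flex f p)"

text \<open>The velocity is \<open>l\<close> times \<open>(- f_y, f_x)\<close> with \<open>l\<close>
  nonzero, and a vector is a multiple of it exactly if \<open>df\<close> annihilates it.
  Differentiating \<open>f (\<gamma> t) = k\<close> twice shows that \<open>df\<close> takes the
  value \<open>- l^2 Flex f\<close> on the second derivative of the curve, so \<open>l^2\<close>
  factors out and the parametrization disappears.\<close>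

lemma geodesic_condition_along_curve:
  assumes D: "affine_connection S D" and f: "smooth_on S f" and reg: "dx f (\<gamma> t) \<noteq> 0 \<or> dy f (\<gamma> t) \<noteq> 0"
    and I: "open I" "smooth_on I \<gamma>" and lev: "\<And>t. t \<in> I \<Longrightarrow> \<gamma> t \<in> S \<and> f (\<gamma> t) = k" and t: "t \<in> I"
    and vel: "velocity \<gamma> t \<noteq> 0"
  shows "(\<exists>c. covariant_acceleration D \<gamma> t = c *\<^sub>R velocity \<gamma> t) \<longleftrightarrow> geodesic_condition D f (\<gamma> t)"
proof -
  have S: "open S"
    using D by (simp add: affine_connection_def)
  have p: "\<gamma> t \<in> S"
    using lev t by blast
  let ?v = "velocity \<gamma> t" and ?w = "vector_derivative (velocity \<gamma>) (at t)" and ?p = "\<gamma> t"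
  define fx fy where "fx = dx f ?p" and "fy = dy f ?p"
  note vc = velocity_level_curve[OF S f I lev t, folded fx_def fy_def]
  have ne: "fx\<^sup>2 + fy\<^sup>2 \<noteq> 0"
    using reg by (simp add: fx_def fy_def sum_power2_eq_zero_iff)
  \<comment> \<open>The coefficient of the orthogonal projection of the velocity to
    \<open>(- fy, fx)\<close>.\<close>
  define l where "l = (snd ?v * fx - fst ?v * fy) / (fx\<^sup>2 + fy\<^sup>2)"
  have "fst ?v * fx = - snd ?v * fy"
    using vc(1) by simp
  then have "fst ?v * (fx\<^sup>2 + fy\<^sup>2) = - fy * (snd ?v * fx - fst ?v * fy)"
      "snd ?v * (fx\<^sup>2 + fy\<^sup>2) = fx * (snd ?v * fx - fst ?v * fy)"
    by (algebra, algebra)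
  then have v: "?v = l *\<^sub>R (- fy, fx)"
    using ne by (auto simp: l_def prod_eq_iff field_simps)
  have l: "l \<noteq> 0"
    using v vel by (auto simp: zero_prod_def)
  define c where "c = christoffel D (- fy, fx) (- fy, fx) ?p"
  define A where "A = covariant_acceleration D \<gamma> t"
  have A: "A = ?w + l\<^sup>2 *\<^sub>R c"
    unfolding A_def covariant_acceleration_def christoffel_def[symmetric] c_def
    by (subst (1 2) v) (simp only: christoffel_scaleR[OF D p])
  have dA: "fx * fst A + fy * snd A = l\<^sup>2 * (fx * fst c + fy * snd c - Flex f ?p)"
    using vc(2) unfolding A v Flex_def fx_def[symmetric] fy_def[symmetric]
    by (simp add: algebra_simps power2_eq_square)
  have "(\<exists>c. A = c *\<^sub>R ?v) \<longleftrightarrow> fx * fst A + fy * snd A = 0"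
  proof
    assume "\<exists>c. A = c *\<^sub>R ?v"
    then show "fx * fst A + fy * snd A = 0"
      unfolding v by auto
  next
    assume 0: "fx * fst A + fy * snd A = 0"
    define m where "m = (snd A * fx - fst A * fy) / (fx\<^sup>2 + fy\<^sup>2)"
    have "fst A * (fx\<^sup>2 + fy\<^sup>2) = - fy * (snd A * fx - fst A * fy)"
      "snd A * (fx\<^sup>2 + fy\<^sup>2) = fx * (snd A * fx - fst A * fy)"
      using 0 by (algebra, algebra)
    then have "A = m *\<^sub>R (- fy, fx)"
      using ne by (auto simp: m_def prod_eq_iff field_simps)
    then have "A = (m / l) *\<^sub>R ?v"
      using l by (simp add: v)
    then show "\<exists>c. A = c *\<^sub>R ?v" ..
  qed
  also have "\<dots> \<longleftrightarrow> geodesic_condition D f ?p"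
    unfolding dA geodesic_condition_def Let_def c_def[unfolded fx_def fy_def, symmetric]
    using l by (simp add: fx_def fy_def)
  finally show ?thesis
    unfolding A_def .
qed

text \<open>Leaves are components of level sets, the condition is pointwise. The bridge is a short
  level curve through \<open>p\<close>: its image is connected, hence lies in the leaf of
  \<open>p\<close>. Conversely, any regular curve in a leaf is a level curve.\<close>

lemma geodesic_leaves_iff:
  assumes D: "affine_connection S D" and f: "smooth_on S f"
    and reg: "\<And>p. p \<in> S \<Longrightarrow> dx f p \<noteq> 0 \<or> dy f p \<noteq> 0"
  shows "(\<forall>L\<in>(\<Union>c. components {p\<in>S. f p = c}). geodesic_leaf D L) \<longleftrightarrow> (\<forall>p\<in>S. geodesic_condition D f p)"
proof safe
  fix p assume *: "\<forall>L\<in>(\<Union>c. components {p\<in>S. f p = c}). geodesic_leaf D L" and p: "p \<in> S"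
  have S: "open S"
    using D by (simp add: affine_connection_def)
  obtain \<gamma> e where \<gamma>: "0 < e" "smooth_on {-e<..<e} \<gamma>" "\<gamma> 0 = p"
    "\<And>t. t \<in> {-e<..<e} \<Longrightarrow> \<gamma> t \<in> S \<and> f (\<gamma> t) = f p \<and> velocity \<gamma> t \<noteq> 0"
    using level_curve_regular[OF S f p reg[OF p]] by blast
  have sub: "\<gamma> ` {-e<..<e} \<subseteq> {q\<in>S. f q = f p}"
    using \<gamma>(4) by auto
  have con: "connected (\<gamma> ` {-e<..<e})"
    by (intro connected_continuous_image smooth_on_imp_continuous_on \<gamma>(2) connected_Ioo)
  define L where "L = connected_component_set {q\<in>S. f q = f p} p"
  have pI: "p \<in> \<gamma> ` {-e<..<e}"
    using \<gamma>(1,3) by (intro image_eqI[of _ _ 0]) auto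
  then have "\<gamma> ` {-e<..<e} \<subseteq> L"
    unfolding L_def by (intro connected_component_maximal con sub)
  moreover have "L \<in> components {q\<in>S. f q = f p}"
    unfolding L_def using p by (intro componentsI) auto
  then have "geodesic_leaf D L"
    using * by blast
  ultimately have "unparametrized_geodesic D {-e<..<e} \<gamma>"
    unfolding geodesic_leaf_def using \<gamma>(1,2,4) by (auto simp: image_subset_iff)
  then have "\<exists>c. covariant_acceleration D \<gamma> 0 = c *\<^sub>R velocity \<gamma> 0"
    using \<gamma>(1) by (auto simp: unparametrized_geodesic_def)
  then show "geodesic_condition D f p"
    using geodesic_condition_along_curve[OF D f _ _ \<gamma>(2), of 0 "f p"] \<gamma> reg[OF p] by auto
next
  fix L c assume *: "\<forall>p\<in>S. geodesic_condition D f p" and L: "L \<in> components {p\<in>S. f p = c}"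
  show "geodesic_leaf D L"
    unfolding geodesic_leaf_def unparametrized_geodesic_def
  proof (intro allI impI ballI)
    fix \<gamma> and a b t :: real
    assume \<gamma>: "a < b" "smooth_on {a<..<b} \<gamma>" "\<forall>t\<in>{a<..<b}. \<gamma> t \<in> L \<and> velocity \<gamma> t \<noteq> 0" "t \<in> {a<..<b}"
    have sub: "L \<subseteq> {p\<in>S. f p = c}"
      using L by (rule in_components_subset)
    then have lev: "\<gamma> t \<in> S \<and> f (\<gamma> t) = c" if "t \<in> {a<..<b}" for t
      using \<gamma>(3) that by blast
    then have "dx f (\<gamma> t) \<noteq> 0 \<or> dy f (\<gamma> t) \<noteq> 0" "geodesic_condition D f (\<gamma> t)" "velocity \<gamma> t \<noteq> 0"
      using reg * \<gamma>(3,4) by blast+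
    then show "\<exists>c. covariant_acceleration D \<gamma> t = c *\<^sub>R velocity \<gamma> t"
      using geodesic_condition_along_curve[OF D f _ open_greaterThanLessThan \<gamma>(2) lev \<gamma>(4)] by blast
  qed
qed

lemma four_webD:
  assumes "four_web U [fst, snd, f3, f4]" "p \<in> U"
  shows "dx f3 p \<noteq> 0" "dy f3 p \<noteq> 0" "dx f4 p \<noteq> 0" "dy f4 p \<noteq> 0" "Delta f3 f4 p \<noteq> 0"
proof -
  have c: "dx fst p = 1" "dy fst p = 0" "dx snd p = 0" "dy snd p = 1" for p :: plane
    by (auto intro!: dx_dyI[THEN trans] derivative_eq_intros)
  have "dx ([fst, snd, f3, f4] ! i) p * dy ([fst, snd, f3, f4] ! j) p - dy ([fst, snd, f3, f4] ! i) p * dx ([fst, snd, f3, f4] ! j) p \<noteq> 0"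
    if "i < 4" "j < 4" "i \<noteq> j" for i j :: nat
    using assms that unfolding four_web_def by blast
  \<comment> \<open>Positions count from 0: pairing \<open>x\<close> with \<open>f3\<close> or
    \<open>f4\<close> gives their \<open>y\<close>-derivatives, pairing \<open>y\<close> with them
    the \<open>x\<close>-derivatives, and the last pair gives \<open>Delta\<close>.\<close>
  from this[of 0 2] this[of 0 3] this[of 1 2] this[of 1 3] this[of 2 3]
  show "dx f3 p \<noteq> 0" "dy f3 p \<noteq> 0" "dx f4 p \<noteq> 0" "dy f4 p \<noteq> 0" "Delta f3 f4 p \<noteq> 0"
    by (auto simp: c Delta_def numeral_eq_Suc)
qed

lemma four_web_subset:
  assumes "four_web U fs" "open W" "W \<subseteq> U"
  shows "four_web W fs"
  using assms smooth_on_subset unfolding four_web_def by blast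

lemma smooth_on_alpha_beta:
  assumes "four_web U [fst, snd, f3, f4]"
  shows "smooth_on U (alpha f3 f4)" "smooth_on U (beta f3 f4)"
proof -
  have U: "open U" and s: "smooth_on U f3" "smooth_on U f4"
    using assms by (auto simp: four_web_def)
  note nz = four_webD[OF assms]
  have flex: "smooth_on U (Flex f)" if "smooth_on U f" for f
    unfolding Flex_def[abs_def] by (intro smooth_intros U that)
  have D: "smooth_on U (Delta f3 f4)"
    unfolding Delta_def[abs_def] by (intro smooth_intros U s)
  show "smooth_on U (alpha f3 f4)" "smooth_on U (beta f3 f4)"
    unfolding alpha_def[abs_def] beta_def[abs_def]
    by (intro smooth_intros U s flex D; simp add: nz)+
qed

text \<open>Origin of \<open>alpha\<close> and \<open>beta\<close>. The coordinate lines are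
  geodesics iff the first component of \<open>g22\<close> and the second of \<open>g11\<close>
  vanish. Then the conditions for \<open>f3\<close> and \<open>f4\<close> read
  \<open>f_x f_y (A f_x + B f_y) = Flex f\<close> with \<open>A = snd g22 - 2 fst g12\<close> and
  \<open>B = fst g11 - 2 snd g12\<close>. This linear system has determinant \<open>Delta\<close> up
  to nonzero factors, and \<open>alpha\<close>, \<open>beta\<close> are its solution.\<close>

lemma geodesic_web_iff_christoffel:
  assumes D: "affine_connection W D" and web: "four_web W [fst, snd, f3, f4]"
  shows "geodesic_web W D [fst, snd, f3, f4] \<longleftrightarrow>
    (\<forall>p\<in>W. let g11 = christoffel D (1, 0) (1, 0) p; g12 = christoffel D (1, 0) (0, 1) p;
        g22 = christoffel D (0, 1) (0, 1) p in
      g11 = (beta f3 f4 p + 2 * snd g12, 0) \<and> g22 = (0, alpha f3 f4 p + 2 * fst g12))"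
proof -
  let ?fs = "[fst, snd, f3, f4] :: (plane \<Rightarrow> real) list"
  note nz = four_webD[OF web]
  have sm: "smooth_on W f" if "f \<in> set ?fs" for f
    using web that by (auto simp: four_web_def)
  have c: "dx fst p = 1" "dy fst p = 0" "dx snd p = 0" "dy snd p = 1" for p :: plane
    by (auto intro!: dx_dyI[THEN trans] derivative_eq_intros)
  then have c': "dx fst = (\<lambda>_. 1)" "dy fst = (\<lambda>_. 0)" "dx snd = (\<lambda>_. 0)" "dy snd = (\<lambda>_. 1)"
    by auto
  have cc: "dx (\<lambda>_. k) p = 0" "dy (\<lambda>_. k) p = 0" for k p
    by (simp_all add: dx_def dy_def)
  have reg: "dx f p \<noteq> 0 \<or> dy f p \<noteq> 0" if "f \<in> set ?fs" "p \<in> W" for f p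
    using that nz[of p] c[of p] by auto
  have "geodesic_web W D ?fs \<longleftrightarrow> (\<forall>f\<in>set ?fs. \<forall>L\<in>(\<Union>c. components {p\<in>W. f p = c}). geodesic_leaf D L)"
    using web unfolding geodesic_web_def web_leaves_def by blast
  also have "\<dots> \<longleftrightarrow> (\<forall>f\<in>set ?fs. \<forall>p\<in>W. geodesic_condition D f p)"
    using geodesic_leaves_iff[OF D sm reg] by blast
  also have "\<dots> \<longleftrightarrow> (\<forall>p\<in>W. \<forall>f\<in>set ?fs. geodesic_condition D f p)"
    by blast
  also have "\<dots> \<longleftrightarrow> (\<forall>p\<in>W. let g11 = christoffel D (1, 0) (1, 0) p; g12 = christoffel D (1, 0) (0, 1) p;
        g22 = christoffel D (0, 1) (0, 1) p in
      g11 = (beta f3 f4 p + 2 * snd g12, 0) \<and> g22 = (0, alpha f3 f4 p + 2 * fst g12))"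
  proof (rule ball_cong[OF refl])
    fix p assume p: "p \<in> W"
    define g11 where "g11 = christoffel D (1, 0) (1, 0) p"
    define g12 where "g12 = christoffel D (1, 0) (0, 1) p"
    define g22 where "g22 = christoffel D (0, 1) (0, 1) p"
    have e: "christoffel D u v p = (fst u * fst v) *\<^sub>R g11 + (fst u * snd v + snd u * fst v) *\<^sub>R g12 + (snd u * snd v) *\<^sub>R g22" for u v
      using christoffel_expand[OF D p, of u v] by (simp only: g11_def g12_def g22_def)
    have 1: "geodesic_condition D fst p \<longleftrightarrow> fst g22 = 0" "geodesic_condition D snd p \<longleftrightarrow> snd g11 = 0"
      by (simp_all add: geodesic_condition_def Let_def e Flex_def c c' cc)
    define A where "A = snd g22 - 2 * fst g12"
    define B where "B = fst g11 - 2 * snd g12"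
    define a b where "a = alpha f3 f4 p" and "b = beta f3 f4 p"
    define x3 y3 x4 y4 where "x3 = dx f3 p" and "y3 = dy f3 p" and "x4 = dx f4 p" and "y4 = dy f4 p"
    define F3 F4 \<Delta> where "F3 = Flex f3 p" and "F4 = Flex f4 p" and "\<Delta> = Delta f3 f4 p"
    note nz' = nz[OF p, folded x3_def y3_def x4_def y4_def \<Delta>_def]
    have \<Delta>: "\<Delta> = x3 * y4 - y3 * x4"
      by (simp add: \<Delta>_def Delta_def x3_def y3_def x4_def y4_def)
    have 2: "geodesic_condition D f p \<longleftrightarrow> dx f p * dy f p * (A * dx f p + B * dy f p) = Flex f p"
      if "fst g22 = 0" "snd g11 = 0" for f
      using that by (simp add: geodesic_condition_def Let_def e A_def B_def algebra_simps)
    have ab: "a = y4 * F3 / (x3 * y3 * \<Delta>) - y3 * F4 / (x4 * y4 * \<Delta>)"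
      "b = - (x4 * F3 / (x3 * y3 * \<Delta>)) + x3 * F4 / (x4 * y4 * \<Delta>)"
      by (simp_all add: a_def b_def alpha_def beta_def x3_def y3_def x4_def y4_def F3_def F4_def \<Delta>_def)
    have 3: "x3 * y3 * (A * x3 + B * y3) = F3 \<and> x4 * y4 * (A * x4 + B * y4) = F4 \<longleftrightarrow> A = a \<and> B = b"
    proof -
      \<comment> \<open>Cramer's rule with right-hand sides \<open>u3\<close> and \<open>u4\<close>.
        All equations are multiplied by the determinant, so that only polynomial identities remain
        to be combined.\<close>
      define u3 u4 where "u3 = F3 / (x3 * y3)" and "u4 = F4 / (x4 * y4)"
      have "a * \<Delta> = y4 * u3 - y3 * u4" "b * \<Delta> = x3 * u4 - x4 * u3"
        using nz' by (simp_all add: ab u3_def u4_def field_simps)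
      moreover have "A = a \<longleftrightarrow> A * \<Delta> = a * \<Delta>" "B = b \<longleftrightarrow> B * \<Delta> = b * \<Delta>"
        "A * x3 + B * y3 = u3 \<longleftrightarrow> (A * x3 + B * y3) * \<Delta> = u3 * \<Delta>"
        "A * x4 + B * y4 = u4 \<longleftrightarrow> (A * x4 + B * y4) * \<Delta> = u4 * \<Delta>"
        using nz'(5) by simp_all
      moreover have "x3 * y3 * (A * x3 + B * y3) = F3 \<longleftrightarrow> A * x3 + B * y3 = u3"
        "x4 * y4 * (A * x4 + B * y4) = F4 \<longleftrightarrow> A * x4 + B * y4 = u4"
        using nz' by (auto simp: u3_def u4_def field_simps)
      moreover have "A * \<Delta> = y4 * (A * x3 + B * y3) - y3 * (A * x4 + B * y4)"
        "B * \<Delta> = x3 * (A * x4 + B * y4) - x4 * (A * x3 + B * y3)"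
        by (simp_all add: \<Delta> algebra_simps)
      moreover have "x3 * (y4 * u3 - y3 * u4) + y3 * (x3 * u4 - x4 * u3) = u3 * \<Delta>"
        "x4 * (y4 * u3 - y3 * u4) + y4 * (x3 * u4 - x4 * u3) = u4 * \<Delta>"
        by (simp_all add: \<Delta> algebra_simps)
      moreover have "(A * x3 + B * y3) * \<Delta> = x3 * (A * \<Delta>) + y3 * (B * \<Delta>)"
        "(A * x4 + B * y4) * \<Delta> = x4 * (A * \<Delta>) + y4 * (B * \<Delta>)"
        by (simp_all add: algebra_simps)
      ultimately show ?thesis
        by metis
    qed
    have "(\<forall>f\<in>set ?fs. geodesic_condition D f p) \<longleftrightarrow>
        fst g22 = 0 \<and> snd g11 = 0 \<and> geodesic_condition D f3 p \<and> geodesic_condition D f4 p"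
      using 1 by simp
    also have "\<dots> \<longleftrightarrow> fst g22 = 0 \<and> snd g11 = 0 \<and> A = a \<and> B = b"
      using 2 3 unfolding x3_def y3_def x4_def y4_def F3_def F4_def by metis
    also have "\<dots> \<longleftrightarrow> g11 = (b + 2 * snd g12, 0) \<and> g22 = (0, a + 2 * fst g12)"
      by (cases g11; cases g22) (auto simp: A_def B_def)
    finally show "(\<forall>f\<in>set ?fs. geodesic_condition D f p) \<longleftrightarrow>
       (let g11 = christoffel D (1, 0) (1, 0) p; g12 = christoffel D (1, 0) (0, 1) p;
        g22 = christoffel D (0, 1) (0, 1) p in
      g11 = (beta f3 f4 p + 2 * snd g12, 0) \<and> g22 = (0, alpha f3 f4 p + 2 * fst g12))"
      unfolding Let_def g11_def[symmetric] g12_def[symmetric] g22_def[symmetric] a_def b_def .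
  qed
  finally show ?thesis .
qed

lemma agrees_on_web_connection_iff:
  assumes D: "affine_connection W D"
  shows "agrees_on W D (web_connection a b r1 r2) \<longleftrightarrow>
    (\<forall>p\<in>W. christoffel D (1, 0) (1, 0) p = (b p + 2 * r1 p, 0) \<and> christoffel D (1, 0) (0, 1) p = (r2 p, r1 p) \<and>
      christoffel D (0, 1) (0, 1) p = (0, a p + 2 * r2 p))"
proof
  assume *: "agrees_on W D (web_connection a b r1 r2)"
  have "christoffel D u v p = web_connection a b r1 r2 (\<lambda>_. u) (\<lambda>_. v) p" if "p \<in> W" for u v p
    using * that smooth_near_const unfolding agrees_on_def christoffel_def by blast
  then show "\<forall>p\<in>W. christoffel D (1, 0) (1, 0) p = (b p + 2 * r1 p, 0) \<and> christoffel D (1, 0) (0, 1) p = (r2 p, r1 p) \<and>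
      christoffel D (0, 1) (0, 1) p = (0, a p + 2 * r2 p)"
    by (simp add: web_connection_def zero_prod_def)
next
  assume *: "\<forall>p\<in>W. christoffel D (1, 0) (1, 0) p = (b p + 2 * r1 p, 0) \<and> christoffel D (1, 0) (0, 1) p = (r2 p, r1 p) \<and>
      christoffel D (0, 1) (0, 1) p = (0, a p + 2 * r2 p)"
  show "agrees_on W D (web_connection a b r1 r2)"
    unfolding agrees_on_def
  proof (intro ballI allI impI)
    fix p and X Y :: vfield assume "p \<in> W" "smooth_near p X" "smooth_near p Y"
    then show "D X Y p = web_connection a b r1 r2 X Y p"
      using * by (simp add: connection_coordinates[OF D] christoffel_expand[OF D, of p "X p" "Y p"] web_connection_def algebra_simps)
  qed
qed

lemma geodesic_web_iff:
  assumes D: "affine_connection W D" and web: "four_web W [fst, snd, f3, f4]"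
  shows "geodesic_web W D [fst, snd, f3, f4] \<longleftrightarrow>
    (\<exists>r1 r2. smooth_on W r1 \<and> smooth_on W r2 \<and>
      agrees_on W D (web_connection (alpha f3 f4) (beta f3 f4) r1 r2))"
proof
  assume *: "geodesic_web W D [fst, snd, f3, f4]"
  have W: "open W"
    using D by (simp add: affine_connection_def)
  \<comment> \<open>The web leaves the mixed Christoffel symbol free. Its components are the two
    parameters, in the order \<open>(r2, r1)\<close>.\<close>
  define r1 where "r1 = (\<lambda>p. snd (christoffel D (1, 0) (0, 1) p))"
  define r2 where "r2 = (\<lambda>p. fst (christoffel D (1, 0) (0, 1) p))"
  have "smooth_near p (\<lambda>p. christoffel D (1, 0) (0, 1) p)" if "p \<in> W" for p
    using affine_connectionD(1)[OF D that smooth_near_const smooth_near_const]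
    unfolding christoffel_def .
  then have "smooth_on W r1 \<and> smooth_on W r2"
    unfolding r1_def r2_def using W by (auto intro!: smooth_on_local smooth_near_fst smooth_near_snd)
  moreover have "agrees_on W D (web_connection (alpha f3 f4) (beta f3 f4) r1 r2)"
    using * unfolding geodesic_web_iff_christoffel[OF assms] agrees_on_web_connection_iff[OF D]
    by (auto simp: r1_def r2_def Let_def)
  ultimately show "\<exists>r1 r2. smooth_on W r1 \<and> smooth_on W r2 \<and>
      agrees_on W D (web_connection (alpha f3 f4) (beta f3 f4) r1 r2)"
    by blast
next
  assume "\<exists>r1 r2. smooth_on W r1 \<and> smooth_on W r2 \<and>
      agrees_on W D (web_connection (alpha f3 f4) (beta f3 f4) r1 r2)"
  then show "geodesic_web W D [fst, snd, f3, f4]"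
    unfolding geodesic_web_iff_christoffel[OF assms] agrees_on_web_connection_iff[OF D]
    by (auto simp: Let_def)
qed

section \<open>Curvature\<close>

lemma partial_derivative_rules:
  fixes f g :: "plane \<Rightarrow> real"
  assumes "f differentiable (at p)" "g differentiable (at p)"
  shows "dx (\<lambda>q. f q + g q) p = dx f p + dx g p" "dy (\<lambda>q. f q + g q) p = dy f p + dy g p"
    "dx (\<lambda>q. f q - g q) p = dx f p - dx g p" "dy (\<lambda>q. f q - g q) p = dy f p - dy g p"
    "dx (\<lambda>q. f q * g q) p = dx f p * g p + f p * dx g p" "dy (\<lambda>q. f q * g q) p = dy f p * g p + f p * dy g p"
proof -
  note d = has_derivative_plane[OF assms(1)] has_derivative_plane[OF assms(2)]
  show "dx (\<lambda>q. f q + g q) p = dx f p + dx g p" "dy (\<lambda>q. f q + g q) p = dy f p + dy g p"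
    using dx_dyI[OF has_derivative_add[OF d]] by simp_all
  show "dx (\<lambda>q. f q - g q) p = dx f p - dx g p" "dy (\<lambda>q. f q - g q) p = dy f p - dy g p"
    using dx_dyI[OF has_derivative_diff[OF d]] by simp_all
  show "dx (\<lambda>q. f q * g q) p = dx f p * g p + f p * dx g p" "dy (\<lambda>q. f q * g q) p = dy f p * g p + f p * dy g p"
    using dx_dyI[OF has_derivative_mult[OF d]] by simp_all
qed

lemma partial_derivative_minus_divide:
  fixes f :: "plane \<Rightarrow> real"
  assumes "f differentiable (at p)"
  shows "dx (\<lambda>q. - f q) p = - dx f p" "dy (\<lambda>q. - f q) p = - dy f p"
    "dx (\<lambda>q. f q / c) p = dx f p / c" "dy (\<lambda>q. f q / c) p = dy f p / c"
  using dx_dyI[OF has_derivative_minus[OF has_derivative_plane[OF assms]]]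
    dx_dyI[OF has_derivative_mult_left[OF has_derivative_plane[OF assms], of "1 / c"]]
  by simp_all

lemma partial_derivative_const: "dx (\<lambda>_. c) p = 0" "dy (\<lambda>_. c) p = 0"
  by (simp_all add: dx_def dy_def)

lemmas partials = partial_derivative_rules partial_derivative_minus_divide partial_derivative_const

lemma frechet_derivative_components:
  fixes Y :: vfield
  assumes "Y differentiable (at p)"
  shows "frechet_derivative Y (at p) v =
    (fst v * dx (\<lambda>q. fst (Y q)) p + snd v * dy (\<lambda>q. fst (Y q)) p,
     fst v * dx (\<lambda>q. snd (Y q)) p + snd v * dy (\<lambda>q. snd (Y q)) p)"
proof -
  have d: "(\<lambda>q. fst (Y q)) differentiable (at p)" "(\<lambda>q. snd (Y q)) differentiable (at p)"
    using assms unfolding differentiable_def by (blast intro: has_derivative_fst has_derivative_snd)+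
  have "(Y has_derivative (\<lambda>v. (fst v * dx (\<lambda>q. fst (Y q)) p + snd v * dy (\<lambda>q. fst (Y q)) p,
     fst v * dx (\<lambda>q. snd (Y q)) p + snd v * dy (\<lambda>q. snd (Y q)) p))) (at p)"
    using has_derivative_Pair[OF has_derivative_plane[OF d(1)] has_derivative_plane[OF d(2)]] by simp
  then show ?thesis
    by (simp add: frechet_derivativeI)
qed

text \<open>In the frame \<open>e\<^sub>1, e\<^sub>2\<close> of coordinate fields, a web connection satisfies
  \<open>R(e\<^sub>1, e\<^sub>2) e\<^sub>1 = (P, Q)\<close> and \<open>R(e\<^sub>1, e\<^sub>2) e\<^sub>2 = (- S, - T)\<close> with the following four functions.\<close>

definition curv_P where "curv_P a b r1 r2 p = dx r2 p - 2 * dy r1 p + r1 p * r2 p - dy b p"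
definition curv_Q where "curv_Q a b r1 r2 p = dx r1 p - r1 p * r1 p - b p * r1 p"
definition curv_S where "curv_S a b r1 r2 p = dy r2 p - r2 p * r2 p - a p * r2 p"
definition curv_T where "curv_T a b r1 r2 p = dy r1 p - 2 * dx r2 p + r1 p * r2 p - dx a p"

text \<open>\<open>D\<close> is kept apart from its coordinate expression: a connection that makes
  the web geodesic is known only up to \<open>agrees_on\<close>.\<close>

locale web_like_connection =
  fixes W :: "plane set" and D :: connection and a b r1 r2 :: "plane \<Rightarrow> real"
  assumes affine: "affine_connection W D"
    and smooth: "smooth_on W a" "smooth_on W b" "smooth_on W r1" "smooth_on W r2"
    and agrees: "agrees_on W D (web_connection a b r1 r2)"
begin

lemma open_W: "open W"
  using affine by (simp add: affine_connection_def)

abbreviation "P \<equiv> curv_P a b r1 r2"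
abbreviation "Q \<equiv> curv_Q a b r1 r2"
abbreviation "S \<equiv> curv_S a b r1 r2"
abbreviation "T \<equiv> curv_T a b r1 r2"

lemma smooth_curv: "smooth_on W P" "smooth_on W Q" "smooth_on W S" "smooth_on W T"
  unfolding curv_P_def[abs_def] curv_Q_def[abs_def] curv_S_def[abs_def] curv_T_def[abs_def]
  by (intro smooth_intros open_W smooth)+

lemma connection_components:
  assumes "p \<in> W" "smooth_near p Y" "smooth_near p Z"
  shows "fst (D Y Z p) = fst (Y p) * dx (\<lambda>q. fst (Z q)) p + snd (Y p) * dy (\<lambda>q. fst (Z q)) p
      + fst (Y p) * fst (Z p) * (b p + 2 * r1 p) + (fst (Y p) * snd (Z p) + snd (Y p) * fst (Z p)) * r2 p"
    and "snd (D Y Z p) = fst (Y p) * dx (\<lambda>q. snd (Z q)) p + snd (Y p) * dy (\<lambda>q. snd (Z q)) p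
      + snd (Y p) * snd (Z p) * (a p + 2 * r2 p) + (fst (Y p) * snd (Z p) + snd (Y p) * fst (Z p)) * r1 p"
proof -
  have "D Y Z p = web_connection a b r1 r2 Y Z p"
    using agrees assms unfolding agrees_on_def by blast
  then show "fst (D Y Z p) = fst (Y p) * dx (\<lambda>q. fst (Z q)) p + snd (Y p) * dy (\<lambda>q. fst (Z q)) p
      + fst (Y p) * fst (Z p) * (b p + 2 * r1 p) + (fst (Y p) * snd (Z p) + snd (Y p) * fst (Z p)) * r2 p"
    "snd (D Y Z p) = fst (Y p) * dx (\<lambda>q. snd (Z q)) p + snd (Y p) * dy (\<lambda>q. snd (Z q)) p
      + snd (Y p) * snd (Z p) * (a p + 2 * r2 p) + (fst (Y p) * snd (Z p) + snd (Y p) * fst (Z p)) * r1 p"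
    by (simp_all add: web_connection_def frechet_derivative_components[OF smooth_near_imp_differentiable[OF assms(3)]])
qed

text \<open>The outer connection differentiates \<open>D Y Z\<close>, so the component formula for
  the inner one is needed on a neighbourhood of \<open>p\<close> and not just at
  \<open>p\<close>.\<close>

lemma second_covariant_derivative:
  assumes p: "p \<in> W" and sm: "smooth_near p X" "smooth_near p Y" "smooth_near p Z"
  defines "x1 \<equiv> \<lambda>q. fst (X q)" and "x2 \<equiv> \<lambda>q. snd (X q)" and "y1 \<equiv> \<lambda>q. fst (Y q)" and "y2 \<equiv> \<lambda>q. snd (Y q)"
    and "z1 \<equiv> \<lambda>q. fst (Z q)" and "z2 \<equiv> \<lambda>q. snd (Z q)"
  defines "d1 \<equiv> \<lambda>q. y1 q * dx z1 q + y2 q * dy z1 q + y1 q * z1 q * (b q + 2 * r1 q) + (y1 q * z2 q + y2 q * z1 q) * r2 q"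
    and "d2 \<equiv> \<lambda>q. y1 q * dx z2 q + y2 q * dy z2 q + y2 q * z2 q * (a q + 2 * r2 q) + (y1 q * z2 q + y2 q * z1 q) * r1 q"
  shows "fst (D X (D Y Z) p) = x1 p * dx d1 p + x2 p * dy d1 p + x1 p * d1 p * (b p + 2 * r1 p) + (x1 p * d2 p + x2 p * d1 p) * r2 p"
    and "snd (D X (D Y Z) p) = x1 p * dx d2 p + x2 p * dy d2 p + x2 p * d2 p * (a p + 2 * r2 p) + (x1 p * d2 p + x2 p * d1 p) * r1 p"
proof -
  obtain V where V: "open V" "p \<in> V" "smooth_on V Y" "smooth_on V Z"
    using smooth_near_common[OF sm(2,3)] .
  have eq: "fst (D Y Z q) = d1 q" "snd (D Y Z q) = d2 q" if "q \<in> V \<inter> W" for q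
    using connection_components[of q Y Z] smooth_nearI[OF V(1) _ V(3)] smooth_nearI[OF V(1) _ V(4)] that
    unfolding d1_def d2_def y1_def y2_def z1_def z2_def by auto
  have op: "open (V \<inter> W)" "p \<in> V \<inter> W"
    using V p open_W by auto
  note c = dx_cong(1,2)[OF op eq(1)] dx_cong(1,2)[OF op eq(2)]
  have s: "smooth_near p (D Y Z)"
    by (rule affine_connectionD(1)[OF affine p sm(2,3)])
  show "fst (D X (D Y Z) p) = x1 p * dx d1 p + x2 p * dy d1 p + x1 p * d1 p * (b p + 2 * r1 p) + (x1 p * d2 p + x2 p * d1 p) * r2 p"
    "snd (D X (D Y Z) p) = x1 p * dx d2 p + x2 p * dy d2 p + x2 p * d2 p * (a p + 2 * r2 p) + (x1 p * d2 p + x2 p * d1 p) * r1 p"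
    unfolding connection_components[OF p sm(1) s] x1_def x2_def
    by (simp_all only: c eq[OF op(2)])
qed

text \<open>Expansion of all terms: second derivatives of \<open>Z\<close> cancel because mixed
  derivatives commute, and derivatives of \<open>X\<close> and \<open>Y\<close> cancel against the
  bracket term. What remains is tensorial and skew in \<open>X\<close>, \<open>Y\<close>.\<close>

lemma curvature_components:
  assumes p: "p \<in> W" and sm: "smooth_near p X" "smooth_near p Y" "smooth_near p Z"
  shows "curvature D X Y Z p = (fst (X p) * snd (Y p) - snd (X p) * fst (Y p)) *\<^sub>R
    (fst (Z p) * P p - snd (Z p) * S p, fst (Z p) * Q p - snd (Z p) * T p)"
proof -
  define x1 x2 where "x1 = (\<lambda>q. fst (X q))" and "x2 = (\<lambda>q. snd (X q))"
  define y1 y2 where "y1 = (\<lambda>q. fst (Y q))" and "y2 = (\<lambda>q. snd (Y q))"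
  define z1 z2 where "z1 = (\<lambda>q. fst (Z q))" and "z2 = (\<lambda>q. snd (Z q))"
  note defs = x1_def x2_def y1_def y2_def z1_def z2_def
  obtain V where V: "open V" "p \<in> V" "smooth_on V z1" "smooth_on V z2"
    using smooth_near_common[OF smooth_near_fst[OF sm(3)] smooth_near_snd[OF sm(3)]] unfolding defs .
  have sn: "smooth_near p x1" "smooth_near p x2" "smooth_near p y1" "smooth_near p y2" "smooth_near p z1" "smooth_near p z2"
    unfolding defs by (intro smooth_near_intros sm)+
  have "smooth_near p (dx z1)" "smooth_near p (dy z1)" "smooth_near p (dx z2)" "smooth_near p (dy z2)"
    using V by (auto intro!: smooth_nearI smooth_on_dx smooth_on_dy)
  note diff [simp] = sn[THEN smooth_near_imp_differentiable] this[THEN smooth_near_imp_differentiable]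
    smooth_on_imp_differentiable[OF smooth(1) p] smooth_on_imp_differentiable[OF smooth(2) p]
    smooth_on_imp_differentiable[OF smooth(3) p] smooth_on_imp_differentiable[OF smooth(4) p]
  have com: "dx (dy z1) p = dy (dx z1) p" "dx (dy z2) p = dy (dx z2) p"
    using dx_dy_commute[OF V(1) _ V(2)] V(3,4) by auto
  have lb: "lie_bracket X Y p = (x1 p * dx y1 p + x2 p * dy y1 p - y1 p * dx x1 p - y2 p * dy x1 p,
      x1 p * dx y2 p + x2 p * dy y2 p - y1 p * dx x2 p - y2 p * dy x2 p)"
    by (simp add: lie_bracket_def frechet_derivative_components smooth_near_imp_differentiable sm defs)
  have "smooth_near p (lie_bracket X Y)"
    unfolding lie_bracket_def by (intro smooth_near_intros sm)
  note lc = connection_components[OF p this sm(3), unfolded lb fst_conv snd_conv, folded defs]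
  note xy = second_covariant_derivative[OF p sm, folded defs]
    second_covariant_derivative[OF p sm(2,1,3), folded defs]
  show ?thesis
    unfolding curvature_def prod_eq_iff fst_diff snd_diff xy lc fst_scaleR snd_scaleR fst_conv snd_conv
      curv_P_def curv_Q_def curv_S_def curv_T_def defs[symmetric]
    unfolding fun_cong[OF x1_def, symmetric] fun_cong[OF x2_def, symmetric]
      fun_cong[OF y1_def, symmetric] fun_cong[OF y2_def, symmetric]
      fun_cong[OF z1_def, symmetric] fun_cong[OF z2_def, symmetric]
    by (simp add: partials com algebra_simps)
qed

text \<open>Each term of the covariant derivative of the curvature vanishes. For the first one the
  curvature must be zero on a neighbourhood, since it is differentiated there.\<close>

lemma affine_symmetric_if_flat:
  assumes "\<And>p. p \<in> W \<Longrightarrow> P p = 0 \<and> Q p = 0 \<and> S p = 0 \<and> T p = 0"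
  shows "affine_symmetric W D"
  unfolding affine_symmetric_def
proof (intro conjI affine ballI allI impI)
  have flat: "curvature D X Y Z p = 0" if "p \<in> W" "smooth_near p X" "smooth_near p Y" "smooth_near p Z" for p and X Y Z :: vfield
    using curvature_components[OF that] assms[OF that(1)] by (simp add: zero_prod_def)
  fix p and V X Y Z :: vfield assume p: "p \<in> W" and sm: "smooth_near p V" "smooth_near p X" "smooth_near p Y" "smooth_near p Z"
  obtain A where A: "open A" "p \<in> A" "smooth_on A X" "smooth_on A Y"
    using smooth_near_common[OF sm(2,3)] .
  obtain B where B: "open B" "p \<in> B" "smooth_on B Z"
    using sm(4) unfolding smooth_near_def by blast
  have zero: "curvature D X Y Z q = 0" if "q \<in> A \<inter> B \<inter> W" for q
    using that A B by (intro flat) (auto intro: smooth_nearI)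
  have op: "open (A \<inter> B \<inter> W)" "p \<in> A \<inter> B \<inter> W"
    using A B open_W p by auto
  have s: "smooth_near p (curvature D X Y Z)"
    using zero by (intro smooth_near_cong[OF smooth_near_const op]) auto
  have "fst (curvature D X Y Z q) = 0" "snd (curvature D X Y Z q) = 0" if "q \<in> A \<inter> B \<inter> W" for q
    using zero[OF that] by auto
  from dx_cong[OF op this(1)] dx_cong[OF op this(2)]
  have "D V (curvature D X Y Z) p = 0"
    unfolding prod_eq_iff connection_components[OF p sm(1) s]
    using zero[OF op(2)] by (simp add: partials)
  then show "nabla_curvature D V X Y Z p = 0"
    unfolding nabla_curvature_def
    using flat[OF p] affine_connectionD(1)[OF affine p sm(1)] sm by simp
qed

text \<open>Components of the parallelism of the curvature on the coordinate frame. These six are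
  the ones that involve the derivatives of the trace \<open>P - T\<close> and those of
  \<open>P\<close>, \<open>Q\<close>, \<open>S\<close> entering the Liouville equations.\<close>

lemma parallel_curvature:
  assumes sym: "affine_symmetric W D" and p: "p \<in> W"
  shows "dx P p + r2 p * Q p - (b p + 3 * r1 p) * P p = 0"
    "dx T p + r2 p * Q p - (b p + 3 * r1 p) * T p = 0"
    "dy P p + r1 p * S p - (a p + 3 * r2 p) * P p = 0"
    "dy T p + r1 p * S p - (a p + 3 * r2 p) * T p = 0"
    "dy Q p + r1 p * (P p + T p) - 2 * r2 p * Q p = 0"
    "dx S p + r2 p * (P p + T p) - 2 * r1 p * S p = 0"
proof -
  define K where "K = (\<lambda>w q. (fst w * P q - snd w * S q, fst w * Q q - snd w * T q) :: plane)"
  have c: "smooth_near q (\<lambda>_. v)" for q v :: plane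
    by (rule smooth_near_const)
  have R: "curvature D (\<lambda>_. (1, 0)) (\<lambda>_. (0, 1)) (\<lambda>_. w) q = K w q" if "q \<in> W" for q w
    using curvature_components[OF that c c c] by (simp add: K_def)
  have sK: "smooth_near p (K w)" for w
    unfolding K_def using smooth_curv[THEN smooth_nearI[OF open_W p]]
    by (intro smooth_near_intros)
  have sR: "smooth_near p (curvature D (\<lambda>_. (1, 0)) (\<lambda>_. (0, 1)) (\<lambda>_. w))" for w
    using R by (intro smooth_near_cong[OF sK open_W p]) auto
  have d [simp]: "P differentiable (at p)" "Q differentiable (at p)" "S differentiable (at p)" "T differentiable (at p)"
    using smooth_curv p smooth_on_imp_differentiable by auto
  have Rf: "fst (curvature D (\<lambda>_. (1, 0)) (\<lambda>_. (0, 1)) (\<lambda>_. w) q) = fst w * P q - snd w * S q" if "q \<in> W" for q w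
    using R[OF that] by (simp add: K_def)
  have Rs: "snd (curvature D (\<lambda>_. (1, 0)) (\<lambda>_. (0, 1)) (\<lambda>_. w) q) = fst w * Q q - snd w * T q" if "q \<in> W" for q w
    using R[OF that] by (simp add: K_def)
  note dR = dx_cong(1,2)[OF open_W p Rf] dx_cong(1,2)[OF open_W p Rs]
  have "nabla_curvature D (\<lambda>_. v) (\<lambda>_. (1, 0)) (\<lambda>_. (0, 1)) (\<lambda>_. w) p = 0" for v w
    using sym p c unfolding affine_symmetric_def by blast
  then have N: "D (\<lambda>_. v) (curvature D (\<lambda>_. (1, 0)) (\<lambda>_. (0, 1)) (\<lambda>_. w)) p
      - curvature D (D (\<lambda>_. v) (\<lambda>_. (1, 0))) (\<lambda>_. (0, 1)) (\<lambda>_. w) p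
      - curvature D (\<lambda>_. (1, 0)) (D (\<lambda>_. v) (\<lambda>_. (0, 1))) (\<lambda>_. w) p
      - curvature D (\<lambda>_. (1, 0)) (\<lambda>_. (0, 1)) (D (\<lambda>_. v) (\<lambda>_. w)) p = 0" for v w
    unfolding nabla_curvature_def .
  have s: "smooth_near p (D (\<lambda>_. v) (\<lambda>_. w))" for v w
    by (rule affine_connectionD(1)[OF affine p c c])
  note ev = curvature_components[OF p s c c] curvature_components[OF p c s c] curvature_components[OF p c c s]
    connection_components[OF p c sR] connection_components[OF p c c] dR Rf[OF p] Rs[OF p]
  note N' = N[unfolded prod_eq_iff fst_diff snd_diff]
  note E = N'[of "(1, 0)" "(1, 0)"] N'[of "(1, 0)" "(0, 1)"] N'[of "(0, 1)" "(1, 0)"] N'[of "(0, 1)" "(0, 1)"]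
  \<comment> \<open>Positions 1 to 4 are the first components, 5 to 8 the second ones, each in the
    order of the direction and the argument listed in \<open>E\<close>.\<close>
  note E' = E[THEN conjunct1] E[THEN conjunct2]
  show "dx P p + r2 p * Q p - (b p + 3 * r1 p) * P p = 0"
    using E'(1) by (simp add: ev partials algebra_simps)
  show "dx T p + r2 p * Q p - (b p + 3 * r1 p) * T p = 0"
    using E'(6) by (simp add: ev partials algebra_simps)
  show "dy P p + r1 p * S p - (a p + 3 * r2 p) * P p = 0"
    using E'(3) by (simp add: ev partials algebra_simps)
  show "dy T p + r1 p * S p - (a p + 3 * r2 p) * T p = 0"
    using E'(8) by (simp add: ev partials algebra_simps)
  show "dy Q p + r1 p * (P p + T p) - 2 * r2 p * Q p = 0"
    using E'(7) by (simp add: ev partials algebra_simps)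
  show "dx S p + r2 p * (P p + T p) - 2 * r1 p * S p = 0"
    using E'(2) by (simp add: ev partials algebra_simps)
qed

text \<open>\<open>P - T\<close> is the trace of \<open>R(e\<^sub>1, e\<^sub>2)\<close>. Being parallel, it satisfies a total differential equation
  whose integrability condition reads \<open>(P - T)\<^sup>2 = 0\<close>.\<close>

lemma trace_curvature_zero:
  assumes sym: "affine_symmetric W D" and p: "p \<in> W"
  shows "P p = T p"
proof -
  define \<tau> where "\<tau> = (\<lambda>q. P q - T q)"
  have s\<tau>: "smooth_on W \<tau>"
    unfolding \<tau>_def by (intro smooth_intros smooth_curv open_W)
  have d [simp]: "f differentiable (at q)" if "f \<in> {P, T, a, b, r1, r2, \<tau>}" "q \<in> W" for f q
    using that smooth_curv smooth s\<tau> smooth_on_imp_differentiable by fastforce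
  have x: "dx \<tau> q = (b q + 3 * r1 q) * \<tau> q" if "q \<in> W" for q
    using parallel_curvature(1,2)[OF sym that] that by (simp add: \<tau>_def partials algebra_simps)
  have y: "dy \<tau> q = (a q + 3 * r2 q) * \<tau> q" if "q \<in> W" for q
    using parallel_curvature(3,4)[OF sym that] that by (simp add: \<tau>_def partials algebra_simps)
  have "dy (dx \<tau>) p = (dy b p + 3 * dy r1 p) * \<tau> p + (b p + 3 * r1 p) * ((a p + 3 * r2 p) * \<tau> p)"
    using p by (simp add: dx_cong(2)[OF open_W p x] partials y)
  moreover have "dx (dy \<tau>) p = (dx a p + 3 * dx r2 p) * \<tau> p + (a p + 3 * r2 p) * ((b p + 3 * r1 p) * \<tau> p)"
    using p by (simp add: dx_cong(1)[OF open_W p y] partials x)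
  ultimately have "(dx a p + 3 * dx r2 p - dy b p - 3 * dy r1 p) * \<tau> p = 0"
    using dx_dy_commute[OF open_W s\<tau> p] by (simp add: algebra_simps)
  \<comment> \<open>The defect of integrability is again the trace, because the one-form in the
    total differential equation has components \<open>b + 3 r1\<close> and
    \<open>a + 3 r2\<close>.\<close>
  moreover have "dx a p + 3 * dx r2 p - dy b p - 3 * dy r1 p = \<tau> p"
    by (simp add: \<tau>_def curv_P_def curv_T_def)
  ultimately show ?thesis
    by (simp add: \<tau>_def)
qed

text \<open>In \<open>P_x + Q_y\<close> the mixed second derivative of \<open>r1\<close> cancels.
  Eliminating the first derivatives of \<open>r1\<close> and \<open>r2\<close> in favour of
  \<open>P\<close>, \<open>Q\<close> and comparing with the sum of the parallelism equations for
  \<open>P_x\<close> and \<open>Q_y\<close>, all terms with \<open>P\<close>, \<open>Q\<close>,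
  \<open>r1\<close>, \<open>r2\<close> cancel and \<open>m_x = beta m\<close> remains. The sum
  \<open>P_y + S_x\<close> gives the other equation.\<close>

lemma star_if_affine_symmetric:
  assumes sym: "affine_symmetric W D" and p: "p \<in> W"
  shows "dx (dx a) p + 2 * dy (dx b) p = b p * dx a p + 2 * b p * dy b p"
    and "2 * dy (dx a) p + dy (dy b) p = 2 * a p * dx a p + a p * dy b p"
proof -
  have PT: "P q = T q" if "q \<in> W" for q
    using trace_curvature_zero[OF sym that] .
  \<comment> \<open>The combination \<open>(2 P + T) / 3\<close> is free of the
    \<open>x\<close>-derivative of \<open>r2\<close>, and \<open>(P + 2 T) / 3\<close> below is free
    of the \<open>y\<close>-derivative of \<open>r1\<close>; both equal \<open>P\<close> because the
    trace vanishes.\<close>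
  have P1: "P q = r1 q * r2 q - dy r1 q - (dx a q + 2 * dy b q) / 3" if "q \<in> W" for q
    using PT[OF that] by (simp add: curv_P_def curv_T_def field_simps)
  have P2: "P q = r1 q * r2 q - dx r2 q - (2 * dx a q + dy b q) / 3" if "q \<in> W" for q
    using PT[OF that] by (simp add: curv_P_def curv_T_def field_simps)
  have d [simp]: "f differentiable (at p)" if "f \<in> {a, b, r1, r2, dx a, dx b, dy a, dy b, dx r1, dy r1, dx r2, dy r2}" for f
    using that smooth smooth_on_dx smooth_on_dy p by (fastforce intro: smooth_on_imp_differentiable)
  note com = dx_dy_commute[OF open_W _ p]
  note com' = smooth[THEN com]
  note par = parallel_curvature[OF sym p]
  have Px: "dx P p = dx r1 p * r2 p + r1 p * dx r2 p - dy (dx r1) p - (dx (dx a) p + 2 * dy (dx b) p) / 3"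
    by (rule dx_cong(1)[OF open_W p P1, THEN trans]) (simp_all add: partials com')
  have Py: "dy P p = dy r1 p * r2 p + r1 p * dy r2 p - dy (dx r2) p - (2 * dy (dx a) p + dy (dy b) p) / 3"
    by (rule dx_cong(2)[OF open_W p P2, THEN trans]) (simp_all add: partials)
  have Qy: "dy Q p = dy (dx r1) p - 2 * r1 p * dy r1 p - dy b p * r1 p - b p * dy r1 p"
    unfolding curv_Q_def[abs_def] by (simp add: partials)
  have Sx: "dx S p = dy (dx r2) p - 2 * r2 p * dx r2 p - dx a p * r2 p - a p * dx r2 p"
    unfolding curv_S_def[abs_def] by (simp add: partials com')
  have r: "dx r1 p = Q p + r1 p * r1 p + b p * r1 p" "dy r2 p = S p + r2 p * r2 p + a p * r2 p"
    "dy r1 p = r1 p * r2 p - P p - (dx a p + 2 * dy b p) / 3"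
    "dx r2 p = r1 p * r2 p - P p - (2 * dx a p + dy b p) / 3"
    using P1[OF p] P2[OF p] by (simp_all add: curv_Q_def curv_S_def)
  show "dx (dx a) p + 2 * dy (dx b) p = b p * dx a p + 2 * b p * dy b p"
    using par(1,5) PT[OF p] unfolding Px Qy unfolding r by (simp add: field_simps)
  show "2 * dy (dx a) p + dy (dy b) p = 2 * a p * dx a p + a p * dy b p"
    using par(3,6) PT[OF p] unfolding Py Sx unfolding r by (simp add: field_simps)
qed

end

section \<open>Flat web connections\<close>

text \<open>The reciprocal of a solution satisfies a linear equation. With \<open>E\<close> the
  exponential of an \<open>x\<close>-antiderivative of \<open>b\<close> and \<open>H\<close> an
  \<open>x\<close>-antiderivative of \<open>E\<close>, the solution with value \<open>g\<close> on
  the vertical line through \<open>p\<close> is \<open>g E / (1 - g H)\<close>; this form also makes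
  sense where \<open>g\<close> is zero.\<close>

lemma riccati_solution_dx:
  assumes r: "0 < r" and sm: "smooth_on (square p r) b" "smooth_on (square p r) m"
  obtains r' \<rho> where "0 < r'" "r' \<le> r" "smooth_on (square p r') \<rho>"
    "\<And>q. q \<in> square p r' \<Longrightarrow> dx \<rho> q = \<rho> q * \<rho> q + b q * \<rho> q"
    "\<And>x. (x, snd p) \<in> square p r' \<Longrightarrow> \<rho> (x, snd p) = 0"
    "\<And>y. (fst p, y) \<in> square p r' \<Longrightarrow> dy \<rho> (fst p, y) = - m (fst p, y) / 3"
proof -
  obtain B where B: "smooth_on (square p r) B" "\<And>q. q \<in> square p r \<Longrightarrow> dx B q = b q" "\<And>y. B (fst p, y) = 0"
    using antiderivative_dx[OF sm(1)] by blast
  define E where "E = (\<lambda>q. exp (B q))"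
  have E: "smooth_on (square p r) E"
    unfolding E_def by (intro smooth_intros open_square B(1))
  obtain H where H: "smooth_on (square p r) H" "\<And>q. q \<in> square p r \<Longrightarrow> dx H q = E q" "\<And>y. H (fst p, y) = 0"
    using antiderivative_dx[OF E] by blast
  obtain G where G: "smooth_on (square p r) G" "\<And>q. q \<in> square p r \<Longrightarrow> dy G q = m q" "\<And>x. G (x, snd p) = 0"
    using antiderivative_dy[OF sm(2)] by blast
  \<comment> \<open>The initial value depends on \<open>y\<close> only. Its
    \<open>y\<close>-derivative is \<open>- m / 3\<close>, which is the mixed equation on the
    vertical line, where the companion \<open>r2\<close> vanishes; and it is 0 at
    \<open>snd p\<close>, so that \<open>r1\<close> vanishes on the horizontal line, as the mixed
    equation for \<open>r2\<close> requires.\<close>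
  define g :: "plane \<Rightarrow> real" where "g = (\<lambda>q. - G (fst p, snd q) / 3)"
  have line: "(fst p, snd q) \<in> square p r" if "q \<in> square p r" for q
    using that r by (auto simp: mem_square)
  have g: "smooth_on (square p r) g"
    unfolding g_def
    by (intro smooth_intros open_square smooth_on_compose[OF open_square open_square _ G(1) line]) auto
  have gx: "dx g q = 0" "dy g q = - m (fst p, snd q) / 3" if q: "q \<in> square p r" for q
  proof -
    have "G differentiable (at (fst p, snd q))"
      using smooth_on_imp_differentiable[OF G(1) line[OF q]] .
    moreover have "((\<lambda>q. (fst p, snd q)) has_derivative (\<lambda>v. (0, snd v))) (at q)"
      by (auto intro!: derivative_eq_intros)
    ultimately have "((\<lambda>q. G (fst p, snd q)) has_derivative (\<lambda>v. snd v * dy G (fst p, snd q))) (at q)"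
      using has_derivative_compose[OF _ has_derivative_plane] by fastforce
    then have "(g has_derivative (\<lambda>v. - (snd v * dy G (fst p, snd q)) * (1 / 3))) (at q)"
      unfolding g_def using has_derivative_mult_left[OF has_derivative_minus, of _ _ _ "1 / 3"] by fastforce
    from dx_dyI[OF this] show "dx g q = 0" "dy g q = - m (fst p, snd q) / 3"
      using G(2)[OF line[OF q]] by auto
  qed
  \<comment> \<open>\<open>H\<close> vanishes on the vertical line, so the denominator is 1 at
    \<open>p\<close> and stays positive on a smaller square.\<close>
  have "open ((\<lambda>q. 1 - g q * H q) -` {0<..} \<inter> square p r)"
    using smooth_on_imp_continuous_on[OF g] smooth_on_imp_continuous_on[OF H(1)]
    by (intro continuous_on_open_vimage[OF open_square, THEN iffD1, rule_format] continuous_intros) auto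
  moreover have "p \<in> (\<lambda>q. 1 - g q * H q) -` {0<..} \<inter> square p r"
    using H(3)[of "snd p"] center_in_square[OF r] by simp
  ultimately obtain s where s: "0 < s" "square p s \<subseteq> (\<lambda>q. 1 - g q * H q) -` {0<..} \<inter> square p r"
    by (rule open_contains_square)
  define r' where "r' = min r s"
  have r': "0 < r'" "r' \<le> r"
    using r s(1) by (auto simp: r'_def)
  have sub: "square p r' \<subseteq> square p r"
    using square_mono[OF r'(2)] .
  have pos: "1 - g q * H q > 0" if "q \<in> square p r'" for q
    using s(2) square_mono[of r' s p] that by (auto simp: r'_def)
  define \<rho> where "\<rho> = (\<lambda>q. g q * E q / (1 - g q * H q))"
  have \<rho>: "smooth_on (square p r') \<rho>"
    unfolding \<rho>_def
    by (intro smooth_intros open_square smooth_on_subset[OF g sub] smooth_on_subset[OF E sub] smooth_on_subset[OF H(1) sub])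
      (use pos in force)
  have dx\<rho>: "dx \<rho> q = \<rho> q * \<rho> q + b q * \<rho> q" if q: "q \<in> square p r'" for q
  proof -
    have qr: "q \<in> square p r"
      using sub q by blast
    obtain x y where xy: "q = (x, y)"
      by (cases q)
    note d = smooth_on_imp_differentiable[OF _ qr, unfolded xy, THEN DERIV_dx]
    have gd: "((\<lambda>t. g (t, y)) has_real_derivative 0) (at x)"
      using d[OF g] gx(1)[OF qr] by (simp add: xy)
    have Bd: "((\<lambda>t. B (t, y)) has_real_derivative b (x, y)) (at x)"
      using d[OF B(1)] B(2)[OF qr] by (simp add: xy)
    have Ed: "((\<lambda>t. E (t, y)) has_real_derivative b (x, y) * E (x, y)) (at x)"
      unfolding E_def using DERIV_fun_exp[OF Bd] by (simp add: mult.commute)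
    have Hd: "((\<lambda>t. H (t, y)) has_real_derivative E (x, y)) (at x)"
      using d[OF H(1)] H(2)[OF qr] by (simp add: xy)
    have ne: "1 - g (x, y) * H (x, y) \<noteq> 0"
      using pos[OF q] by (simp add: xy)
    have "((\<lambda>t. \<rho> (t, y)) has_real_derivative
        (g (x, y) * (b (x, y) * E (x, y)) * (1 - g (x, y) * H (x, y)) - g (x, y) * E (x, y) * (- (g (x, y) * E (x, y))))
          / ((1 - g (x, y) * H (x, y)) * (1 - g (x, y) * H (x, y)))) (at x)"
      unfolding \<rho>_def by (rule derivative_eq_intros gd Ed Hd ne refl)+ (simp add: algebra_simps)
    moreover have "((\<lambda>t. \<rho> (t, y)) has_real_derivative dx \<rho> (x, y)) (at x)"
      using smooth_on_imp_differentiable[OF \<rho> q] by (simp add: xy DERIV_dx)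
    ultimately have "dx \<rho> (x, y) = (g (x, y) * (b (x, y) * E (x, y)) * (1 - g (x, y) * H (x, y)) - g (x, y) * E (x, y) * (- (g (x, y) * E (x, y))))
          / ((1 - g (x, y) * H (x, y)) * (1 - g (x, y) * H (x, y)))"
      by (rule DERIV_unique[rotated])
    then show ?thesis
      using ne by (simp add: xy \<rho>_def add_divide_distrib)
  qed
  show ?thesis
  proof (rule that[OF r' \<rho> dx\<rho>])
    show "\<rho> (x, snd p) = 0" for x
      using G(3)[of "fst p"] by (simp add: \<rho>_def g_def)
    show "dy \<rho> (fst p, y) = - m (fst p, y) / 3" if y: "(fst p, y) \<in> square p r'" for y
    proof -
      have "\<rho> (fst p, t) = g (fst p, t)" for t
        using H(3) B(3) by (simp add: \<rho>_def E_def)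
      moreover have "((\<lambda>t. \<rho> (fst p, t)) has_real_derivative dy \<rho> (fst p, y)) (at y)"
        using smooth_on_imp_differentiable[OF \<rho> y] by (rule DERIV_dy)
      moreover have "((\<lambda>t. g (fst p, t)) has_real_derivative dy g (fst p, y)) (at y)"
        using y sub smooth_on_imp_differentiable[OF g] by (intro DERIV_dy) blast
      ultimately have "dy \<rho> (fst p, y) = dy g (fst p, y)"
        by (simp add: DERIV_unique)
      then show ?thesis
        using gx(2)[of "(fst p, y)"] y sub by auto
    qed
  qed
qed

lemma riccati_solution_dy:
  assumes r: "0 < r" and sm: "smooth_on (square p r) a" "smooth_on (square p r) n"
  obtains r' \<rho> where "0 < r'" "r' \<le> r" "smooth_on (square p r') \<rho>"
    "\<And>q. q \<in> square p r' \<Longrightarrow> dy \<rho> q = \<rho> q * \<rho> q + a q * \<rho> q"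
    "\<And>y. (fst p, y) \<in> square p r' \<Longrightarrow> \<rho> (fst p, y) = 0"
    "\<And>x. (x, snd p) \<in> square p r' \<Longrightarrow> dx \<rho> (x, snd p) = - n (x, snd p) / 3"
proof -
  have sw: "prod.swap q \<in> square (prod.swap p) s \<longleftrightarrow> q \<in> square p s" for q s and p :: plane
    by (auto simp: mem_square)
  have sm': "smooth_on (square (prod.swap p) r) (\<lambda>q. a (prod.swap q))" "smooth_on (square (prod.swap p) r) (\<lambda>q. n (prod.swap q))"
    using sm sw[of _ "prod.swap p" r] by (auto intro!: smooth_on_swap[OF open_square open_square])
  obtain r' \<rho> where \<rho>: "0 < r'" "r' \<le> r" "smooth_on (square (prod.swap p) r') \<rho>"
    "\<And>q. q \<in> square (prod.swap p) r' \<Longrightarrow> dx \<rho> q = \<rho> q * \<rho> q + a (prod.swap q) * \<rho> q"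
    "\<And>x. (x, snd (prod.swap p)) \<in> square (prod.swap p) r' \<Longrightarrow> \<rho> (x, snd (prod.swap p)) = 0"
    "\<And>y. (fst (prod.swap p), y) \<in> square (prod.swap p) r' \<Longrightarrow>
      dy \<rho> (fst (prod.swap p), y) = - n (prod.swap (fst (prod.swap p), y)) / 3"
    using riccati_solution_dx[OF r sm'] by blast
  have d: "dx (\<lambda>q. \<rho> (prod.swap q)) q = dy \<rho> (prod.swap q)" "dy (\<lambda>q. \<rho> (prod.swap q)) q = dx \<rho> (prod.swap q)"
    if "q \<in> square p r'" for q
    using dx_dy_swap[OF smooth_on_imp_differentiable[OF \<rho>(3)], of q] that sw by auto
  show ?thesis
  proof (rule that[OF \<rho>(1,2)])
    show "smooth_on (square p r') (\<lambda>q. \<rho> (prod.swap q))"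
      by (rule smooth_on_swap[OF open_square open_square \<rho>(3)]) (simp only: sw)
    show "dy (\<lambda>q. \<rho> (prod.swap q)) q = \<rho> (prod.swap q) * \<rho> (prod.swap q) + a q * \<rho> (prod.swap q)"
      if "q \<in> square p r'" for q
      using d(2)[OF that] \<rho>(4)[of "prod.swap q"] that sw by simp
    show "\<rho> (prod.swap (fst p, y)) = 0" if "(fst p, y) \<in> square p r'" for y
      using \<rho>(5)[of y] that by (simp add: mem_square)
    show "dx (\<lambda>q. \<rho> (prod.swap q)) (x, snd p) = - n (x, snd p) / 3" if "(x, snd p) \<in> square p r'" for x
      using d(1)[OF that] \<rho>(6)[of x] that by (simp add: mem_square)
  qed
qed

text \<open>On a square of side \<open>s\<close> the suprema of \<open>\<bar>d\<^sub>1\<bar>\<close> and \<open>\<bar>d\<^sub>2\<bar>\<close> are at most \<open>s K\<close> times the supremum of their sum,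
  which forces the sum to vanish once \<open>2 s K < 1\<close>.\<close>

lemma goursat_zero:
  assumes r: "0 < r"
    and sm: "smooth_on (square p r) d1" "smooth_on (square p r) d2"
      "continuous_on (square p r) c1" "continuous_on (square p r) c2"
      "continuous_on (square p r) c3" "continuous_on (square p r) c4"
    and dx: "\<And>q. q \<in> square p r \<Longrightarrow> dx d1 q = c1 q * d1 q + c2 q * d2 q"
    and dy: "\<And>q. q \<in> square p r \<Longrightarrow> dy d2 q = c3 q * d1 q + c4 q * d2 q"
    and init: "\<And>y. (fst p, y) \<in> square p r \<Longrightarrow> d1 (fst p, y) = 0"
      "\<And>x. (x, snd p) \<in> square p r \<Longrightarrow> d2 (x, snd p) = 0"
  obtains s where "0 < s" "s \<le> r" "\<And>q. q \<in> square p s \<Longrightarrow> d1 q = 0 \<and> d2 q = 0"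
proof -
  \<comment> \<open>Closed squares are compact, so the suprema are attained.\<close>
  define C where "C = (\<lambda>s. {fst p - s..fst p + s} \<times> {snd p - s..snd p + s})"
  have compact: "compact (C s)" for s
    unfolding C_def by (intro compact_Times compact_Icc)
  have mem: "q \<in> C s \<longleftrightarrow> \<bar>fst q - fst p\<bar> \<le> s \<and> \<bar>snd q - snd p\<bar> \<le> s" for q s
    unfolding C_def by (cases q) auto
  have sub: "C s \<subseteq> square p r" if "s < r" for s
    using that by (auto simp: mem mem_square)
  define k where "k = (\<lambda>q. \<bar>c1 q\<bar> + \<bar>c2 q\<bar> + \<bar>c3 q\<bar> + \<bar>c4 q\<bar>)"
  have "continuous_on (C (r / 2)) k"
    unfolding k_def using sm(3-6) sub[of "r / 2"] r
    by (intro continuous_intros) (auto intro: continuous_on_subset)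
  moreover have "p \<in> C (r / 2)"
    using r by (simp add: mem)
  ultimately obtain q0 where q0: "q0 \<in> C (r / 2)" "\<And>q. q \<in> C (r / 2) \<Longrightarrow> k q \<le> k q0"
    using continuous_attains_sup[OF compact, of "r / 2" k] by blast
  \<comment> \<open>The summand 1 makes the bound on the coefficients positive, so that dividing by
    it is possible.\<close>
  define K where "K = k q0 + 1"
  have K: "0 < K" "\<And>q. q \<in> C (r / 2) \<Longrightarrow> k q \<le> K"
    using q0 by (auto simp: K_def k_def add_increasing add_increasing2 intro: order_trans)
  \<comment> \<open>The first bound keeps the square inside the region where \<open>K\<close>
    controls the coefficients; the second gives \<open>2 s K\<close> at most one half.\<close>
  define s where "s = min (r / 2) (1 / (4 * K))"
  have s: "0 < s" "s \<le> r / 2" "2 * (s * K) < 1"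
    using r K(1) by (auto simp: s_def min_def field_simps)
  have subs: "C s \<subseteq> square p r" "C s \<subseteq> C (r / 2)"
    using sub[of s] s r by (auto simp: mem)
  have "continuous_on (C s) (\<lambda>q. \<bar>d1 q\<bar> + \<bar>d2 q\<bar>)"
    using sm(1,2)[THEN smooth_on_imp_continuous_on] subs(1)
    by (intro continuous_intros) (auto intro: continuous_on_subset)
  moreover have "p \<in> C s"
    using s by (simp add: mem)
  ultimately obtain q1 where q1: "q1 \<in> C s" "\<And>q. q \<in> C s \<Longrightarrow> \<bar>d1 q\<bar> + \<bar>d2 q\<bar> \<le> \<bar>d1 q1\<bar> + \<bar>d2 q1\<bar>"
    using continuous_attains_sup[OF compact, of s "\<lambda>q. \<bar>d1 q\<bar> + \<bar>d2 q\<bar>"] by blast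
  define M where "M = \<bar>d1 q1\<bar> + \<bar>d2 q1\<bar>"
  have M: "0 \<le> M"
    by (simp add: M_def)
  have bound: "\<bar>u * d1 q + v * d2 q\<bar> \<le> K * M" if "q \<in> C s" "\<bar>u\<bar> + \<bar>v\<bar> \<le> k q" for u v q
  proof -
    have "\<bar>u * d1 q + v * d2 q\<bar> \<le> \<bar>u\<bar> * \<bar>d1 q\<bar> + \<bar>v\<bar> * \<bar>d2 q\<bar>"
      by (simp add: abs_mult[symmetric])
    also have "\<dots> \<le> k q * \<bar>d1 q\<bar> + k q * \<bar>d2 q\<bar>"
      using that(2) by (intro add_mono mult_right_mono) auto
    also have "\<dots> = k q * (\<bar>d1 q\<bar> + \<bar>d2 q\<bar>)"
      by (simp add: algebra_simps)
    also have "\<dots> \<le> K * M"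
      using q1(2)[OF that(1)] K(1) K(2)[OF subsetD[OF subs(2) that(1)]] M by (intro mult_mono) (auto simp: M_def)
    finally show ?thesis .
  qed
  have small: "\<bar>d1 q\<bar> \<le> s * K * M" "\<bar>d2 q\<bar> \<le> s * K * M" if q: "q \<in> C s" for q
  proof -
    obtain x y where xy: "q = (x, y)"
      by (cases q)
    have line: "(t, y) \<in> C s" if "t \<in> {fst p - s..fst p + s}" for t
      using that q by (auto simp: C_def xy)
    \<comment> \<open>Mean value inequality along the horizontal segment from the vertical line,
      where \<open>d1\<close> is zero; \<open>d2\<close> is treated along vertical segments.\<close>
    have "norm (d1 (x, y) - d1 (fst p, y)) \<le> K * M * norm (x - fst p)"
    proof (rule field_differentiable_bound[of "{fst p - s..fst p + s}" _ "\<lambda>t. dx d1 (t, y)"])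
      fix t assume t: "t \<in> {fst p - s..fst p + s}"
      then have "(t, y) \<in> square p r"
        using line subs(1) by blast
      then show "((\<lambda>t. d1 (t, y)) has_real_derivative dx d1 (t, y)) (at t within {fst p - s..fst p + s})"
        using smooth_on_imp_differentiable[OF sm(1)] DERIV_dx has_field_derivative_at_within by blast
      show "norm (dx d1 (t, y)) \<le> K * M"
        using bound[OF line[OF t], of "c1 (t, y)" "c2 (t, y)"] dx[OF \<open>(t, y) \<in> square p r\<close>] by (simp add: k_def)
    qed (use q s in \<open>auto simp: C_def xy\<close>)
    moreover have "d1 (fst p, y) = 0"
      using line[of "fst p"] subs(1) s by (intro init) auto
    moreover have "K * M * \<bar>x - fst p\<bar> \<le> K * M * s"
      using q M K(1) by (intro mult_left_mono) (auto simp: mem xy)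
    ultimately show "\<bar>d1 q\<bar> \<le> s * K * M"
      by (simp add: xy mult.commute mult.left_commute)
    have line: "(x, t) \<in> C s" if "t \<in> {snd p - s..snd p + s}" for t
      using that q by (auto simp: C_def xy)
    have "norm (d2 (x, y) - d2 (x, snd p)) \<le> K * M * norm (y - snd p)"
    proof (rule field_differentiable_bound[of "{snd p - s..snd p + s}" _ "\<lambda>t. dy d2 (x, t)"])
      fix t assume t: "t \<in> {snd p - s..snd p + s}"
      then have "(x, t) \<in> square p r"
        using line subs(1) by blast
      then show "((\<lambda>t. d2 (x, t)) has_real_derivative dy d2 (x, t)) (at t within {snd p - s..snd p + s})"
        using smooth_on_imp_differentiable[OF sm(2)] DERIV_dy has_field_derivative_at_within by blast
      show "norm (dy d2 (x, t)) \<le> K * M"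
        using bound[OF line[OF t], of "c3 (x, t)" "c4 (x, t)"] dy[OF \<open>(x, t) \<in> square p r\<close>] by (simp add: k_def)
    qed (use q s in \<open>auto simp: C_def xy\<close>)
    moreover have "d2 (x, snd p) = 0"
      using line[of "snd p"] subs(1) s by (intro init) auto
    moreover have "K * M * \<bar>y - snd p\<bar> \<le> K * M * s"
      using q M K(1) by (intro mult_left_mono) (auto simp: mem xy)
    ultimately show "\<bar>d2 q\<bar> \<le> s * K * M"
      by (simp add: xy mult.commute mult.left_commute)
  qed
  \<comment> \<open>The two bounds at the maximum point add up to \<open>M\<close> being at most
    \<open>2 s K M\<close>.\<close>
  have "(1 - 2 * (s * K)) * M \<le> 0"
    using small[OF q1(1)] by (simp add: M_def algebra_simps)
  then have "M = 0"
    using s(3) M by (simp add: mult_le_0_iff)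
  then have "d1 q = 0 \<and> d2 q = 0" if "q \<in> square p s" for q
    using q1(2)[of q] that by (auto simp: M_def mem mem_square)
  then show ?thesis
    using s r by (intro that[of s]) auto
qed

lemma flat_web_connection_exists:
  assumes U: "open U" "p \<in> U" and sm: "smooth_on U a" "smooth_on U b"
    and star: "\<And>q. q \<in> U \<Longrightarrow> dx (dx a) q + 2 * dy (dx b) q = b q * dx a q + 2 * b q * dy b q"
      "\<And>q. q \<in> U \<Longrightarrow> 2 * dy (dx a) q + dy (dy b) q = 2 * a q * dx a q + a q * dy b q"
  obtains W r1 r2 where "open W" "p \<in> W" "W \<subseteq> U" "smooth_on W r1" "smooth_on W r2"
    "affine_symmetric W (web_connection a b r1 r2)"
proof -
  obtain r where r: "0 < r" "square p r \<subseteq> U"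
    using open_contains_square[OF U] .
  define m where "m = (\<lambda>q. dx a q + 2 * dy b q)"
  define n where "n = (\<lambda>q. 2 * dx a q + dy b q)"
  have smU: "smooth_on U m" "smooth_on U n"
    unfolding m_def n_def by (intro smooth_intros U(1) sm)+
  note sq = smooth_on_subset[OF _ r(2)]
  obtain t1 r1 where r1: "0 < t1" "t1 \<le> r" "smooth_on (square p t1) r1"
    "\<And>q. q \<in> square p t1 \<Longrightarrow> dx r1 q = r1 q * r1 q + b q * r1 q"
    "\<And>x. (x, snd p) \<in> square p t1 \<Longrightarrow> r1 (x, snd p) = 0"
    "\<And>y. (fst p, y) \<in> square p t1 \<Longrightarrow> dy r1 (fst p, y) = - m (fst p, y) / 3"
    using riccati_solution_dx[OF r(1) sq[OF sm(2)] sq[OF smU(1)]] by blast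
  obtain t2 r2 where r2: "0 < t2" "t2 \<le> r" "smooth_on (square p t2) r2"
    "\<And>q. q \<in> square p t2 \<Longrightarrow> dy r2 q = r2 q * r2 q + a q * r2 q"
    "\<And>y. (fst p, y) \<in> square p t2 \<Longrightarrow> r2 (fst p, y) = 0"
    "\<And>x. (x, snd p) \<in> square p t2 \<Longrightarrow> dx r2 (x, snd p) = - n (x, snd p) / 3"
    using riccati_solution_dy[OF r(1) sq[OF sm(1)] sq[OF smU(2)]] by blast
  define t where "t = min t1 t2"
  have t: "0 < t" "square p t \<subseteq> square p t1" "square p t \<subseteq> square p t2" "square p t \<subseteq> U"
    using r1(1) r2(1) r square_mono[of t t1 p] square_mono[of t t2 p] square_mono[of t1 r p] r1(2) by (auto simp: t_def)
  let ?V = "square p t"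
  have smV: "smooth_on ?V a" "smooth_on ?V b" "smooth_on ?V r1" "smooth_on ?V r2" "smooth_on ?V m" "smooth_on ?V n"
    using sm smU r1(3) r2(3) t by (auto intro: smooth_on_subset)
  \<comment> \<open>The defects of the two mixed equations. With the Riccati equations, their
    vanishing is flatness.\<close>
  define d1 where "d1 = (\<lambda>q. dy r1 q - r1 q * r2 q + m q / 3)"
  define d2 where "d2 = (\<lambda>q. dx r2 q - r1 q * r2 q + n q / 3)"
  have smd: "smooth_on ?V d1" "smooth_on ?V d2"
    unfolding d1_def d2_def by (intro smooth_intros open_square smV; simp)+
  have diff: "f differentiable (at q)"
    if "f \<in> {a, b, r1, r2, m, n, dx a, dx b, dy a, dy b, dx r1, dy r1, dx r2, dy r2}" "q \<in> ?V" for f q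
    using that smV smV[THEN smooth_on_dx] smV[THEN smooth_on_dy] by (auto intro: smooth_on_imp_differentiable)
  have eqs: "dx d1 q = (2 * r1 q + b q) * d1 q + (- r1 q) * d2 q \<and> dy d2 q = (- r2 q) * d1 q + (2 * r2 q + a q) * d2 q"
    if q: "q \<in> ?V" for q
  proof -
    note [simp] = diff[OF _ q]
    have R1: "dx r1 q = r1 q * r1 q + b q * r1 q" if "q \<in> ?V" for q
      using r1(4) t that by blast
    have R2: "dy r2 q = r2 q * r2 q + a q * r2 q" if "q \<in> ?V" for q
      using r2(4) t that by blast
    have qU: "q \<in> U"
      using q t by blast
    \<comment> \<open>The star conditions enter here and in the equation for \<open>n\<close>: they
      remove the terms free of \<open>d1\<close> and \<open>d2\<close>, which makes the system for
      the defects homogeneous.\<close>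
    have mx: "dx m q = b q * m q"
      using star(1)[OF qU] dx_dy_commute[OF U(1) sm(2) qU] unfolding m_def by (simp add: partials algebra_simps)
    have ny: "dy n q = a q * n q"
      using star(2)[OF qU] unfolding n_def by (simp add: partials algebra_simps)
    \<comment> \<open>The Riccati equation holds on a whole square and may be differentiated in the
      other variable.\<close>
    have xy1: "dx (dy r1) q = 2 * r1 q * dy r1 q + dy b q * r1 q + b q * dy r1 q"
      unfolding dx_dy_commute[OF open_square smV(3) q]
      by (rule dx_cong(2)[OF open_square q R1, THEN trans]) (simp_all add: partials)
    have xy2: "dy (dx r2) q = 2 * r2 q * dx r2 q + dx a q * r2 q + a q * dx r2 q"
      unfolding dx_dy_commute[OF open_square smV(4) q, symmetric]
      by (rule dx_cong(1)[OF open_square q R2, THEN trans]) (simp_all add: partials)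
    have e: "dy r1 q = d1 q + r1 q * r2 q - m q / 3" "dx r2 q = d2 q + r1 q * r2 q - n q / 3"
      by (simp_all add: d1_def d2_def)
    have mn: "dx a q = (2 * n q - m q) / 3" "dy b q = (2 * m q - n q) / 3"
      by (simp_all add: m_def n_def)
    have 1: "dx d1 q = dx (dy r1) q - (dx r1 q * r2 q + r1 q * dx r2 q) + dx m q / 3"
      unfolding d1_def by (simp add: partials)
    have 2: "dy d2 q = dy (dx r2) q - (dy r1 q * r2 q + r1 q * dy r2 q) + dy n q / 3"
      unfolding d2_def by (simp add: partials)
    show ?thesis
      unfolding 1 2 xy1 xy2 R1[OF q] R2[OF q] mx ny unfolding e mn by (simp add: field_simps)
  qed
  have cont: "continuous_on ?V (\<lambda>q. 2 * r1 q + b q)" "continuous_on ?V (\<lambda>q. - r1 q)"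
    "continuous_on ?V (\<lambda>q. - r2 q)" "continuous_on ?V (\<lambda>q. 2 * r2 q + a q)"
    by (intro continuous_intros smV[THEN smooth_on_imp_continuous_on])+
  have init: "d1 (fst p, y) = 0" if "(fst p, y) \<in> ?V" for y
    using r1(6)[of y] r2(5)[of y] subsetD[OF t(2) that] subsetD[OF t(3) that] by (simp add: d1_def)
  have init': "d2 (x, snd p) = 0" if "(x, snd p) \<in> ?V" for x
    using r1(5)[of x] r2(6)[of x] subsetD[OF t(2) that] subsetD[OF t(3) that] by (simp add: d2_def)
  obtain s where s: "0 < s" "s \<le> t" "\<And>q. q \<in> square p s \<Longrightarrow> d1 q = 0 \<and> d2 q = 0"
    using goursat_zero[OF t(1) smd cont _ _ init init'] eqs by blast
  define W where "W = square p s"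
  have W: "open W" "p \<in> W" "W \<subseteq> ?V"
    using s square_mono by (auto simp: W_def open_square center_in_square)
  have smW: "smooth_on W a" "smooth_on W b" "smooth_on W r1" "smooth_on W r2"
    using smV W(3) by (auto intro: smooth_on_subset)
  interpret web_like_connection W "web_connection a b r1 r2" a b r1 r2
    using W smW by unfold_locales (auto simp: agrees_on_def intro: affine_connection_web_connection)
  have "affine_symmetric W (web_connection a b r1 r2)"
  proof (rule affine_symmetric_if_flat)
    fix q assume q: "q \<in> W"
    have "dx r1 q = r1 q * r1 q + b q * r1 q" "dy r2 q = r2 q * r2 q + a q * r2 q"
      using r1(4) r2(4) q W(3) t by blast+
    moreover have "d1 q = 0" "d2 q = 0"
      using s(3) q by (auto simp: W_def)
    ultimately show "P q = 0 \<and> Q q = 0 \<and> S q = 0 \<and> T q = 0"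
      by (simp add: curv_P_def curv_Q_def curv_S_def curv_T_def d1_def d2_def m_def n_def field_simps)
  qed
  then show ?thesis
    using that W t smW by blast
qed

section \<open>Pulling back connections\<close>

lemma affine_connection_subset:
  assumes "affine_connection U D" "open W" "W \<subseteq> U"
  shows "affine_connection W D"
  using assms unfolding affine_connection_def is_connection_def torsion_free_def by blast

lemma affine_symmetric_subset:
  assumes "affine_symmetric U D" "open W" "W \<subseteq> U"
  shows "affine_symmetric W D"
  using assms affine_connection_subset unfolding affine_symmetric_def by blast

text \<open>Pushing forward a pulled back derivative recovers the original one only on the image of
  the diffeomorphism, so nested derivatives are compared through equality near a point.\<close>

definition germ_eq :: "plane \<Rightarrow> (plane \<Rightarrow> 'b) \<Rightarrow> (plane \<Rightarrow> 'b) \<Rightarrow> bool" where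
  "germ_eq p f g \<longleftrightarrow> (\<forall>\<^sub>F q in nhds p. f q = g q)"

lemma germ_eq_refl: "germ_eq p f f"
  by (simp add: germ_eq_def)

lemma germ_eq_at: "germ_eq p f g \<Longrightarrow> f p = g p"
  unfolding germ_eq_def by (rule eventually_nhds_x_imp_x)

lemma germ_eqI: "open W \<Longrightarrow> p \<in> W \<Longrightarrow> (\<And>q. q \<in> W \<Longrightarrow> f q = g q) \<Longrightarrow> germ_eq p f g"
  unfolding germ_eq_def by (auto simp: eventually_nhds)

lemma eventually_smooth_near: "smooth_near p f \<Longrightarrow> \<forall>\<^sub>F q in nhds p. smooth_near q f"
  unfolding eventually_nhds smooth_near_def by blast

lemma eventually_germ_eq: "germ_eq p f g \<Longrightarrow> \<forall>\<^sub>F q in nhds p. germ_eq q f g"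
  unfolding germ_eq_def by (simp add: eventually_eventually)

lemma frechet_derivative_germ:
  fixes f g :: "plane \<Rightarrow> 'b::real_normed_vector"
  assumes "germ_eq p f g"
  shows "frechet_derivative f (at p) = frechet_derivative g (at p)"
proof -
  obtain W where W: "open W" "p \<in> W" "\<And>q. q \<in> W \<Longrightarrow> f q = g q"
    using assms unfolding germ_eq_def eventually_nhds by blast
  have "(f has_derivative D) (at p) \<longleftrightarrow> (g has_derivative D) (at p)" for D
    using W has_derivative_transform_within_open[of f D p UNIV W g]
      has_derivative_transform_within_open[of g D p UNIV W f] by auto
  then show ?thesis
    by (simp add: frechet_derivative_def)
qed

lemma smooth_near_germ: "smooth_near p f \<Longrightarrow> germ_eq p f g \<Longrightarrow> smooth_near p g"
  unfolding germ_eq_def eventually_nhds using smooth_near_cong by blast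

lemma smooth_near_lie_bracket:
  "smooth_near p X \<Longrightarrow> smooth_near p Y \<Longrightarrow> smooth_near p (lie_bracket X Y)"
  unfolding lie_bracket_def by (intro smooth_near_intros)

lemma smooth_near_curvature:
  assumes "affine_connection W D" "p \<in> W" "smooth_near p X" "smooth_near p Y" "smooth_near p Z"
  shows "smooth_near p (curvature D X Y Z)"
  unfolding curvature_def
  by (intro smooth_near_diff affine_connectionD(1)[OF assms(1,2)] smooth_near_lie_bracket assms(3-5))

text \<open>The coordinate formula holds at all nearby points and depends on germs only. Stating the
  conclusion for germs allows it to be iterated inside the curvature and its covariant
  derivative.\<close>

lemma connection_germ:
  assumes D: "affine_connection W D" and p: "p \<in> W"
    and sm: "smooth_near p X" "smooth_near p Y" and eq: "germ_eq p X X'" "germ_eq p Y Y'"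
  shows "germ_eq p (D X Y) (D X' Y')"
proof -
  have "\<forall>\<^sub>F q in nhds p. q \<in> W"
    using D p eventually_nhds_in_open by (auto simp: affine_connection_def)
  then show ?thesis
    unfolding germ_eq_def
    using eventually_smooth_near[OF sm(1)] eventually_smooth_near[OF sm(2)]
      eventually_germ_eq[OF eq(1)] eventually_germ_eq[OF eq(2)]
  proof eventually_elim
    case (elim q)
    have s: "smooth_near q X'" "smooth_near q Y'"
      using smooth_near_germ[OF elim(2,4)] smooth_near_germ[OF elim(3,5)] .
    show ?case
      unfolding connection_coordinates[OF D elim(1-3)] connection_coordinates[OF D elim(1) s]
        germ_eq_at[OF elim(4)] germ_eq_at[OF elim(5)] frechet_derivative_germ[OF elim(5)] ..
  qed
qed

lemma lie_bracket_germ: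
  assumes "germ_eq p X X'" "germ_eq p Y Y'"
  shows "germ_eq p (lie_bracket X Y) (lie_bracket X' Y')"
  unfolding germ_eq_def
  using eventually_germ_eq[OF assms(1)] eventually_germ_eq[OF assms(2)]
proof eventually_elim
  case (elim q)
  show ?case
    unfolding lie_bracket_def germ_eq_at[OF elim(1)] germ_eq_at[OF elim(2)]
      frechet_derivative_germ[OF elim(1)] frechet_derivative_germ[OF elim(2)] ..
qed

lemma curvature_germ:
  assumes D: "affine_connection W D" "p \<in> W"
    and sm: "smooth_near p X" "smooth_near p Y" "smooth_near p Z"
    and eq: "germ_eq p X X'" "germ_eq p Y Y'" "germ_eq p Z Z'"
  shows "curvature D X Y Z p = curvature D X' Y' Z' p"
  unfolding curvature_def
  by (intro arg_cong2[of _ _ _ _ minus] germ_eq_at connection_germ[OF D] lie_bracket_germ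
      affine_connectionD(1)[OF D] smooth_near_lie_bracket sm eq)

section \<open>Transport of vector fields along a diffeomorphism\<close>

locale diffeo =
  fixes U V :: "plane set" and \<phi> :: "plane \<Rightarrow> plane"
  assumes diffeo: "diffeomorphism U V \<phi>"
begin

definition "\<psi> = inv_into U \<phi>"

lemma basic: "open U" "open V" "smooth_on U \<phi>" "smooth_on V \<psi>"
  and maps: "p \<in> U \<Longrightarrow> \<phi> p \<in> V" "q \<in> V \<Longrightarrow> \<psi> q \<in> U" "p \<in> U \<Longrightarrow> \<psi> (\<phi> p) = p" "q \<in> V \<Longrightarrow> \<phi> (\<psi> q) = q"
  using diffeo unfolding diffeomorphism_def \<psi>_def bij_betw_def
  by (auto simp: inv_into_into f_inv_into_f)

definition A where "A p = frechet_derivative \<phi> (at p)"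
definition B where "B q = frechet_derivative \<psi> (at q)"

lemma A: "p \<in> U \<Longrightarrow> (\<phi> has_derivative A p) (at p)" "p \<in> U \<Longrightarrow> linear (A p)"
  and B: "q \<in> V \<Longrightarrow> (\<psi> has_derivative B q) (at q)" "q \<in> V \<Longrightarrow> linear (B q)"
  unfolding A_def B_def using basic
  by (auto intro: smooth_on_has_derivative linear_frechet_derivative smooth_on_imp_differentiable)

lemma BA: "B (\<phi> p) (A p v) = v" if p: "p \<in> U"
proof -
  have "((\<lambda>q. \<psi> (\<phi> q)) has_derivative (\<lambda>v. B (\<phi> p) (A p v))) (at p)"
    by (rule has_derivative_compose[OF A(1)[OF p] B(1)[OF maps(1)[OF p]]])
  then have "((\<lambda>q. q) has_derivative (\<lambda>v. B (\<phi> p) (A p v))) (at p)"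
    by (rule has_derivative_transform_within_open[OF _ basic(1) p]) (simp add: maps)
  from frechet_derivativeI[OF this] show ?thesis
    by (metis frechet_derivative_ident)
qed

lemma AB: "A (\<psi> q) (B q v) = v" if q: "q \<in> V"
proof -
  have "((\<lambda>p. \<phi> (\<psi> p)) has_derivative (\<lambda>v. A (\<psi> q) (B q v))) (at q)"
    by (rule has_derivative_compose[OF B(1)[OF q] A(1)[OF maps(2)[OF q]]])
  then have "((\<lambda>q. q) has_derivative (\<lambda>v. A (\<psi> q) (B q v))) (at q)"
    by (rule has_derivative_transform_within_open[OF _ basic(2) q]) (simp add: maps)
  from frechet_derivativeI[OF this] show ?thesis
    by (metis frechet_derivative_ident)
qed

text \<open>The value \<open>0\<close> outside \<open>V\<close> makes \<open>push\<close> linear, so that the axioms of a connection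
  transfer as identities of vector fields.\<close>

definition push :: "vfield \<Rightarrow> vfield" where
  "push X q = (if q \<in> V then A (\<psi> q) (X (\<psi> q)) else 0)"

definition pull :: "vfield \<Rightarrow> vfield" where
  "pull Z p = B (\<phi> p) (Z (\<phi> p))"

definition pullback :: "connection \<Rightarrow> connection" where
  "pullback D X Y = pull (D (push X) (push Y))"

lemma push_at: "p \<in> U \<Longrightarrow> push X (\<phi> p) = A p (X p)"
  by (simp add: push_def maps)

lemma push_pull: "q \<in> V \<Longrightarrow> push (pull Z) q = Z q"
  by (simp add: pull_def push_def maps AB)

lemma push_add: "push (\<lambda>q. X q + Y q) = (\<lambda>q. push X q + push Y q)"
  using A(2)[OF maps(2)] by (auto simp: push_def fun_eq_iff linear_add)

lemma push_scaleR: "push (\<lambda>q. g q *\<^sub>R X q) = (\<lambda>q. g (\<psi> q) *\<^sub>R push X q)"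
  using A(2)[OF maps(2)] by (auto simp: push_def fun_eq_iff linear_cmul)

lemma smooth_near_compose_\<psi>:
  fixes f :: "plane \<Rightarrow> 'b::real_normed_vector"
  assumes "smooth_near p f" "p \<in> U"
  shows "smooth_near (\<phi> p) (\<lambda>q. f (\<psi> q))"
proof -
  obtain W where W: "open W" "p \<in> W" "smooth_on W f"
    using assms(1) unfolding smooth_near_def by blast
  have op: "open (\<psi> -` W \<inter> V)"
    using continuous_on_open_vimage[OF basic(2)] smooth_on_imp_continuous_on[OF basic(4)] W(1) by blast
  show ?thesis
  proof (rule smooth_nearI[OF op])
    show "\<phi> p \<in> \<psi> -` W \<inter> V"
      using assms(2) W(2) by (simp add: maps)
    show "smooth_on (\<psi> -` W \<inter> V) (\<lambda>q. f (\<psi> q))"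
      using smooth_on_subset[OF basic(4)] by (intro smooth_on_compose[OF op W(1) _ W(3)]) auto
  qed
qed

lemma smooth_near_compose_\<phi>:
  fixes f :: "plane \<Rightarrow> 'b::real_normed_vector"
  assumes "smooth_near (\<phi> p) f" "p \<in> U"
  shows "smooth_near p (\<lambda>q. f (\<phi> q))"
proof -
  obtain W where W: "open W" "\<phi> p \<in> W" "smooth_on W f"
    using assms(1) unfolding smooth_near_def by blast
  have op: "open (\<phi> -` W \<inter> U)"
    using continuous_on_open_vimage[OF basic(1)] smooth_on_imp_continuous_on[OF basic(3)] W(1) by blast
  show ?thesis
  proof (rule smooth_nearI[OF op])
    show "p \<in> \<phi> -` W \<inter> U"
      using assms(2) W(2) by simp
    show "smooth_on (\<phi> -` W \<inter> U) (\<lambda>q. f (\<phi> q))"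
      using smooth_on_subset[OF basic(3)] by (intro smooth_on_compose[OF op W(1) _ W(3)]) auto
  qed
qed

lemma smooth_near_push:
  assumes "smooth_near p X" "p \<in> U"
  shows "smooth_near (\<phi> p) (push X)"
proof (rule smooth_near_cong[OF _ basic(2) maps(1)[OF assms(2)]])
  show "smooth_near (\<phi> p) (\<lambda>q. frechet_derivative \<phi> (at (\<psi> q)) (X (\<psi> q)))"
    using smooth_near_compose_\<psi>[OF smooth_near_frechet_derivative_field[OF smooth_nearI[OF basic(1) assms(2) basic(3)] assms(1)] assms(2)] .
qed (simp add: push_def A_def)

lemma smooth_near_pull:
  assumes "smooth_near (\<phi> p) Z" "p \<in> U"
  shows "smooth_near p (pull Z)"
  unfolding pull_def[abs_def] B_def
  using smooth_near_compose_\<phi>[OF smooth_near_frechet_derivative_field[OF smooth_nearI[OF basic(2) maps(1)[OF assms(2)] basic(4)] assms(1)] assms(2)] .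

text \<open>The second derivative of \<open>\<phi>\<close> at \<open>p\<close> in the directions
  \<open>u\<close> and \<open>w\<close>, assembled from the derivatives of the two columns of
  \<open>A\<close>.\<close>

definition hess :: "plane \<Rightarrow> plane \<Rightarrow> plane \<Rightarrow> plane" where
  "hess p u w = fst w *\<^sub>R frechet_derivative (\<lambda>q. A q (1, 0)) (at p) u
     + snd w *\<^sub>R frechet_derivative (\<lambda>q. A q (0, 1)) (at p) u"

lemma A_expand: "p \<in> U \<Longrightarrow> A p w = fst w *\<^sub>R A p (1, 0) + snd w *\<^sub>R A p (0, 1)"
  using linear_add[OF A(2)[of p], of "fst w *\<^sub>R (1, 0)" "snd w *\<^sub>R (0, 1)"]
  by (simp only: linear_cmul[OF A(2)[of p]]) simp

lemma smooth_on_A: "smooth_on U (\<lambda>q. A q v)"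
  unfolding A_def by (rule smooth_on_frechet_derivative[OF basic(3)])

text \<open>Mixed derivatives of the components of \<open>\<phi>\<close> commute. This makes the
  second-order terms cancel in the bracket of pushed fields, hence in the torsion.\<close>

lemma hess_commute: "hess p u w = hess p w u" if p: "p \<in> U"
proof -
  let ?D = "\<lambda>e. frechet_derivative (\<lambda>q. A q e) (at p)"
  have s: "smooth_on U (\<lambda>q. fst (\<phi> q))" "smooth_on U (\<lambda>q. snd (\<phi> q))"
    by (intro smooth_intros basic)+
  have comp: "fst (A q (1, 0)) = dx (\<lambda>q. fst (\<phi> q)) q" "snd (A q (1, 0)) = dx (\<lambda>q. snd (\<phi> q)) q"
      "fst (A q (0, 1)) = dy (\<lambda>q. fst (\<phi> q)) q" "snd (A q (0, 1)) = dy (\<lambda>q. snd (\<phi> q)) q" if "q \<in> U" for q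
    unfolding A_def frechet_derivative_components[OF smooth_on_imp_differentiable[OF basic(3) that]] by auto
  have c: "dx (\<lambda>q. fst (A q (0, 1))) p = dy (\<lambda>q. fst (A q (1, 0))) p"
    using dx_dy_commute[OF basic(1) s(1) p] dx_cong(1)[OF basic(1) p comp(3)] dx_cong(2)[OF basic(1) p comp(1)]
    by simp
  have c': "dx (\<lambda>q. snd (A q (0, 1))) p = dy (\<lambda>q. snd (A q (1, 0))) p"
    using dx_dy_commute[OF basic(1) s(2) p] dx_cong(1)[OF basic(1) p comp(4)] dx_cong(2)[OF basic(1) p comp(2)]
    by simp
  note fd = frechet_derivative_components[OF smooth_on_imp_differentiable[OF smooth_on_A p]]
  show ?thesis
    unfolding hess_def fd by (simp add: c c' algebra_simps)
qed

lemma derivative_A_field: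
  assumes p: "p \<in> U" and Y: "Y differentiable (at p)"
  shows "((\<lambda>q. A q (Y q)) has_derivative (\<lambda>v. hess p v (Y p) + A p (frechet_derivative Y (at p) v))) (at p)"
proof -
  have d: "(Y has_derivative frechet_derivative Y (at p)) (at p)"
    using Y frechet_derivative_works by blast
  have "((\<lambda>q. fst (Y q) *\<^sub>R A q (1, 0) + snd (Y q) *\<^sub>R A q (0, 1)) has_derivative
      (\<lambda>v. (fst (Y p) *\<^sub>R frechet_derivative (\<lambda>q. A q (1, 0)) (at p) v + fst (frechet_derivative Y (at p) v) *\<^sub>R A p (1, 0))
        + (snd (Y p) *\<^sub>R frechet_derivative (\<lambda>q. A q (0, 1)) (at p) v + snd (frechet_derivative Y (at p) v) *\<^sub>R A p (0, 1)))) (at p)"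
    by (intro has_derivative_add has_derivative_scaleR has_derivative_fst has_derivative_snd d
        smooth_on_has_derivative[OF smooth_on_A p])
  moreover have "(\<lambda>v. (fst (Y p) *\<^sub>R frechet_derivative (\<lambda>q. A q (1, 0)) (at p) v + fst (frechet_derivative Y (at p) v) *\<^sub>R A p (1, 0))
        + (snd (Y p) *\<^sub>R frechet_derivative (\<lambda>q. A q (0, 1)) (at p) v + snd (frechet_derivative Y (at p) v) *\<^sub>R A p (0, 1)))
      = (\<lambda>v. hess p v (Y p) + A p (frechet_derivative Y (at p) v))"
  proof
    show "(fst (Y p) *\<^sub>R frechet_derivative (\<lambda>q. A q (1, 0)) (at p) v + fst (frechet_derivative Y (at p) v) *\<^sub>R A p (1, 0))
        + (snd (Y p) *\<^sub>R frechet_derivative (\<lambda>q. A q (0, 1)) (at p) v + snd (frechet_derivative Y (at p) v) *\<^sub>R A p (0, 1))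
      = hess p v (Y p) + A p (frechet_derivative Y (at p) v)" for v
      using A_expand[OF p, of "frechet_derivative Y (at p) v"] by (simp add: hess_def)
  qed
  ultimately have "((\<lambda>q. fst (Y q) *\<^sub>R A q (1, 0) + snd (Y q) *\<^sub>R A q (0, 1)) has_derivative
      (\<lambda>v. hess p v (Y p) + A p (frechet_derivative Y (at p) v))) (at p)"
    by simp
  then show ?thesis
    by (rule has_derivative_transform_within_open[OF _ basic(1) p]) (rule A_expand[symmetric])
qed

text \<open>Since \<open>push Y\<close> composed with \<open>\<phi>\<close> is \<open>A\<close>
  applied to \<open>Y\<close>, differentiation takes place on \<open>U\<close> and \<open>B\<close>
  is never differentiated. Directions at the image point are written as
  \<open>A p v\<close>.\<close>

lemma derivative_push:
  assumes p: "p \<in> U" and Y: "smooth_near p Y"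
  shows "frechet_derivative (push Y) (at (\<phi> p)) (A p v) = hess p v (Y p) + A p (frechet_derivative Y (at p) v)"
proof -
  have "(push Y has_derivative frechet_derivative (push Y) (at (\<phi> p))) (at (\<phi> p))"
    using smooth_near_imp_differentiable[OF smooth_near_push[OF Y p]] frechet_derivative_works by blast
  from has_derivative_compose[OF A(1)[OF p] this]
  have "((\<lambda>q. A q (Y q)) has_derivative (\<lambda>v. frechet_derivative (push Y) (at (\<phi> p)) (A p v))) (at p)"
    by (rule has_derivative_transform_within_open[OF _ basic(1) p]) (simp add: push_at)
  from has_derivative_unique[OF this derivative_A_field[OF p smooth_near_imp_differentiable[OF Y]]]
  show ?thesis
    by metis
qed

lemma lie_bracket_push:
  assumes p: "p \<in> U" and sm: "smooth_near p X" "smooth_near p Y"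
  shows "lie_bracket (push X) (push Y) (\<phi> p) = A p (lie_bracket X Y p)"
  using hess_commute[OF p, of "X p" "Y p"]
  by (simp add: lie_bracket_def push_at p derivative_push sm linear_diff[OF A(2)[OF p]])

lemma eventually_\<psi>:
  assumes "p \<in> U" "\<forall>\<^sub>F q in nhds p. P q"
  shows "\<forall>\<^sub>F q in nhds (\<phi> p). q \<in> V \<and> P (\<psi> q)"
proof -
  have "isCont \<psi> (\<phi> p)"
    using has_derivative_continuous[OF B(1)[OF maps(1)[OF assms(1)]]] .
  then have "filterlim \<psi> (nhds p) (nhds (\<phi> p))"
    using assms(1) unfolding isCont_def tendsto_at_iff_tendsto_nhds by (simp add: maps)
  then have "\<forall>\<^sub>F q in nhds (\<phi> p). P (\<psi> q)"
    using assms(2) by (auto simp: filterlim_iff)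
  moreover have "\<forall>\<^sub>F q in nhds (\<phi> p). q \<in> V"
    using basic(2) maps(1)[OF assms(1)] by (rule eventually_nhds_in_open)
  ultimately show ?thesis
    by (rule eventually_conj[rotated])
qed

lemma germ_push_lie_bracket:
  assumes p: "p \<in> U" and sm: "smooth_near p X" "smooth_near p Y"
  shows "germ_eq (\<phi> p) (push (lie_bracket X Y)) (lie_bracket (push X) (push Y))"
  unfolding germ_eq_def
  using eventually_\<psi>[OF p eventually_smooth_near[OF sm(1)]] eventually_\<psi>[OF p eventually_smooth_near[OF sm(2)]]
proof eventually_elim
  case (elim q)
  then show ?case
    using lie_bracket_push[of "\<psi> q" X Y] by (simp add: maps push_def)
qed

section \<open>Transport of a connection, its curvature and its geodesics\<close>

context
  fixes D :: connection
  assumes D: "affine_connection V D"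
begin

lemma affine_connection_pullback: "affine_connection U (pullback D)"
  unfolding affine_connection_def
proof (intro conjI basic(1))
  show "is_connection U (pullback D)"
    unfolding is_connection_def
  proof (intro ballI allI impI)
    fix p and X X' Y Y' :: vfield and g :: "plane \<Rightarrow> real"
    assume p: "p \<in> U" and sm: "smooth_near p X" "smooth_near p X'" "smooth_near p Y" "smooth_near p Y'" "smooth_near p g"
    note s = sm(1-4)[THEN smooth_near_push, OF p]
    note sg = smooth_near_compose_\<psi>[OF sm(5) p]
    note c = affine_connectionD[OF D maps(1)[OF p]]
    have lin: "linear (B (\<phi> p))"
      by (rule B(2)[OF maps(1)[OF p]])
    have "((\<lambda>q. g (\<psi> q)) has_derivative (\<lambda>v. frechet_derivative g (at p) (B (\<phi> p) v))) (at (\<phi> p))"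
      using has_derivative_compose[OF B(1)[OF maps(1)[OF p]], of g "frechet_derivative g (at p)"]
        smooth_near_imp_differentiable[OF sm(5)] frechet_derivative_works maps(3)[OF p] by metis
    then have gd: "frechet_derivative (\<lambda>q. g (\<psi> q)) (at (\<phi> p)) (A p v) = frechet_derivative g (at p) v" for v
      by (simp add: frechet_derivativeI BA p)
    have "smooth_near p (pullback D X Y)"
      unfolding pullback_def by (intro smooth_near_pull c(1) s p)
    moreover have "pullback D (\<lambda>q. X q + X' q) Y p = pullback D X Y p + pullback D X' Y p"
      unfolding pullback_def push_add pull_def c(2)[OF s(1,3,2)] by (rule linear_add[OF lin])
    moreover have "pullback D (\<lambda>q. g q *\<^sub>R X q) Y p = g p *\<^sub>R pullback D X Y p"
      unfolding pullback_def push_scaleR pull_def c(3)[OF s(1,3) sg] by (simp add: linear_cmul[OF lin] maps p)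
    moreover have "pullback D X (\<lambda>q. Y q + Y' q) p = pullback D X Y p + pullback D X Y' p"
      unfolding pullback_def push_add pull_def c(4)[OF s(1,3,4)] by (rule linear_add[OF lin])
    moreover have "pullback D X (\<lambda>q. g q *\<^sub>R Y q) p =
            frechet_derivative g (at p) (X p) *\<^sub>R Y p + g p *\<^sub>R pullback D X Y p"
      unfolding pullback_def push_scaleR pull_def c(5)[OF s(1,3) sg]
      by (simp add: linear_cmul[OF lin] linear_add[OF lin] maps p push_at gd BA)
    ultimately show "smooth_near p (pullback D X Y)
        \<and> pullback D (\<lambda>q. X q + X' q) Y p = pullback D X Y p + pullback D X' Y p
        \<and> pullback D (\<lambda>q. g q *\<^sub>R X q) Y p = g p *\<^sub>R pullback D X Y p
        \<and> pullback D X (\<lambda>q. Y q + Y' q) p = pullback D X Y p + pullback D X Y' p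
        \<and> pullback D X (\<lambda>q. g q *\<^sub>R Y q) p =
            frechet_derivative g (at p) (X p) *\<^sub>R Y p + g p *\<^sub>R pullback D X Y p"
      by blast
  qed
  show "torsion_free U (pullback D)"
    unfolding torsion_free_def
  proof (intro ballI allI impI)
    fix p and X Y :: vfield
    assume p: "p \<in> U" and sm: "smooth_near p X" "smooth_near p Y"
    show "pullback D X Y p - pullback D Y X p = lie_bracket X Y p"
      using affine_connectionD(6)[OF D maps(1)[OF p] smooth_near_push[OF sm(1) p] smooth_near_push[OF sm(2) p]]
      unfolding pullback_def pull_def
      by (simp add: linear_diff[OF B(2)[OF maps(1)[OF p]], symmetric] lie_bracket_push[OF p sm] BA p)
  qed
qed

lemma germ_push_pullback:
  assumes "p \<in> U"
  shows "germ_eq (\<phi> p) (push (pullback D X Y)) (D (push X) (push Y))"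
  unfolding pullback_def by (rule germ_eqI[OF basic(2) maps(1)[OF assms]]) (rule push_pull)

lemma curvature_pullback:
  assumes p: "p \<in> U" and sm: "smooth_near p X" "smooth_near p Y" "smooth_near p Z"
  shows "curvature (pullback D) X Y Z p = B (\<phi> p) (curvature D (push X) (push Y) (push Z) (\<phi> p))"
proof -
  have p': "\<phi> p \<in> V"
    using maps p by blast
  note s = sm[THEN smooth_near_push, OF p]
  note c = affine_connectionD(1)[OF affine_connection_pullback p]
  have 1: "pullback D X' (pullback D Y' Z) p = B (\<phi> p) (D (push X') (D (push Y') (push Z)) (\<phi> p))"
    if "smooth_near p X'" "smooth_near p Y'" for X' Y'
    unfolding pullback_def[of D X'] pull_def
    using that by (intro arg_cong[of _ _ "B (\<phi> p)"] germ_eq_at connection_germ[OF D p'] germ_push_pullback[OF p]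
        germ_eq_refl smooth_near_push[OF _ p] c sm)
  have 2: "pullback D (lie_bracket X Y) Z p = B (\<phi> p) (D (lie_bracket (push X) (push Y)) (push Z) (\<phi> p))"
    unfolding pullback_def[of D "lie_bracket X Y"] pull_def
    by (intro arg_cong[of _ _ "B (\<phi> p)"] germ_eq_at connection_germ[OF D p'] germ_push_lie_bracket[OF p]
        germ_eq_refl smooth_near_push[OF _ p] smooth_near_lie_bracket sm)
  show ?thesis
    unfolding curvature_def 1[OF sm(1,2)] 1[OF sm(2,1)] 2
    by (simp add: linear_diff[OF B(2)[OF p']])
qed

text \<open>The pointwise transformation law, applied at every point near \<open>p\<close>, becomes
  an identity of germs that may be differentiated once more.\<close>

lemma germ_push_curvature:
  assumes p: "p \<in> U" and sm: "smooth_near p X" "smooth_near p Y" "smooth_near p Z"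
  shows "germ_eq (\<phi> p) (push (curvature (pullback D) X Y Z)) (curvature D (push X) (push Y) (push Z))"
  unfolding germ_eq_def
  using sm[THEN eventually_smooth_near, THEN eventually_\<psi>[OF p]]
proof eventually_elim
  case (elim q)
  then show ?case
    using curvature_pullback[of "\<psi> q" X Y Z] by (simp add: maps push_def AB)
qed

lemma nabla_curvature_pullback:
  assumes p: "p \<in> U" and sm: "smooth_near p W" "smooth_near p X" "smooth_near p Y" "smooth_near p Z"
  shows "nabla_curvature (pullback D) W X Y Z p =
    B (\<phi> p) (nabla_curvature D (push W) (push X) (push Y) (push Z) (\<phi> p))"
proof -
  have p': "\<phi> p \<in> V"
    using maps p by blast
  note s = sm[THEN smooth_near_push, OF p]
  note c = affine_connectionD(1)[OF affine_connection_pullback p sm(1)]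
  have 1: "pullback D W (curvature (pullback D) X Y Z) p =
      B (\<phi> p) (D (push W) (curvature D (push X) (push Y) (push Z)) (\<phi> p))"
    unfolding pullback_def[of D W] pull_def
    by (intro arg_cong[of _ _ "B (\<phi> p)"] germ_eq_at connection_germ[OF D p'] germ_push_curvature[OF p]
        germ_eq_refl smooth_near_push[OF _ p] smooth_near_curvature[OF affine_connection_pullback p] sm)
  note r = curvature_germ[OF D p']
  have 2: "curvature (pullback D) (pullback D W X) Y Z p = B (\<phi> p) (curvature D (D (push W) (push X)) (push Y) (push Z) (\<phi> p))"
    "curvature (pullback D) X (pullback D W Y) Z p = B (\<phi> p) (curvature D (push X) (D (push W) (push Y)) (push Z) (\<phi> p))"
    "curvature (pullback D) X Y (pullback D W Z) p = B (\<phi> p) (curvature D (push X) (push Y) (D (push W) (push Z)) (\<phi> p))"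
    by (subst curvature_pullback[OF p],
      (intro c sm)+, intro arg_cong[of _ _ "B (\<phi> p)"] r germ_push_pullback[OF p] germ_eq_refl smooth_near_push[OF _ p] c sm)+
  show ?thesis
    unfolding nabla_curvature_def 1 2
    by (simp add: linear_diff[OF B(2)[OF p']])
qed

text \<open>The acceleration is defined by a coordinate formula but transforms as a vector.
  Differentiating the image curve twice produces \<open>hess\<close> on the velocity; pushing
  forward the constant velocity field gives a nonconstant field, whose derivative contributes the
  same term.\<close>

lemma covariant_acceleration_pullback:
  assumes I: "open I" "smooth_on I \<gamma>" and mem: "\<And>t. t \<in> I \<Longrightarrow> \<gamma> t \<in> U" and t: "t \<in> I"
  shows "velocity (\<lambda>t. \<phi> (\<gamma> t)) t = A (\<gamma> t) (velocity \<gamma> t)"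
    and "covariant_acceleration D (\<lambda>t. \<phi> (\<gamma> t)) t = A (\<gamma> t) (covariant_acceleration (pullback D) \<gamma> t)"
proof -
  have v: "(\<gamma> has_vector_derivative velocity \<gamma> t) (at t)" if "t \<in> I" for t
    using smooth_on_imp_differentiable[OF I(2) that] by (simp add: velocity_def vector_derivative_works)
  have vel: "velocity (\<lambda>t. \<phi> (\<gamma> t)) t = A (\<gamma> t) (velocity \<gamma> t)" if t: "t \<in> I" for t
  proof -
    have "((\<lambda>t. \<phi> (\<gamma> t)) has_derivative (\<lambda>h. A (\<gamma> t) (h *\<^sub>R velocity \<gamma> t))) (at t)"
      by (rule has_derivative_compose[OF v[OF t, unfolded has_vector_derivative_def] A(1)[OF mem[OF t]]])
    then have "((\<lambda>t. \<phi> (\<gamma> t)) has_vector_derivative A (\<gamma> t) (velocity \<gamma> t)) (at t)"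
      unfolding has_vector_derivative_def linear_cmul[OF A(2)[OF mem[OF t]]] .
    then show ?thesis
      unfolding velocity_def by (rule vector_derivative_at)
  qed
  show "velocity (\<lambda>t. \<phi> (\<gamma> t)) t = A (\<gamma> t) (velocity \<gamma> t)"
    by (rule vel[OF t])
  let ?p = "\<gamma> t" and ?v = "velocity \<gamma> t"
  let ?w = "vector_derivative (velocity \<gamma>) (at t)"
  have p: "?p \<in> U"
    using mem t by blast
  have "smooth_on I (velocity \<gamma>)"
  proof -
    have "smooth_on I (\<lambda>t. frechet_derivative \<gamma> (at t) 1)"
      by (rule smooth_on_frechet_derivative[OF I(2)])
    moreover have "frechet_derivative \<gamma> (at t) 1 = velocity \<gamma> t" if "t \<in> I" for t
      using frechet_derivativeI[OF v[OF that, unfolded has_vector_derivative_def]] by simp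
    ultimately show ?thesis
      using smooth_on_cong[OF I(1), of "\<lambda>t. frechet_derivative \<gamma> (at t) 1" "velocity \<gamma>"] by simp
  qed
  then have w: "(velocity \<gamma> has_vector_derivative ?w) (at t)"
    using t by (simp add: smooth_on_imp_differentiable flip: vector_derivative_works)
  have w12: "((\<lambda>t. fst (velocity \<gamma> t)) has_derivative (\<lambda>h. h * fst ?w)) (at t)"
    "((\<lambda>t. snd (velocity \<gamma> t)) has_derivative (\<lambda>h. h * snd ?w)) (at t)"
    using w unfolding has_vector_derivative_def
    by (auto intro!: derivative_eq_intros simp: fun_eq_iff)
  have Ae: "((\<lambda>t. A (\<gamma> t) e) has_derivative (\<lambda>h. h *\<^sub>R frechet_derivative (\<lambda>q. A q e) (at ?p) ?v)) (at t)" for e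
    using has_derivative_compose[OF v[OF t, unfolded has_vector_derivative_def] smooth_on_has_derivative[OF smooth_on_A p]]
    unfolding linear_cmul[OF linear_frechet_derivative[OF smooth_on_imp_differentiable[OF smooth_on_A p]]] .
  have "((\<lambda>t. fst (velocity \<gamma> t) *\<^sub>R A (\<gamma> t) (1, 0) + snd (velocity \<gamma> t) *\<^sub>R A (\<gamma> t) (0, 1)) has_derivative
     (\<lambda>h. (fst ?v *\<^sub>R (h *\<^sub>R frechet_derivative (\<lambda>q. A q (1, 0)) (at ?p) ?v) + (h * fst ?w) *\<^sub>R A ?p (1, 0))
       + (snd ?v *\<^sub>R (h *\<^sub>R frechet_derivative (\<lambda>q. A q (0, 1)) (at ?p) ?v) + (h * snd ?w) *\<^sub>R A ?p (0, 1)))) (at t)"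
    by (intro has_derivative_add has_derivative_scaleR w12 Ae)
  moreover have "(\<lambda>h. (fst ?v *\<^sub>R (h *\<^sub>R frechet_derivative (\<lambda>q. A q (1, 0)) (at ?p) ?v) + (h * fst ?w) *\<^sub>R A ?p (1, 0))
       + (snd ?v *\<^sub>R (h *\<^sub>R frechet_derivative (\<lambda>q. A q (0, 1)) (at ?p) ?v) + (h * snd ?w) *\<^sub>R A ?p (0, 1)))
      = (\<lambda>h. h *\<^sub>R (hess ?p ?v ?v + A ?p ?w))"
    unfolding hess_def A_expand[OF p, of ?w] by (auto simp: fun_eq_iff algebra_simps)
  ultimately have "((\<lambda>t. fst (velocity \<gamma> t) *\<^sub>R A (\<gamma> t) (1, 0) + snd (velocity \<gamma> t) *\<^sub>R A (\<gamma> t) (0, 1))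
      has_vector_derivative hess ?p ?v ?v + A ?p ?w) (at t)"
    unfolding has_vector_derivative_def by simp
  then have "(velocity (\<lambda>t. \<phi> (\<gamma> t)) has_vector_derivative hess ?p ?v ?v + A ?p ?w) (at t)"
    by (rule has_vector_derivative_transform_within_open[OF _ I(1) t])
      (subst vel, assumption, rule A_expand[symmetric], rule mem)
  then have acc: "vector_derivative (velocity (\<lambda>t. \<phi> (\<gamma> t))) (at t) = hess ?p ?v ?v + A ?p ?w"
    by (rule vector_derivative_at)
  have p': "\<phi> ?p \<in> V"
    using maps p by blast
  have c: "smooth_near q (\<lambda>_. u)" for q u :: plane
    by (rule smooth_near_const)
  have "D (push (\<lambda>_. ?v)) (push (\<lambda>_. ?v)) (\<phi> ?p) = hess ?p ?v ?v + D (\<lambda>_. A ?p ?v) (\<lambda>_. A ?p ?v) (\<phi> ?p)"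
    unfolding connection_coordinates[OF D p' smooth_near_push[OF c p] smooth_near_push[OF c p]]
      push_at[OF p] derivative_push[OF p c]
    by (simp add: christoffel_def linear_0[OF A(2)[OF p]])
  then have "A ?p (pullback D (\<lambda>_. ?v) (\<lambda>_. ?v) ?p) = hess ?p ?v ?v + D (\<lambda>_. A ?p ?v) (\<lambda>_. A ?p ?v) (\<phi> ?p)"
    unfolding pullback_def pull_def using AB[OF p'] by (simp add: maps p)
  then show "covariant_acceleration D (\<lambda>t. \<phi> (\<gamma> t)) t = A (\<gamma> t) (covariant_acceleration (pullback D) \<gamma> t)"
    unfolding covariant_acceleration_def acc vel[OF t] linear_add[OF A(2)[OF p]] by simp
qed

lemma geodesic_leaf_pullback:
  assumes L: "L \<subseteq> U" "geodesic_leaf D (\<phi> ` L)"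
  shows "geodesic_leaf (pullback D) L"
  unfolding geodesic_leaf_def
proof (intro allI impI)
  fix \<gamma> and a b :: real
  assume ab: "a < b" and \<gamma>: "smooth_on {a<..<b} \<gamma>" "\<forall>t\<in>{a<..<b}. \<gamma> t \<in> L \<and> velocity \<gamma> t \<noteq> 0"
  have mem: "\<gamma> t \<in> U" if "t \<in> {a<..<b}" for t
    using L(1) \<gamma>(2) that by blast
  have pb: "velocity (\<lambda>t. \<phi> (\<gamma> t)) t = A (\<gamma> t) (velocity \<gamma> t)"
      "covariant_acceleration D (\<lambda>t. \<phi> (\<gamma> t)) t = A (\<gamma> t) (covariant_acceleration (pullback D) \<gamma> t)"
    if "t \<in> {a<..<b}" for t
    using covariant_acceleration_pullback[OF open_greaterThanLessThan \<gamma>(1) mem, of t] that by blast+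
  have inj: "u = v" if "A (\<gamma> t) u = A (\<gamma> t) v" "t \<in> {a<..<b}" for t u v
    using BA[OF mem[OF that(2)]] that(1) by metis
  have "smooth_on {a<..<b} (\<lambda>t. \<phi> (\<gamma> t))"
    by (rule smooth_on_compose[OF _ basic(1) \<gamma>(1) basic(3) mem]) auto
  moreover have "\<phi> (\<gamma> t) \<in> \<phi> ` L \<and> velocity (\<lambda>t. \<phi> (\<gamma> t)) t \<noteq> 0" if t: "t \<in> {a<..<b}" for t
  proof -
    have "A (\<gamma> t) (velocity \<gamma> t) \<noteq> A (\<gamma> t) 0"
      using inj[OF _ t] \<gamma>(2) t by blast
    then show ?thesis
      using \<gamma>(2) t by (simp add: pb(1) linear_0[OF A(2)[OF mem[OF t]]])
  qed
  ultimately have geo: "unparametrized_geodesic D {a<..<b} (\<lambda>t. \<phi> (\<gamma> t))"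
    using L(2) ab unfolding geodesic_leaf_def by blast
  show "unparametrized_geodesic (pullback D) {a<..<b} \<gamma>"
    unfolding unparametrized_geodesic_def
  proof
    fix t assume t: "t \<in> {a<..<b}"
    then obtain c where "covariant_acceleration D (\<lambda>t. \<phi> (\<gamma> t)) t = c *\<^sub>R velocity (\<lambda>t. \<phi> (\<gamma> t)) t"
      using geo unfolding unparametrized_geodesic_def by blast
    then have "A (\<gamma> t) (covariant_acceleration (pullback D) \<gamma> t) = A (\<gamma> t) (c *\<^sub>R velocity \<gamma> t)"
      using t by (simp add: pb linear_cmul[OF A(2)[OF mem[OF t]]])
    then show "\<exists>c. covariant_acceleration (pullback D) \<gamma> t = c *\<^sub>R velocity \<gamma> t"
      using inj t by blast
  qed
qed

end

lemma affine_symmetric_pullback: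
  assumes "affine_symmetric V D"
  shows "affine_symmetric U (pullback D)"
proof -
  have D: "affine_connection V D"
    using assms by (simp add: affine_symmetric_def)
  show ?thesis
    unfolding affine_symmetric_def
  proof (intro conjI affine_connection_pullback[OF D] ballI allI impI)
    fix p and W X Y Z :: vfield
    assume p: "p \<in> U" and sm: "smooth_near p W" "smooth_near p X" "smooth_near p Y" "smooth_near p Z"
    have "nabla_curvature D (push W) (push X) (push Y) (push Z) (\<phi> p) = 0"
      using assms maps(1)[OF p] sm[THEN smooth_near_push, OF p] unfolding affine_symmetric_def by blast
    then show "nabla_curvature (pullback D) W X Y Z p = 0"
      by (simp add: nabla_curvature_pullback[OF D p sm] linear_0[OF B(2)[OF maps(1)[OF p]]])
  qed
qed

end

lemma geodesic_leaf_subset: "geodesic_leaf D L \<Longrightarrow> L' \<subseteq> L \<Longrightarrow> geodesic_leaf D L'"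
  unfolding geodesic_leaf_def by blast

text \<open>The equivalence matches leaves of the web on the smaller set \<open>V'\<close>, whereas
  geodesicity is known for leaves on \<open>V\<close>; a connected part of a level set lies in one
  of its components.\<close>

lemma web_leaves_extend:
  assumes "L \<in> web_leaves V' gs" "V' \<subseteq> V"
  obtains L' where "L' \<in> web_leaves V gs" "L \<subseteq> L'"
proof -
  obtain g c where g: "g \<in> set gs" "L \<in> components {p\<in>V'. g p = c}"
    using assms(1) unfolding web_leaves_def by blast
  have "L \<subseteq> {p\<in>V. g p = c}" "connected L" "L \<noteq> {}"
    using in_components_subset[OF g(2)] in_components_connected[OF g(2)] in_components_nonempty[OF g(2)] assms(2)
    by auto
  then obtain L' where "L' \<in> components {p\<in>V. g p = c}" "L \<subseteq> L'"
    using exists_component_superset[of L "{p\<in>V. g p = c}"] in_components_nonempty by blast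
  then show ?thesis
    using g(1) that unfolding web_leaves_def by blast
qed

text \<open>It suffices that every leaf of \<open>fs\<close> is mapped into some leaf of
  \<open>gs\<close>; no correspondence between the web functions, nor their order, is
  involved.\<close>

lemma geodesic_web_pullback:
  assumes D: "affine_symmetric V D" "geodesic_web V D gs" and eq: "webs_equivalent_near p U fs V gs"
    and web: "four_web U fs"
  obtains W D' where "p \<in> W" "W \<subseteq> U" "affine_symmetric W D'" "geodesic_web W D' fs"
proof -
  obtain U' V' \<phi> where *: "p \<in> U'" "U' \<subseteq> U" "V' \<subseteq> V" "diffeomorphism U' V' \<phi>"
      "(\<lambda>L. \<phi> ` L) ` web_leaves U' fs = web_leaves V' gs"
    using eq unfolding webs_equivalent_near_def by (elim exE conjE) (rule that)
  interpret diffeo U' V' \<phi>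
    using *(4) by unfold_locales
  have sym: "affine_symmetric V' D"
    by (rule affine_symmetric_subset[OF D(1) basic(2) *(3)])
  then have con: "affine_connection V' D"
    by (simp add: affine_symmetric_def)
  have "geodesic_leaf (pullback D) L" if L: "L \<in> web_leaves U' fs" for L
  proof (rule geodesic_leaf_pullback[OF con])
    show "L \<subseteq> U'"
      using L unfolding web_leaves_def by (auto dest!: in_components_subset)
    have "\<phi> ` L \<in> web_leaves V' gs"
      using L *(5) by blast
    then obtain L' where "L' \<in> web_leaves V gs" "\<phi> ` L \<subseteq> L'"
      by (rule web_leaves_extend[OF _ *(3)])
    then show "geodesic_leaf D (\<phi> ` L)"
      using D(2) geodesic_leaf_subset unfolding geodesic_web_def by blast
  qed
  then have "geodesic_web U' (pullback D) fs"
    using four_web_subset[OF web basic(1) *(2)] by (simp add: geodesic_web_def)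
  then show ?thesis
    using that *(1,2) affine_symmetric_pullback[OF sym] by blast
qed

section \<open>The projective structure of a web\<close>

lemma agrees_on_subset: "agrees_on U D D' \<Longrightarrow> W \<subseteq> U \<Longrightarrow> agrees_on W D D'"
  unfolding agrees_on_def by blast

text \<open>A one-form shifts \<open>r1\<close> and \<open>r2\<close> by its two components and
  leaves \<open>a\<close> and \<open>b\<close> fixed, so the connections with given
  \<open>a\<close>, \<open>b\<close> make up one projective class.\<close>

lemma projectively_equivalent_web_connection_iff:
  assumes W: "open W" and sm: "smooth_on W r1" "smooth_on W r2" and D: "agrees_on W D (web_connection a b r1 r2)"
  shows "projectively_equivalent W D D' \<longleftrightarrow>
    (\<exists>s1 s2. smooth_on W s1 \<and> smooth_on W s2 \<and> agrees_on W D' (web_connection a b s1 s2))"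
proof
  assume "projectively_equivalent W D D'"
  then obtain \<rho> where \<rho>: "one_form W \<rho>"
    "\<And>p X Y. p \<in> W \<Longrightarrow> smooth_near p X \<Longrightarrow> smooth_near p Y \<Longrightarrow>
      D X Y p - D' X Y p = \<rho> p (X p) *\<^sub>R Y p + \<rho> p (Y p) *\<^sub>R X p"
    unfolding projectively_equivalent_def by blast
  define s1 where "s1 = (\<lambda>p. r1 p - \<rho> p (1, 0))"
  define s2 where "s2 = (\<lambda>p. r2 p - \<rho> p (0, 1))"
  have "smooth_on W s1" "smooth_on W s2"
    unfolding s1_def s2_def using \<rho>(1) sm W by (auto simp: one_form_def intro!: smooth_on_diff)
  moreover have "agrees_on W D' (web_connection a b s1 s2)"
    unfolding agrees_on_def
  proof (intro ballI allI impI)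
    fix p and X Y :: vfield
    assume p: "p \<in> W" and s: "smooth_near p X" "smooth_near p Y"
    have lin: "linear (\<rho> p)"
      using \<rho>(1) p by (simp add: one_form_def)
    have e: "\<rho> p v = fst v * \<rho> p (1, 0) + snd v * \<rho> p (0, 1)" for v
      using linear_add[OF lin, of "fst v *\<^sub>R (1, 0)" "snd v *\<^sub>R (0, 1)"]
      by (simp only: linear_cmul[OF lin]) simp
    have "D' X Y p = web_connection a b r1 r2 X Y p - (\<rho> p (X p) *\<^sub>R Y p + \<rho> p (Y p) *\<^sub>R X p)"
      using \<rho>(2)[OF p s] D p s unfolding agrees_on_def by (metis diff_diff_eq2 add_diff_cancel_left' diff_add_cancel)
    also have "\<dots> = web_connection a b s1 s2 X Y p"
      unfolding e[of "X p"] e[of "Y p"]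
      by (simp add: web_connection_def s1_def s2_def prod_eq_iff algebra_simps)
    finally show "D' X Y p = web_connection a b s1 s2 X Y p" .
  qed
  ultimately show "\<exists>s1 s2. smooth_on W s1 \<and> smooth_on W s2 \<and> agrees_on W D' (web_connection a b s1 s2)"
    by blast
next
  assume "\<exists>s1 s2. smooth_on W s1 \<and> smooth_on W s2 \<and> agrees_on W D' (web_connection a b s1 s2)"
  then obtain s1 s2 where s: "smooth_on W s1" "smooth_on W s2" "agrees_on W D' (web_connection a b s1 s2)"
    by blast
  define \<rho> where "\<rho> = (\<lambda>p v. fst v * (r1 p - s1 p) + snd v * (r2 p - s2 p))"
  have "one_form W \<rho>"
    unfolding one_form_def \<rho>_def
    using W sm s by (auto intro!: smooth_on_add smooth_on_mult smooth_on_const smooth_on_diff linearI simp: algebra_simps)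
  moreover have "D X Y p - D' X Y p = \<rho> p (X p) *\<^sub>R Y p + \<rho> p (Y p) *\<^sub>R X p"
    if "p \<in> W" "smooth_near p X" "smooth_near p Y" for p X Y
  proof -
    have "D X Y p = web_connection a b r1 r2 X Y p" "D' X Y p = web_connection a b s1 s2 X Y p"
      using D s(3) that unfolding agrees_on_def by blast+
    then show ?thesis
      by (simp add: web_connection_def \<rho>_def prod_eq_iff algebra_simps)
  qed
  ultimately show "projectively_equivalent W D D'"
    unfolding projectively_equivalent_def by blast
qed

section \<open>The projective structure of the given web and the two equivalences\<close>

context
  fixes U :: "plane set" and f3 f4 :: "plane \<Rightarrow> real"
  assumes web: "four_web U [fst, snd, f3, f4]"
begin

lemma open_U: "open U"
  using web by (simp add: four_web_def)

lemma projectively_equivalent_iff_geodesic_web: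
  assumes W: "open W" "W \<subseteq> U" and D: "affine_connection W D" "geodesic_web W D [fst, snd, f3, f4]"
    and D': "affine_connection W D'"
  shows "projectively_equivalent W D D' \<longleftrightarrow> geodesic_web W D' [fst, snd, f3, f4]"
proof -
  have web': "four_web W [fst, snd, f3, f4]"
    by (rule four_web_subset[OF web W])
  show ?thesis
    using D(2) projectively_equivalent_web_connection_iff[OF W(1), of _ _ D]
    unfolding geodesic_web_iff[OF D(1) web'] geodesic_web_iff[OF D' web'] by blast
qed

lemma web_connection_in_projective_structure:
  assumes "open W" "W \<subseteq> U"
  shows "affine_connection W (web_connection (alpha f3 f4) (beta f3 f4) (\<lambda>_. 0) (\<lambda>_. 0))"
    and "geodesic_web W (web_connection (alpha f3 f4) (beta f3 f4) (\<lambda>_. 0) (\<lambda>_. 0)) [fst, snd, f3, f4]"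
proof -
  have web': "four_web W [fst, snd, f3, f4]"
    by (rule four_web_subset[OF web assms])
  show con: "affine_connection W (web_connection (alpha f3 f4) (beta f3 f4) (\<lambda>_. 0) (\<lambda>_. 0))"
    by (intro affine_connection_web_connection assms(1) smooth_on_alpha_beta[OF web'] smooth_on_const)
  show "geodesic_web W (web_connection (alpha f3 f4) (beta f3 f4) (\<lambda>_. 0) (\<lambda>_. 0)) [fst, snd, f3, f4]"
    unfolding geodesic_web_iff[OF con web'] using smooth_on_const[of W "0::real"] by (auto simp: agrees_on_def)
qed

text \<open>Resolves the definite description. The class of the connection with
  \<open>r1 = r2 = 0\<close> exists; and any class with the required property contains its
  representative, which therefore makes the web geodesic and has the same class.\<close>

lemma web_projective_structure_eq:
  "web_projective_structure U [fst, snd, f3, f4] =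
    {D. affine_connection U D \<and> geodesic_web U D [fst, snd, f3, f4]}"
  unfolding web_projective_structure_def
proof (rule the_equality)
  note eq = projectively_equivalent_iff_geodesic_web[OF open_U subset_refl]
  note D0 = web_connection_in_projective_structure[OF open_U subset_refl]
  show "projective_structure U {D. affine_connection U D \<and> geodesic_web U D [fst, snd, f3, f4]} \<and>
      (\<forall>D\<in>{D. affine_connection U D \<and> geodesic_web U D [fst, snd, f3, f4]}. geodesic_web U D [fst, snd, f3, f4])"
    unfolding projective_structure_def using eq[OF D0] D0 by blast
  fix P assume P: "projective_structure U P \<and> (\<forall>D\<in>P. geodesic_web U D [fst, snd, f3, f4])"
  then obtain D where D: "affine_connection U D" "P = {D'. affine_connection U D' \<and> projectively_equivalent U D D'}"
    unfolding projective_structure_def by blast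
  have "one_form U (\<lambda>_ _. 0)"
    by (auto simp: one_form_def smooth_on_const linearI)
  then have "projectively_equivalent U D D"
    unfolding projectively_equivalent_def by (intro exI[of _ "\<lambda>_ _. 0"]) simp
  then have "geodesic_web U D [fst, snd, f3, f4]"
    using D P by blast
  then show "P = {D. affine_connection U D \<and> geodesic_web U D [fst, snd, f3, f4]}"
    using D eq[OF D(1)] by blast
qed

text \<open>A connection on \<open>W\<close> that makes the web geodesic need not extend to
  \<open>U\<close>, but it is projectively equivalent over \<open>W\<close> to the restriction of
  the connection with \<open>r1 = r2 = 0\<close>. Conversely, members of the structure on
  \<open>U\<close> restrict because their parameters do.\<close>

lemma restrict_web_projective_structure:
  assumes W: "open W" "W \<subseteq> U"
  shows "restrict_projective W (web_projective_structure U [fst, snd, f3, f4]) =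
    {D. affine_connection W D \<and> geodesic_web W D [fst, snd, f3, f4]}"
proof -
  have restr: "affine_connection W D \<and> geodesic_web W D [fst, snd, f3, f4]"
    if "affine_connection U D" "geodesic_web U D [fst, snd, f3, f4]" for D
  proof -
    have con: "affine_connection W D"
      by (rule affine_connection_subset[OF that(1) W])
    have web': "four_web W [fst, snd, f3, f4]"
      by (rule four_web_subset[OF web W])
    show ?thesis
      using that(2) con W(2) smooth_on_subset agrees_on_subset
      unfolding geodesic_web_iff[OF that(1) web] geodesic_web_iff[OF con web'] by blast
  qed
  show ?thesis
    unfolding restrict_projective_def web_projective_structure_eq
    using restr projectively_equivalent_iff_geodesic_web[OF W]
      web_connection_in_projective_structure[OF open_U subset_refl] by blast
qed

lemma star_conditions_if_symmetric:
  assumes W: "W \<subseteq> U" "p \<in> W" and D: "affine_symmetric W D" "geodesic_web W D [fst, snd, f3, f4]"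
  defines "a \<equiv> alpha f3 f4" and "b \<equiv> beta f3 f4"
  shows "dx (dx a) p + 2 * dy (dx b) p = b p * dx a p + 2 * b p * dy b p
          \<and> 2 * dy (dx a) p + dy (dy b) p = 2 * a p * dx a p + a p * dy b p"
proof -
  have con: "affine_connection W D" and web': "four_web W [fst, snd, f3, f4]"
    using D by (auto simp: affine_symmetric_def geodesic_web_def)
  obtain r1 r2 where r: "smooth_on W r1" "smooth_on W r2" "agrees_on W D (web_connection a b r1 r2)"
    using D(2) unfolding geodesic_web_iff[OF con web'] a_def b_def by blast
  interpret web_like_connection W D a b r1 r2
    using con r smooth_on_alpha_beta[OF web'] by unfold_locales (auto simp: a_def b_def)
  show ?thesis
    using star_if_affine_symmetric[OF D(1) W(2)] by blast
qed

lemma symmetric_if_star_conditions: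
  assumes star: "star_conditions U f3 f4" and p: "p \<in> U"
  obtains W D where "open W" "p \<in> W" "W \<subseteq> U" "affine_symmetric W D" "geodesic_web W D [fst, snd, f3, f4]"
proof -
  obtain W r1 r2 where W: "open W" "p \<in> W" "W \<subseteq> U" and r: "smooth_on W r1" "smooth_on W r2"
    and sym: "affine_symmetric W (web_connection (alpha f3 f4) (beta f3 f4) r1 r2)"
    using flat_web_connection_exists[OF open_U p smooth_on_alpha_beta[OF web]] star
    unfolding star_conditions_def Let_def by blast
  have con: "affine_connection W (web_connection (alpha f3 f4) (beta f3 f4) r1 r2)"
    using sym by (simp add: affine_symmetric_def)
  have "geodesic_web W (web_connection (alpha f3 f4) (beta f3 f4) r1 r2) [fst, snd, f3, f4]"
    unfolding geodesic_web_iff[OF con four_web_subset[OF web W(1,3)]] using r by (auto simp: agrees_on_def)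
  then show ?thesis
    using that W sym by blast
qed

lemma locally_symmetric_iff:
  "locally_symmetric_projective U (web_projective_structure U [fst, snd, f3, f4]) \<longleftrightarrow> star_conditions U f3 f4"
proof
  assume *: "locally_symmetric_projective U (web_projective_structure U [fst, snd, f3, f4])"
  show "star_conditions U f3 f4"
    unfolding star_conditions_def Let_def
  proof
    fix p assume "p \<in> U"
    then obtain W D where W: "open W" "p \<in> W" "W \<subseteq> U"
      and D: "D \<in> restrict_projective W (web_projective_structure U [fst, snd, f3, f4])" "affine_symmetric W D"
      using * unfolding locally_symmetric_projective_def symmetric_projective_def by blast
    then show "dx (dx (alpha f3 f4)) p + 2 * dy (dx (beta f3 f4)) p =
          beta f3 f4 p * dx (alpha f3 f4) p + 2 * beta f3 f4 p * dy (beta f3 f4) p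
        \<and> 2 * dy (dx (alpha f3 f4)) p + dy (dy (beta f3 f4)) p =
          2 * alpha f3 f4 p * dx (alpha f3 f4) p + alpha f3 f4 p * dy (beta f3 f4) p"
      using restrict_web_projective_structure[OF W(1,3)] by (intro star_conditions_if_symmetric) auto
  qed
next
  assume star: "star_conditions U f3 f4"
  show "locally_symmetric_projective U (web_projective_structure U [fst, snd, f3, f4])"
    unfolding locally_symmetric_projective_def symmetric_projective_def
  proof
    fix p assume "p \<in> U"
    then obtain W D where W: "open W" "p \<in> W" "W \<subseteq> U" "affine_symmetric W D" "geodesic_web W D [fst, snd, f3, f4]"
      using symmetric_if_star_conditions[OF star] by blast
    then have "D \<in> restrict_projective W (web_projective_structure U [fst, snd, f3, f4])"
      unfolding restrict_web_projective_structure[OF W(1,3)] by (simp add: affine_symmetric_def)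
    then show "\<exists>W. open W \<and> p \<in> W \<and> W \<subseteq> U \<and>
        (\<exists>D\<in>restrict_projective W (web_projective_structure U [fst, snd, f3, f4]). affine_symmetric W D)"
      using W by blast
  qed
qed

lemma locally_equivalent_iff:
  "locally_equivalent_to_geodesic_web_on_symmetric_surface U [fst, snd, f3, f4] \<longleftrightarrow> star_conditions U f3 f4"
proof
  assume *: "locally_equivalent_to_geodesic_web_on_symmetric_surface U [fst, snd, f3, f4]"
  show "star_conditions U f3 f4"
    unfolding star_conditions_def Let_def
  proof
    fix p assume "p \<in> U"
    then obtain V D gs where "affine_symmetric V D" "geodesic_web V D gs"
        "webs_equivalent_near p U [fst, snd, f3, f4] V gs"
      using * unfolding locally_equivalent_to_geodesic_web_on_symmetric_surface_def by blast
    then obtain W D' where "p \<in> W" "W \<subseteq> U" "affine_symmetric W D'" "geodesic_web W D' [fst, snd, f3, f4]"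
      using geodesic_web_pullback web by metis
    then show "dx (dx (alpha f3 f4)) p + 2 * dy (dx (beta f3 f4)) p =
          beta f3 f4 p * dx (alpha f3 f4) p + 2 * beta f3 f4 p * dy (beta f3 f4) p
        \<and> 2 * dy (dx (alpha f3 f4)) p + dy (dy (beta f3 f4)) p =
          2 * alpha f3 f4 p * dx (alpha f3 f4) p + alpha f3 f4 p * dy (beta f3 f4) p"
      by (intro star_conditions_if_symmetric)
  qed
next
  assume star: "star_conditions U f3 f4"
  show "locally_equivalent_to_geodesic_web_on_symmetric_surface U [fst, snd, f3, f4]"
    unfolding locally_equivalent_to_geodesic_web_on_symmetric_surface_def
  proof
    fix p assume "p \<in> U"
    then obtain W D where W: "open W" "p \<in> W" "W \<subseteq> U" "affine_symmetric W D" "geodesic_web W D [fst, snd, f3, f4]"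
      using symmetric_if_star_conditions[OF star] by blast
    \<comment> \<open>The web itself on \<open>W\<close> serves as the geodesic web, with the
      identity as equivalence. The formal inverse is the identity only on \<open>W\<close>.\<close>
    have "smooth_on W (inv_into W (\<lambda>q. q))"
      using smooth_on_cong[OF W(1), of "inv_into W (\<lambda>q. q)" "\<lambda>q. q"] smooth_on_ident
      by (simp add: inv_into_f_eq)
    then have "diffeomorphism W W (\<lambda>q. q)"
      using W(1) by (auto simp: diffeomorphism_def smooth_on_ident bij_betw_def)
    then have "webs_equivalent_near p U [fst, snd, f3, f4] W [fst, snd, f3, f4]"
      unfolding webs_equivalent_near_def using W(2,3)
      by (intro exI[of _ W] exI[of _ "\<lambda>q. q"]) auto
    then show "\<exists>V D gs. affine_symmetric V D \<and> geodesic_web V D gs \<and> webs_equivalent_near p U [fst, snd, f3, f4] V gs"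
      using W(4,5) by blast
  qed
qed

end

theorem theorem10:
  fixes U :: "plane set" and f3 f4 :: "plane \<Rightarrow> real"
  assumes "four_web U [fst, snd, f3, f4]"
  shows "(locally_symmetric_projective U (web_projective_structure U [fst, snd, f3, f4])
            \<longleftrightarrow> star_conditions U f3 f4)
       \<and> (locally_equivalent_to_geodesic_web_on_symmetric_surface U [fst, snd, f3, f4]
            \<longleftrightarrow> star_conditions U f3 f4)"
  using locally_symmetric_iff[OF assms] locally_equivalent_iff[OF assms] by blast

end
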